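(* Let $\alpha>0$, $a>0$, $b>0$ be constants, let $W\ge 0$ be a random variable such that for some $x_0>0$, $\mathbb{P}(W>x)=a x^{-\alpha}$ for all $x\ge x_0$, and let $G(n,\alpha)$ be the random graph on $\{1,\dots,n\}$ with i.i.d. vertex weights $W_1,\dots,W_n$ distributed as $W$ in which, conditionally on the weights, distinct vertices $i,j$ are joined independently with probability $1-\exp(-bW_iW_j/n)$. Let $\omega(G(n,\alpha))$ be the number of vertices in a largest clique of $G(n,\alpha)$. (i) If $0<\alpha<2$, then $$\omega(G(n,\alpha))=(c+o_{\mathrm p}(1))\,n^{1-\alpha/2}(\log n)^{-\alpha/2},\qquad\text{where } c=a\,b^{\alpha/2}(1-\alpha/2)^{-\alpha/2}.$$ (ii) If $\alpha=2$, then $\omega(G(n,\alpha))=O_{\mathrm p}(1)$; that is, for every $\varepsilon>0$ there exists a constant $C_\varepsilon$ such that $\mathbb{P}(\omega(G(n,\alpha))>C_\varepsilon)\le\varepsilon$ for every $n$. However, there is no fixed finite bound $C$ such that $\omega(G(n,\alpha))\le C$ with high probability. (iii) If $\alpha>2$, then $\omega(G(n,\alpha))\in\{2,3\}$ with high probability. Moreover, the probabilities of each of the events $\omega(G(n,\alpha))=2$ and $\omega(G(n,\alpha))=3$ tend to positive limits, given by $$\mathbb{P}(\omega(G(n,\alpha))=2)\to e^{-\frac16\left(b\,\mathbb{E}(W^2)\right)^3},\qquad \mathbb{P}(\omega(G(n,\alpha))=3)\to 1-e^{-\frac16\left(b\,\mathbb{E}(W^2)\right)^3}.$$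
   Context: The model: each vertex $i\in\{1,\dots,n\}$ gets a weight $W_i$; the $W_i$ are i.i.d. copies of a nonnegative random variable $W$ with $\mathbb{P}(W>x)=ax^{-\alpha}$ for $x\ge x_0$, where $a,\alpha,x_0>0$ are constants (the distribution below $x_0$ is arbitrary). Conditionally on $W_1,\dots,W_n$, each pair $\{i,j\}$ with $1\le i<j\le n$ is joined by an edge with probability $p_{ij}=1-\exp(-\lambda_{ij})$, $\lambda_{ij}=bW_iW_j/n$, independently for all pairs, where $b>0$ is a constant. The resulting simple graph is $G(n,\alpha)$. The constants $a,b,\alpha$ and the distribution of $W$ are fixed and $n\to\infty$. A clique is a set of pairwise adjacent vertices. "With high probability" means with probability tending to $1$ as $n\to\infty$. $o_{\mathrm p}(1)$ denotes a random quantity converging to $0$ in probability as $n\to\infty$. *)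

theory Defs
  imports "HOL-Probability.Probability" "HOL-Library.Ramsey"
begin

text \<open>
  A graph on \<open>V\<close> is represented by its edge set \<open>E \<subseteq> [V]\<^bsup>2\<^esup>\<close>, a set of two-element subsets
  of \<open>V\<close>; cliques are those of \<^theory>\<open>HOL-Library.Ramsey\<close>.
\<close>

definition clique_number :: "'a set \<Rightarrow> 'a set set \<Rightarrow> nat" where
  "clique_number V E = Max (card ` {K. K \<subseteq> V \<and> clique K E})"

text \<open>
  The conditional law of the edge set given the weights \<open>w\<close>. For \<open>e = {i, j}\<close> with \<open>i \<noteq> j\<close>, the
  product over \<open>e\<close> is \<open>w i * w j\<close>.
\<close>

definition edges_given_weights :: "real \<Rightarrow> nat \<Rightarrow> (nat \<Rightarrow> real) \<Rightarrow> nat set set pmf" where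
  "edges_given_weights b n w =
     map_pmf (\<lambda>g. {e \<in> [{1..n}]\<^bsup>2\<^esup>. g e})
       (Pi_pmf ([{1..n}]\<^bsup>2\<^esup>) False
          (\<lambda>e. bernoulli_pmf (1 - exp (- (b * (\<Prod>i\<in>e. w i) / real n)))))"

text \<open>
  The law of the random graph on \<open>{1..n}\<close> with i.i.d. weights of law \<open>D\<close>. Its total mass being \<open>1\<close>
  and its description as a mixture depend on the measurability of the kernel, which is established
  below.
\<close>

definition weighted_random_graph :: "real measure \<Rightarrow> real \<Rightarrow> nat \<Rightarrow> nat set set measure" where
  "weighted_random_graph D b n =
     (\<Pi>\<^sub>M i\<in>{1..n}. D) \<bind> (\<lambda>w. measure_pmf (edges_given_weights b n w))"

definition op1 :: "(nat \<Rightarrow> 'a measure) \<Rightarrow> (nat \<Rightarrow> 'a \<Rightarrow> real) \<Rightarrow> bool" where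
  "op1 M Z \<longleftrightarrow> (\<forall>n. Z n \<in> borel_measurable (M n)) \<and>
     (\<forall>\<epsilon>>0. (\<lambda>n. measure (M n) {x \<in> space (M n). \<bar>Z n x\<bar> > \<epsilon>}) \<longlonglongrightarrow> 0)"

lemma pmf_bernoulli_clamp:
  "pmf (bernoulli_pmf p) x = (if x then min 1 (max 0 p) else 1 - min 1 (max 0 p))"
  by (simp add: bernoulli_pmf.rep_eq)

lemma measurable_edges_given_weights:
  assumes "sets D = sets borel"
  shows "(\<lambda>w. measure_pmf (edges_given_weights b n w))
           \<in> measurable (\<Pi>\<^sub>M i\<in>{1..n}. D) (subprob_algebra (count_space UNIV))"
proof (rule measurable_subprob_algebra)
  fix w
  show "subprob_space (measure_pmf (edges_given_weights b n w))"
    by (rule measure_pmf.subprob_space_axioms)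
next
  fix A :: "nat set set set"
  let ?I = "[{1..n}]\<^bsup>2\<^esup>"
  let ?q = "\<lambda>w e. 1 - exp (- (b * (\<Prod>i\<in>e. w i) / real n))"
  let ?P = "\<lambda>w. Pi_pmf ?I False (\<lambda>e. bernoulli_pmf (?q w e))"
  let ?S = "PiE_dflt ?I False (\<lambda>_. UNIV) \<inter> (\<lambda>g. {e \<in> ?I. g e}) -` A"
  have fin: "finite ?I"
    by (simp add: finite_imp_finite_nsets)
  have finS: "finite ?S"
    using fin by (intro finite_Int disjI1 finite_PiE_dflt) auto
  have eq: "emeasure (measure_pmf (edges_given_weights b n w)) A =
      ennreal (\<Sum>g\<in>?S. \<Prod>e\<in>?I. pmf (bernoulli_pmf (?q w e)) (g e))" for w
  proof -
    have "set_pmf (?P w) \<subseteq> PiE_dflt ?I False (\<lambda>_. UNIV)"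
      using set_Pi_pmf_subset[OF fin, of False "\<lambda>e. bernoulli_pmf (?q w e)"]
      by (auto simp: PiE_dflt_def)
    hence "measure_pmf.prob (?P w) ((\<lambda>g. {e \<in> ?I. g e}) -` A) = measure_pmf.prob (?P w) ?S"
      by (intro measure_pmf.finite_measure_eq_AE) (auto simp: AE_measure_pmf_iff)
    also have "\<dots> = (\<Sum>g\<in>?S. pmf (?P w) g)"
      by (rule measure_measure_pmf_finite[OF finS])
    also have "\<dots> = (\<Sum>g\<in>?S. \<Prod>e\<in>?I. pmf (bernoulli_pmf (?q w e)) (g e))"
      by (intro sum.cong refl, subst pmf_Pi[OF fin]) (auto simp: PiE_dflt_def)
    finally show ?thesis
      by (simp add: edges_given_weights_def measure_pmf.emeasure_eq_measure)
  qed
  have comp: "(\<lambda>w. w i) \<in> borel_measurable (\<Pi>\<^sub>M i\<in>{1..n}. D)" if "i \<in> {1..n}" for i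
    using measurable_component_singleton[OF that, of "\<lambda>_. D"] assms
    by (simp cong: measurable_cong_sets)
  have "(\<lambda>w. \<Prod>i\<in>e. w i) \<in> borel_measurable (\<Pi>\<^sub>M i\<in>{1..n}. D)" if "e \<in> ?I" for e
    using that by (intro borel_measurable_prod comp) (auto simp: nsets_def)
  then show "(\<lambda>w. emeasure (measure_pmf (edges_given_weights b n w)) A)
      \<in> borel_measurable (\<Pi>\<^sub>M i\<in>{1..n}. D)"
    unfolding eq pmf_bernoulli_clamp
    by (intro measurable_compose[OF _ measurable_ennreal] borel_measurable_sum
          borel_measurable_prod) (simp split: if_splits)
qed auto

lemma
  assumes "prob_space D" "sets D = sets borel"
  shows sets_weighted_random_graph: "sets (weighted_random_graph D b n) = UNIV"
    and space_weighted_random_graph: "space (weighted_random_graph D b n) = UNIV"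
    and prob_space_weighted_random_graph: "prob_space (weighted_random_graph D b n)"
    and emeasure_weighted_random_graph: "emeasure (weighted_random_graph D b n) A =
          (\<integral>\<^sup>+ w. emeasure (edges_given_weights b n w) A \<partial>(\<Pi>\<^sub>M i\<in>{1..n}. D))"
proof -
  interpret P: prob_space "\<Pi>\<^sub>M i\<in>{1..n}. D"
    by (intro prob_space_PiM assms)
  note meas = measurable_edges_given_weights[OF assms(2), of b n]
  show sets: "sets (weighted_random_graph D b n) = UNIV"
    unfolding weighted_random_graph_def
    by (subst sets_bind[OF sets_kernel[OF meas] P.not_empty]) auto
  then show "space (weighted_random_graph D b n) = UNIV"
    by (metis UNIV_I sets.sets_into_space top.extremum_uniqueI)
  show "prob_space (weighted_random_graph D b n)"
    unfolding weighted_random_graph_def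
    by (rule P.prob_space_bind[OF _ meas]) (simp add: measure_pmf.prob_space_axioms)
  show "emeasure (weighted_random_graph D b n) A =
          (\<integral>\<^sup>+ w. emeasure (edges_given_weights b n w) A \<partial>(\<Pi>\<^sub>M i\<in>{1..n}. D))"
    unfolding weighted_random_graph_def
    by (rule emeasure_bind[OF P.not_empty meas]) simp
qed

end

theory Submission
  imports Defs
begin

text \<open>
  Everything is reduced to the law of the edge set given the weights \<open>w\<close>, under which the edges are
  independent: the probability of an event is the average over \<open>w\<close> of its conditional probability, so
  that a conditional bound valid off a set of weights of small probability suffices. A vertex is
  called heavy at level \<open>t\<close> if its weight exceeds \<open>t\<close>. The number of heavy vertices is a sum of
  independent indicators, controlled by the inequalities of Markov and Chebyshev.

  For \<open>\<alpha> < 2\<close> consider the level \<open>A * sqrt (n * ln n)\<close>. About \<open>a * A powr (- \<alpha>)\<close> times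
  \<open>n powr (1 - \<alpha> / 2) * ln n powr (- \<alpha> / 2)\<close> vertices are heavy. Two heavy vertices are non-adjacent
  with probability at most \<open>n powr (- \<gamma>)\<close>, where \<open>\<gamma> = b * A\<^sup>2\<close>, and two light ones with at least that
  probability. If \<open>\<gamma> > 1 - \<alpha> / 2\<close>, the expected number of missing edges among the heavy vertices is
  negligible compared with their number, and deleting an endpoint of each leaves a clique
  (\<open>subcritical_lower\<close>). If \<open>\<gamma> < 1 - \<alpha> / 2\<close>, a union bound shows that the light vertices contain no
  clique on more than about \<open>4 * n powr \<gamma> * ln n\<close> vertices, which again is negligible, so the heavy
  vertices bound the clique number (\<open>subcritical_upper\<close>). The constant \<open>c\<close> is \<open>a * A powr (- \<alpha>)\<close> at the
  threshold \<open>b * A\<^sup>2 = 1 - \<alpha> / 2\<close>.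

  For \<open>\<alpha> = 2\<close> and \<open>\<alpha> > 2\<close> the upper bounds come from \<open>measure_clique_number_ge_4_le\<close>: a clique with
  \<open>4 + k\<close> vertices requires more than \<open>k\<close> heavy vertices or a clique on four light ones, and the
  expected number of the latter is governed by the truncated third moment. At \<open>\<alpha> = 2\<close> and level
  \<open>\<delta> * sqrt n\<close> both are unlikely for small \<open>\<delta>\<close> and then large \<open>k\<close>. Conversely, the number of weights
  above \<open>sqrt n\<close> exceeds any fixed number with probability bounded away from zero, and these vertices
  form a clique with probability bounded away from zero.

  For \<open>\<alpha> > 2\<close> the second moment is finite. There are no cliques on four vertices and there is some
  edge, both with probability tending to one, so the clique number is \<open>2\<close> or \<open>3\<close> according to whether
  there is a triangle. Truncating the weights at \<open>sqrt n\<close> changes the graph with negligible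
  probability. In the truncated model, averaged over the weights, triangles on disjoint vertex sets
  are independent, and the expected number of pairs of triangles sharing one or two vertices tends to
  zero. A telescoping argument (\<open>prob_none_approx\<close>) then shows that the probability of having no
  triangle is asymptotically the product of the probabilities of the complementary events, which
  tends to \<open>exp (- (b * E W\<^sup>2) ^ 3 / 6)\<close> (\<open>triangle_free_tendsto\<close>).
\<close>

section \<open>Random subsets with independent elements\<close>

text \<open>
  The random subset of \<open>F\<close> that contains each \<open>e \<in> F\<close> independently with probability \<open>p e\<close>
  (truncated to \<open>[0, 1]\<close>, as in \<^const>\<open>bernoulli_pmf\<close>).
\<close>

definition bernoulli_subset :: "'a set \<Rightarrow> ('a \<Rightarrow> real) \<Rightarrow> 'a set pmf" where
  "bernoulli_subset F p =
     map_pmf (\<lambda>g. {e \<in> F. g e}) (Pi_pmf F False (\<lambda>e. bernoulli_pmf (p e)))"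

lemma measure_bernoulli_pmf_True:
  "0 \<le> p \<Longrightarrow> p \<le> 1 \<Longrightarrow> measure_pmf.prob (bernoulli_pmf p) {True} = p"
  by (simp add: measure_pmf_single)

lemma measure_bernoulli_pmf_False:
  "0 \<le> p \<Longrightarrow> p \<le> 1 \<Longrightarrow> measure_pmf.prob (bernoulli_pmf p) {False} = 1 - p"
  by (simp add: measure_pmf_single)

lemma prob_bernoulli_subset_superset:
  assumes "finite F" "A \<subseteq> F" "\<And>e. e \<in> A \<Longrightarrow> 0 \<le> p e \<and> p e \<le> 1"
  shows "measure_pmf.prob (bernoulli_subset F p) {E. A \<subseteq> E} = (\<Prod>e\<in>A. p e)"
proof -
  have "measure_pmf.prob (bernoulli_subset F p) {E. A \<subseteq> E} =
      measure_pmf.prob (Pi_pmf F False (\<lambda>e. bernoulli_pmf (p e)))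
        (Pi F (\<lambda>e. if e \<in> A then {True} else UNIV))"
    unfolding bernoulli_subset_def measure_map_pmf
    using assms(2) by (intro arg_cong2[where f = measure]) (auto simp: Pi_def)
  also have "\<dots> = (\<Prod>e\<in>F. measure_pmf.prob (bernoulli_pmf (p e)) (if e \<in> A then {True} else UNIV))"
    by (rule measure_Pi_pmf_Pi[OF assms(1)])
  also have "\<dots> = (\<Prod>e\<in>A. p e)"
    using assms by (intro prod.mono_neutral_cong_right)
      (auto simp: measure_bernoulli_pmf_True)
  finally show ?thesis .
qed

lemma prob_bernoulli_subset_disjoint:
  assumes "finite F" "A \<subseteq> F" "\<And>e. e \<in> A \<Longrightarrow> 0 \<le> p e \<and> p e \<le> 1"
  shows "measure_pmf.prob (bernoulli_subset F p) {E. A \<inter> E = {}} = (\<Prod>e\<in>A. 1 - p e)"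
proof -
  have "measure_pmf.prob (bernoulli_subset F p) {E. A \<inter> E = {}} =
      measure_pmf.prob (Pi_pmf F False (\<lambda>e. bernoulli_pmf (p e)))
        (Pi F (\<lambda>e. if e \<in> A then {False} else UNIV))"
    unfolding bernoulli_subset_def measure_map_pmf
    using assms(2) by (intro arg_cong2[where f = measure]) (auto simp: Pi_def)
  also have "\<dots> = (\<Prod>e\<in>F. measure_pmf.prob (bernoulli_pmf (p e)) (if e \<in> A then {False} else UNIV))"
    by (rule measure_Pi_pmf_Pi[OF assms(1)])
  also have "\<dots> = (\<Prod>e\<in>A. 1 - p e)"
    using assms by (intro prod.mono_neutral_cong_right)
      (auto simp: measure_bernoulli_pmf_False)
  finally show ?thesis .
qed

lemma bernoulli_subset_restrict:
  assumes "finite F" "A \<subseteq> F"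
  shows "map_pmf (\<lambda>E. E \<inter> A) (bernoulli_subset F p) = bernoulli_subset A p"
  unfolding bernoulli_subset_def Pi_pmf_subset[OF assms] map_pmf_comp
  using assms by (intro map_pmf_cong) auto

lemma bernoulli_subset_cong:
  assumes "finite F" "\<And>e. e \<in> F \<Longrightarrow> p e = q e"
  shows "bernoulli_subset F p = bernoulli_subset F q"
  unfolding bernoulli_subset_def using assms by (intro map_pmf_cong Pi_pmf_cong) auto

lemma bernoulli_subset_union:
  assumes "finite A" "finite B" "A \<inter> B = {}"
  shows "bernoulli_subset (A \<union> B) p =
    map_pmf (\<lambda>(X, Y). X \<union> Y) (pair_pmf (bernoulli_subset A p) (bernoulli_subset B p))"
  unfolding bernoulli_subset_def Pi_pmf_union[OF assms] map_pair[symmetric] map_pmf_comp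
  using assms(3) by (intro map_pmf_cong refl) (auto split: if_splits)

lemma set_bernoulli_subset:
  "E \<in> set_pmf (bernoulli_subset F p) \<Longrightarrow> E \<subseteq> F"
  by (auto simp: bernoulli_subset_def)

text \<open>Events that are determined by the trace of the random set on two disjoint sets are
  independent.\<close>

lemma bernoulli_subset_indep:
  assumes "finite F" "A \<subseteq> F" "B \<subseteq> F" "A \<inter> B = {}"
  shows "measure_pmf.prob (bernoulli_subset F p) {E. E \<inter> A \<in> X \<and> E \<inter> B \<in> Y} =
    measure_pmf.prob (bernoulli_subset A p) X * measure_pmf.prob (bernoulli_subset B p) Y"
proof -
  have fin: "finite A" "finite B"
    using assms by (auto intro: finite_subset)
  have "measure_pmf.prob (bernoulli_subset F p) {E. E \<inter> A \<in> X \<and> E \<inter> B \<in> Y} =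
      measure_pmf.prob (map_pmf (\<lambda>E. E \<inter> (A \<union> B)) (bernoulli_subset F p))
        {E. E \<inter> A \<in> X \<and> E \<inter> B \<in> Y}"
    unfolding measure_map_pmf by (intro arg_cong2[where f = measure] refl)
      (auto simp: Int_assoc Int_absorb1 inf_sup_distrib2)
  also have "\<dots> = measure_pmf.prob (pair_pmf (bernoulli_subset A p) (bernoulli_subset B p))
      {(E, E'). (E \<union> E') \<inter> A \<in> X \<and> (E \<union> E') \<inter> B \<in> Y}"
    using assms by (subst bernoulli_subset_restrict)
      (auto simp: bernoulli_subset_union[OF fin assms(4)] measure_map_pmf
         intro!: arg_cong2[where f = measure])
  also have "\<dots> = measure_pmf.prob (pair_pmf (bernoulli_subset A p) (bernoulli_subset B p))
      ((X \<inter> Pow A) \<times> (Y \<inter> Pow B))"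
  proof (rule measure_pmf.finite_measure_eq_AE, rule AE_pmfI)
    fix z assume "z \<in> set_pmf (pair_pmf (bernoulli_subset A p) (bernoulli_subset B p))"
    then have z: "fst z \<subseteq> A" "snd z \<subseteq> B"
      using set_bernoulli_subset by fastforce+
    have "(fst z \<union> snd z) \<inter> A = fst z" "(fst z \<union> snd z) \<inter> B = snd z"
      using z assms(4) by auto
    then show "(z \<in> {(E, E'). (E \<union> E') \<inter> A \<in> X \<and> (E \<union> E') \<inter> B \<in> Y}) =
        (z \<in> (X \<inter> Pow A) \<times> (Y \<inter> Pow B))"
      using z by (simp add: case_prod_unfold mem_Times_iff)
  qed auto
  also have "\<dots> = measure_pmf.prob (bernoulli_subset A p) (X \<inter> Pow A) *
      measure_pmf.prob (bernoulli_subset B p) (Y \<inter> Pow B)"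
    by (rule measure_pmf_prob_product) (simp_all add: countable_finite fin)
  also have "measure_pmf.prob (bernoulli_subset A p) (X \<inter> Pow A) =
      measure_pmf.prob (bernoulli_subset A p) X"
    by (rule measure_pmf.finite_measure_eq_AE, rule AE_pmfI) (auto dest: set_bernoulli_subset)
  also have "measure_pmf.prob (bernoulli_subset B p) (Y \<inter> Pow B) =
      measure_pmf.prob (bernoulli_subset B p) Y"
    by (rule measure_pmf.finite_measure_eq_AE, rule AE_pmfI) (auto dest: set_bernoulli_subset)
  finally show ?thesis .
qed

section \<open>Cliques\<close>

lemma clique_iff_nsets: "clique S E \<longleftrightarrow> [S]\<^bsup>2\<^esup> \<subseteq> E"
  unfolding clique_def by (auto simp: nsets_2_eq) 

text \<open>
  A subset of a clique is a clique, so the sizes of cliques form an initial segment.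
\<close>

lemma clique_number_ge_iff:
  assumes "finite V"
  shows "k \<le> clique_number V E \<longleftrightarrow> (\<exists>S. S \<subseteq> V \<and> card S = k \<and> clique S E)"
proof -
  let ?C = "card ` {K. K \<subseteq> V \<and> clique K E}"
  have fin: "finite ?C" and ne: "?C \<noteq> {}"
    using assms by (auto intro!: exI[of _ "{}"])
  have "k \<le> clique_number V E \<longleftrightarrow> (\<exists>c\<in>?C. k \<le> c)"
    unfolding clique_number_def by (rule Max_ge_iff[OF fin ne])
  also have "\<dots> \<longleftrightarrow> (\<exists>S. S \<subseteq> V \<and> card S = k \<and> clique S E)"
  proof
    assume "\<exists>c\<in>?C. k \<le> c"
    then obtain K where K: "K \<subseteq> V" "clique K E" "k \<le> card K"
      by auto
    then obtain S where "S \<subseteq> K" "card S = k"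
      by (meson obtain_subset_with_card_n)
    then show "\<exists>S. S \<subseteq> V \<and> card S = k \<and> clique S E"
      using K smaller_clique by blast
  qed auto
  finally show ?thesis .
qed

lemma clique_number_le_card: "finite V \<Longrightarrow> clique_number V E \<le> card V"
  by (metis clique_number_ge_iff card_mono order_refl)

section \<open>The graph given the weights\<close>

text \<open>
  The conditional probability of the edge \<open>e\<close>; it lies in \<open>[0, 1]\<close> when the weights are nonnegative.
\<close>

definition edge_prob :: "real \<Rightarrow> nat \<Rightarrow> (nat \<Rightarrow> real) \<Rightarrow> nat set \<Rightarrow> real" where
  "edge_prob b n w e = 1 - exp (- (b * (\<Prod>i\<in>e. w i) / real n))"

lemma edges_given_weights_altdef:
  "edges_given_weights b n w = bernoulli_subset ([{1..n}]\<^bsup>2\<^esup>) (edge_prob b n w)"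
  by (simp add: edges_given_weights_def bernoulli_subset_def edge_prob_def)

declare finite_imp_finite_nsets [simp]
\<comment> \<open>Keeps \<open>{1..n}\<close> from being rewritten to \<open>{Suc 0..n}\<close>.\<close>
declare One_nat_def [simp del]

lemma edge_prob_bounds:
  assumes "b > 0" "\<And>i. i \<in> {1..n} \<Longrightarrow> 0 \<le> w i" "e \<in> [{1..n}]\<^bsup>2\<^esup>"
  shows "0 \<le> edge_prob b n w e" "edge_prob b n w e \<le> 1"
    and "edge_prob b n w e \<le> b / real n * (\<Prod>i\<in>e. w i)"
proof -
  have "0 \<le> (\<Prod>i\<in>e. w i)"
    using assms by (intro prod_nonneg) (auto simp: nsets_def)
  then have "0 \<le> b * (\<Prod>i\<in>e. w i) / real n"
    using assms(1) by simp
  then show "0 \<le> edge_prob b n w e" "edge_prob b n w e \<le> 1"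
    by (auto simp: edge_prob_def)
  show "edge_prob b n w e \<le> b / real n * (\<Prod>i\<in>e. w i)"
    using exp_ge_add_one_self[of "- (b * (\<Prod>i\<in>e. w i) / real n)"] by (simp add: edge_prob_def)
qed

lemma prob_given_weights_superset:
  assumes "b > 0" "\<And>i. i \<in> {1..n} \<Longrightarrow> 0 \<le> w i" "F \<subseteq> [{1..n}]\<^bsup>2\<^esup>"
  shows "measure_pmf.prob (edges_given_weights b n w) {E. F \<subseteq> E} = (\<Prod>e\<in>F. edge_prob b n w e)"
  unfolding edges_given_weights_altdef
proof (rule prob_bernoulli_subset_superset)
  show "0 \<le> edge_prob b n w e \<and> edge_prob b n w e \<le> 1" if "e \<in> F" for e
    using edge_prob_bounds(1,2)[of b n w e] assms that by blast
qed (use assms(3) in simp_all)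

lemma prob_given_weights_disjoint:
  assumes "b > 0" "\<And>i. i \<in> {1..n} \<Longrightarrow> 0 \<le> w i" "F \<subseteq> [{1..n}]\<^bsup>2\<^esup>"
  shows "measure_pmf.prob (edges_given_weights b n w) {E. F \<inter> E = {}} =
    (\<Prod>e\<in>F. exp (- (b * (\<Prod>i\<in>e. w i) / real n)))"
proof -
  have "measure_pmf.prob (edges_given_weights b n w) {E. F \<inter> E = {}} =
      (\<Prod>e\<in>F. 1 - edge_prob b n w e)"
    unfolding edges_given_weights_altdef
  proof (rule prob_bernoulli_subset_disjoint)
    show "0 \<le> edge_prob b n w e \<and> edge_prob b n w e \<le> 1" if "e \<in> F" for e
      using edge_prob_bounds(1,2)[of b n w e] assms that by blast
  qed (use assms(3) in simp_all)
  then show ?thesis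
    by (simp add: edge_prob_def)
qed

lemma prob_given_weights_superset_le:
  assumes "b > 0" "\<And>i. i \<in> {1..n} \<Longrightarrow> 0 \<le> w i" "F \<subseteq> [{1..n}]\<^bsup>2\<^esup>"
  shows "measure_pmf.prob (edges_given_weights b n w) {E. F \<subseteq> E} \<le>
    (b / real n) ^ card F * (\<Prod>e\<in>F. \<Prod>i\<in>e. w i)"
proof -
  have "(\<Prod>e\<in>F. edge_prob b n w e) \<le> (\<Prod>e\<in>F. b / real n * (\<Prod>i\<in>e. w i))"
    using assms(3) by (intro prod_mono conjI edge_prob_bounds assms(1,2)) auto
  also have "\<dots> = (b / real n) ^ card F * (\<Prod>e\<in>F. \<Prod>i\<in>e. w i)"
    by (simp only: prod.distrib prod_constant)
  finally show ?thesis
    by (simp only: prob_given_weights_superset[OF assms])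
qed

section \<open>Averaging over the weights\<close>

text \<open>
  A weight distribution \<open>D\<close> on the nonnegative reals, together with the constant \<open>b\<close> of the model.
\<close>

locale weight_law = prob_space D for D :: "real measure" +
  fixes b :: real
  assumes sets_D [simp, measurable_cong]: "sets D = sets borel"
    and b_pos: "0 < b"
    and nonneg_D: "AE x in D. 0 \<le> x"
begin

abbreviation weights :: "nat set \<Rightarrow> (nat \<Rightarrow> real) measure" where
  "weights I \<equiv> \<Pi>\<^sub>M i\<in>I. D"

abbreviation graph :: "nat \<Rightarrow> nat set set measure" where
  "graph n \<equiv> weighted_random_graph D b n"

lemma space_D [simp]: "space D = UNIV"
  using sets_eq_imp_space_eq[OF sets_D] by simp

sublocale W: prob_space "weights I" for I
  by (intro prob_space_PiM prob_space_axioms)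

lemma prob_space_graph: "prob_space (graph n)"
  by (rule prob_space_weighted_random_graph[OF prob_space_axioms sets_D])

lemma sets_graph [simp]: "sets (graph n) = UNIV"
  by (rule sets_weighted_random_graph[OF prob_space_axioms sets_D])

lemma space_graph [simp]: "space (graph n) = UNIV"
  by (rule space_weighted_random_graph[OF prob_space_axioms sets_D])

lemma AE_weights_nonneg: "AE w in weights {1..n}. \<forall>i\<in>{1..n}. 0 \<le> w i"
  by (intro AE_finite_allI AE_PiM_component nonneg_D prob_space_axioms) auto

lemma measurable_given_weights [measurable]:
  "(\<lambda>w. measure_pmf.prob (edges_given_weights b n w) A) \<in> borel_measurable (weights {1..n})"
proof -
  have "(\<lambda>w. emeasure (measure_pmf (edges_given_weights b n w)) A) \<in> borel_measurable (weights {1..n})"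
    by (rule measurable_emeasure_kernel[OF measurable_edges_given_weights[OF sets_D]]) simp
  then show ?thesis
    unfolding measure_def by measurable
qed

lemma integrable_given_weights:
  "integrable (weights {1..n}) (\<lambda>w. measure_pmf.prob (edges_given_weights b n w) A)"
  by (rule W.integrable_const_bound[where B = 1]) (rule AE_I2, simp, rule measurable_given_weights)

lemma measure_graph:
  "measure (graph n) A = (\<integral>w. measure_pmf.prob (edges_given_weights b n w) A \<partial>weights {1..n})"
proof -
  have "emeasure (graph n) A =
      (\<integral>\<^sup>+ w. ennreal (measure_pmf.prob (edges_given_weights b n w) A) \<partial>weights {1..n})"
    by (simp add: emeasure_weighted_random_graph[OF prob_space_axioms sets_D]
        measure_pmf.emeasure_eq_measure)
  also have "\<dots> = ennreal (\<integral>w. measure_pmf.prob (edges_given_weights b n w) A \<partial>weights {1..n})"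
    by (rule nn_integral_eq_integral[OF integrable_given_weights]) simp
  finally show ?thesis
    by (simp add: measure_def integral_nonneg_AE)
qed

text \<open>
  Bounds on conditional probabilities are only needed for nonnegative weights, which occur almost
  surely.
\<close>

lemma measure_graph_le:
  assumes "integrable (weights {1..n}) h"
    and "\<And>w. (\<And>i. i \<in> {1..n} \<Longrightarrow> 0 \<le> w i) \<Longrightarrow> w \<in> space (weights {1..n}) \<Longrightarrow>
      measure_pmf.prob (edges_given_weights b n w) A \<le> h w"
  shows "measure (graph n) A \<le> (\<integral>w. h w \<partial>weights {1..n})"
  unfolding measure_graph
proof (intro integral_mono_AE integrable_given_weights assms(1))
  show "AE w in weights {1..n}. measure_pmf.prob (edges_given_weights b n w) A \<le> h w"
    using AE_weights_nonneg AE_space by eventually_elim (rule assms(2), auto)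
qed

text \<open>A conditional bound outside an exceptional set of weights.\<close>

lemma measure_graph_le_bad:
  assumes "B \<in> sets (weights {1..n})" "0 \<le> d"
    and "\<And>w. (\<And>i. i \<in> {1..n} \<Longrightarrow> 0 \<le> w i) \<Longrightarrow> w \<in> space (weights {1..n}) \<Longrightarrow> w \<notin> B \<Longrightarrow>
      measure_pmf.prob (edges_given_weights b n w) A \<le> d"
  shows "measure (graph n) A \<le> measure (weights {1..n}) B + d"
proof -
  have "measure (graph n) A \<le> (\<integral>w. indicator B w + d \<partial>weights {1..n})"
  proof (rule measure_graph_le)
    show "integrable (weights {1..n}) (\<lambda>w. indicator B w + d)"
      using assms(1) by (intro Bochner_Integration.integrable_add) (auto simp: W.emeasure_eq_measure)
  next
    fix w :: "nat \<Rightarrow> real"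
    assume w: "\<And>i. i \<in> {1..n} \<Longrightarrow> 0 \<le> w i" "w \<in> space (weights {1..n})"
    show "measure_pmf.prob (edges_given_weights b n w) A \<le> indicator B w + d"
      using assms(2) assms(3)[OF w] measure_pmf.prob_le_1[of _ A]
      by (cases "w \<in> B") (auto simp: indicator_def intro: order_trans)
  qed
  also have "\<dots> = measure (weights {1..n}) B + d"
    using assms(1) by (subst Bochner_Integration.integral_add)
      (auto simp: W.emeasure_eq_measure W.prob_space)
  finally show ?thesis .
qed

lemma measure_graph_ge:
  assumes "B \<in> sets (weights {1..n})"
    and "\<And>w. (\<And>i. i \<in> {1..n} \<Longrightarrow> 0 \<le> w i) \<Longrightarrow> w \<in> B \<Longrightarrow>
      d \<le> measure_pmf.prob (edges_given_weights b n w) A"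
  shows "d * measure (weights {1..n}) B \<le> measure (graph n) A"
proof -
  have "d * measure (weights {1..n}) B = (\<integral>w. d * indicator B w \<partial>weights {1..n})"
    using assms(1) by simp
  also have "\<dots> \<le> (\<integral>w. measure_pmf.prob (edges_given_weights b n w) A \<partial>weights {1..n})"
    proof (intro integral_mono_AE integrable_given_weights)
    show "integrable (weights {1..n}) (\<lambda>w. d * indicator B w)"
      using assms(1) by (simp add: W.emeasure_eq_measure)
    show "AE w in weights {1..n}. d * indicator B w \<le>
        measure_pmf.prob (edges_given_weights b n w) A"
      using AE_weights_nonneg by eventually_elim (auto simp: indicator_def intro!: assms(2))
  qed
  finally show ?thesis
    by (simp only: measure_graph)
qed

lemma
  fixes g :: "nat \<Rightarrow> real \<Rightarrow> real"
  assumes "finite I" "S \<subseteq> I" "\<And>i. i \<in> S \<Longrightarrow> integrable D (g i)"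
  shows integral_weights_prod: "(\<integral>w. (\<Prod>i\<in>S. g i (w i)) \<partial>weights I) = (\<Prod>i\<in>S. \<integral>x. g i x \<partial>D)"
    and integrable_weights_prod: "integrable (weights I) (\<lambda>w. \<Prod>i\<in>S. g i (w i))"
proof -
  interpret P: product_prob_space "\<lambda>_::nat. D" I
    by unfold_locales
  let ?h = "\<lambda>i. if i \<in> S then g i else (\<lambda>_. 1)"
  have eq: "(\<Prod>i\<in>I. ?h i (w i)) = (\<Prod>i\<in>S. g i (w i))" for w :: "nat \<Rightarrow> real"
    using assms by (intro prod.mono_neutral_cong_right) auto
  have int: "integrable D (?h i)" for i
    using assms by auto
  have "(\<integral>w. (\<Prod>i\<in>I. ?h i (w i)) \<partial>weights I) = (\<Prod>i\<in>I. \<integral>x. ?h i x \<partial>D)"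
    by (rule P.product_integral_prod) (use assms int in auto)
  also have "(\<Prod>i\<in>I. \<integral>x. ?h i x \<partial>D) = (\<Prod>i\<in>S. \<integral>x. g i x \<partial>D)"
    using assms by (intro prod.mono_neutral_cong_right) (use prob_space in auto)
  finally show "(\<integral>w. (\<Prod>i\<in>S. g i (w i)) \<partial>weights I) = (\<Prod>i\<in>S. \<integral>x. g i x \<partial>D)"
    by (simp only: eq)
  have "integrable (weights I) (\<lambda>w. \<Prod>i\<in>I. ?h i (w i))"
    by (rule P.product_integrable_prod) (use assms int in auto)
  then show "integrable (weights I) (\<lambda>w. \<Prod>i\<in>S. g i (w i))"
    by (simp only: eq)
qed

end

section \<open>The number of heavy vertices\<close>

text \<open>
  The vertices whose weight exceeds the level \<open>t\<close>.
\<close>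

definition heavy :: "nat \<Rightarrow> real \<Rightarrow> (nat \<Rightarrow> real) \<Rightarrow> nat set" where
  "heavy n t w = {i \<in> {1..n}. t < w i}"

lemma heavy_subset: "heavy n t w \<subseteq> {1..n}"
  by (auto simp: heavy_def)

lemma finite_heavy [simp]: "finite (heavy n t w)"
  by (auto simp: heavy_def)

lemma real_card_heavy: "real (card (heavy n t w)) = (\<Sum>i\<in>{1..n}. indicator {t<..} (w i))"
  by (simp add: heavy_def indicator_def sum.If_cases Int_def)

context weight_law
begin

lemma measurable_weights_component:
  "i \<in> I \<Longrightarrow> (\<lambda>w. w i) \<in> borel_measurable (weights I)"
  using measurable_component_singleton[of i I "\<lambda>_. D"] by (simp cong: measurable_cong_sets)

lemma measurable_card_heavy [measurable]:
  "(\<lambda>w. card (heavy n t w)) \<in> measurable (weights {1..n}) (count_space UNIV)"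
proof -
  have "(\<lambda>w. real (card (heavy n t w))) \<in> borel_measurable (weights {1..n})"
    unfolding real_card_heavy
    by (intro borel_measurable_sum measurable_compose[OF measurable_weights_component]) simp_all
  then have "(\<lambda>w. nat \<lfloor>real (card (heavy n t w))\<rfloor>) \<in> measurable (weights {1..n}) (count_space UNIV)"
    by measurable
  then show ?thesis
    by simp
qed

lemma measurable_D [simp]: "f \<in> measurable D N \<longleftrightarrow> f \<in> measurable borel N"
  by (simp cong: measurable_cong_sets)

lemma integrable_indicator_D [simp]: "integrable D (indicator {t<..} :: real \<Rightarrow> real)"
  by (rule integrable_const_bound[where B = 1]) (auto simp: indicator_def)

lemma integral_card_heavy:
  "integrable (weights {1..n}) (\<lambda>w. real (card (heavy n t w)))"
  "(\<integral>w. real (card (heavy n t w)) \<partial>weights {1..n}) = real n * prob {t<..}"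
proof -
  have *: "integrable (weights {1..n}) (\<lambda>w. indicator {t<..} (w i) :: real)"
    "(\<integral>w. indicator {t<..} (w i) \<partial>weights {1..n}) = prob {t<..}" if "i \<in> {1..n}" for i
    using integrable_weights_prod[of "{1..n}" "{i}" "\<lambda>_. indicator {t<..}"]
      integral_weights_prod[of "{1..n}" "{i}" "\<lambda>_. indicator {t<..}"] that by simp_all
  show "integrable (weights {1..n}) (\<lambda>w. real (card (heavy n t w)))"
    unfolding real_card_heavy by (intro Bochner_Integration.integrable_sum *)
  show "(\<integral>w. real (card (heavy n t w)) \<partial>weights {1..n}) = real n * prob {t<..}"
    unfolding real_card_heavy
    by (subst Bochner_Integration.integral_sum) (auto intro!: * simp: *(2))
qed

lemma heavy_markov:
  "measure (weights {1..n}) {w \<in> space (weights {1..n}). k < card (heavy n t w)}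
     \<le> real n * prob {t<..} / (real k + 1)"
proof -
  have "measure (weights {1..n}) {w \<in> space (weights {1..n}). real k + 1 \<le> real (card (heavy n t w))}
      \<le> (\<integral>w. real (card (heavy n t w)) \<partial>weights {1..n}) / (real k + 1)"
    by (rule integral_Markov_inequality_measure[where A = "space (weights {1..n})"])
       (auto intro: integral_card_heavy)
  moreover have "k < m \<longleftrightarrow> real k + 1 \<le> real m" for m
    by linarith
  ultimately show ?thesis
    by (simp only: integral_card_heavy)
qed

lemma heavy_chebyshev:
  assumes "0 < s"
  shows "measure (weights {1..n}) {w \<in> space (weights {1..n}).
      s \<le> \<bar>real (card (heavy n t w)) - real n * prob {t<..}\<bar>} \<le> real n * prob {t<..} / s\<^sup>2"
proof -
  define p where "p = prob {t<..}"
  \<comment> \<open>The deviation is the sum of the centred variables \<open>g (w i)\<close>, which are uncorrelated.\<close>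
  define g where "g x = indicator {t<..} x - p" for x :: real
  have p: "0 \<le> p" "p \<le> 1"
    by (auto simp: p_def)
  have g_meas [measurable]: "g \<in> borel_measurable borel"
    unfolding g_def by measurable
  have g_bound: "\<bar>g x\<bar> \<le> 1" for x
    using p by (auto simp: g_def indicator_def)
  have g2_bound: "\<bar>(g x)\<^sup>2\<bar> \<le> 1" for x
    using g_bound[of x] by (simp add: abs_square_le_1)
  have int_g: "integrable D g" "integrable D (\<lambda>x. (g x)\<^sup>2)"
    by (rule integrable_const_bound[where B = 1]; (use g_bound g2_bound g_meas in simp))+
  have int_ind: "(\<integral>x. indicator {t<..} x \<partial>D) = p"
    by (simp add: p_def)
  have mean: "(\<integral>x. g x \<partial>D) = 0"
    unfolding g_def by (subst Bochner_Integration.integral_diff) (use int_ind prob_space in auto)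
  have "(g x)\<^sup>2 = (1 - 2 * p) * indicator {t<..} x + p\<^sup>2" for x
    by (simp add: g_def indicator_def power2_eq_square algebra_simps)
  then have "(\<integral>x. (g x)\<^sup>2 \<partial>D) = (\<integral>x. (1 - 2 * p) * indicator {t<..} x + p\<^sup>2 \<partial>D)"
    by simp
  also have "\<dots> = (1 - 2 * p) * p + p\<^sup>2"
    by (subst Bochner_Integration.integral_add) (use int_ind prob_space in auto)
  also have "\<dots> \<le> p"
    by (simp add: power2_eq_square algebra_simps)
  finally have var: "(\<integral>x. (g x)\<^sup>2 \<partial>D) \<le> p" .
  have pair: "integrable (weights {1..n}) (\<lambda>w. g (w i) * g (w j))"
    "(\<integral>w. g (w i) * g (w j) \<partial>weights {1..n}) = (if i = j then \<integral>x. (g x)\<^sup>2 \<partial>D else 0)"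
    if "i \<in> {1..n}" "j \<in> {1..n}" for i j
  proof -
    have "integrable (weights {1..n}) (\<lambda>w. g (w i) * g (w j)) \<and>
      (\<integral>w. g (w i) * g (w j) \<partial>weights {1..n}) = (if i = j then \<integral>x. (g x)\<^sup>2 \<partial>D else 0)"
    proof (cases "i = j")
      case True
      then show ?thesis
        using integrable_weights_prod[of "{1..n}" "{i}" "\<lambda>_ x. (g x)\<^sup>2"]
          integral_weights_prod[of "{1..n}" "{i}" "\<lambda>_ x. (g x)\<^sup>2"] that int_g
        by (simp add: power2_eq_square)
    next
      case False
      then show ?thesis
        using integrable_weights_prod[of "{1..n}" "{i, j}" "\<lambda>_. g"]
          integral_weights_prod[of "{1..n}" "{i, j}" "\<lambda>_. g"] that int_g mean
        by simp
    qed
    then show "integrable (weights {1..n}) (\<lambda>w. g (w i) * g (w j))"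
      "(\<integral>w. g (w i) * g (w j) \<partial>weights {1..n}) = (if i = j then \<integral>x. (g x)\<^sup>2 \<partial>D else 0)"
      by blast+
  qed
  let ?f = "\<lambda>w. real (card (heavy n t w)) - real n * p"
  have f_eq: "?f w = (\<Sum>i\<in>{1..n}. g (w i))" for w
    by (simp add: real_card_heavy g_def sum_subtractf)
  have f2_eq: "(?f w)\<^sup>2 = (\<Sum>i\<in>{1..n}. \<Sum>j\<in>{1..n}. g (w i) * g (w j))" for w
    unfolding f_eq power2_eq_square by (simp only: sum_product)
  have int_f2: "integrable (weights {1..n}) (\<lambda>w. (?f w)\<^sup>2)"
    unfolding f2_eq by (intro Bochner_Integration.integrable_sum pair)
  have "(\<integral>w. (?f w)\<^sup>2 \<partial>weights {1..n}) =
      (\<Sum>i\<in>{1..n}. \<Sum>j\<in>{1..n}. \<integral>w. g (w i) * g (w j) \<partial>weights {1..n})"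
    unfolding f2_eq
    by (subst Bochner_Integration.integral_sum;
        (intro Bochner_Integration.integrable_sum pair sum.cong refl
          Bochner_Integration.integral_sum)?) 
  also have "\<dots> = (\<Sum>i\<in>{1..n}. \<Sum>j\<in>{1..n}. if i = j then \<integral>x. (g x)\<^sup>2 \<partial>D else 0)"
    by (intro sum.cong refl pair)
  also have "\<dots> = real n * (\<integral>x. (g x)\<^sup>2 \<partial>D)"
    by simp
  also have "\<dots> \<le> real n * p"
    using var by (intro mult_left_mono) auto
  finally have "(\<integral>w. (?f w)\<^sup>2 \<partial>weights {1..n}) \<le> real n * p" .
  moreover have "measure (weights {1..n}) {w \<in> space (weights {1..n}). s \<le> \<bar>?f w\<bar>} \<le>
      (\<integral>w. (?f w)\<^sup>2 \<partial>weights {1..n}) / s\<^sup>2"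
    by (rule W.second_moment_method) (use int_f2 assms in auto)
  ultimately show ?thesis
    using assms by (fold p_def) (meson divide_right_mono order_trans zero_le_power2)
qed

end

section \<open>Cliques on four light vertices\<close>

lemma prod_over_edges:
  fixes f :: "'a \<Rightarrow> 'b::comm_monoid_mult"
  assumes "finite V" "finite F" "\<And>e. e \<in> F \<Longrightarrow> e \<subseteq> V"
  shows "(\<Prod>e\<in>F. \<Prod>i\<in>e. f i) = (\<Prod>i\<in>V. f i ^ card {e \<in> F. i \<in> e})"
proof -
  have "(\<Prod>e\<in>F. \<Prod>i\<in>e. f i) = (\<Prod>e\<in>F. prod f {i. i \<in> V \<and> i \<in> e})"
    using assms(3) by (intro prod.cong refl) (auto intro!: prod.cong)
  also have "\<dots> = (\<Prod>i\<in>V. \<Prod>e | e \<in> F \<and> i \<in> e. f i)"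
    by (rule prod.swap_restrict[OF assms(2,1)])
  finally show ?thesis
    by simp
qed

lemma card_nsets_2_containing:
  assumes "finite S" "i \<in> S"
  shows "card {e \<in> [S]\<^bsup>2\<^esup>. i \<in> e} = card S - 1"
proof -
  have "{e \<in> [S]\<^bsup>2\<^esup>. i \<in> e} = (\<lambda>j. {i, j}) ` (S - {i})"
    using assms(2) by (auto simp: nsets_2_eq)
  moreover have "inj_on (\<lambda>j. {i, j}) (S - {i})"
    by (auto simp: inj_on_def doubleton_eq_iff)
  ultimately show ?thesis
    using assms by (simp add: card_image)
qed

lemma prod_over_clique:
  fixes f :: "'a \<Rightarrow> real"
  assumes "finite S"
  shows "(\<Prod>e\<in>[S]\<^bsup>2\<^esup>. \<Prod>i\<in>e. f i) = (\<Prod>i\<in>S. f i ^ (card S - 1))"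
proof -
  have "(\<Prod>e\<in>[S]\<^bsup>2\<^esup>. \<Prod>i\<in>e. f i) = (\<Prod>i\<in>S. f i ^ card {e \<in> [S]\<^bsup>2\<^esup>. i \<in> e})"
    using assms by (intro prod_over_edges) (auto simp: nsets_def)
  also have "\<dots> = (\<Prod>i\<in>S. f i ^ (card S - 1))"
    using assms by (intro prod.cong refl) (simp only: card_nsets_2_containing)
  finally show ?thesis .
qed

text \<open>Deleting the heavy vertices from a clique leaves a clique on light vertices.\<close>

lemma light_clique_exists:
  assumes "card (heavy n t w) + m \<le> clique_number {1..n} E"
  shows "\<exists>S\<in>[{1..n} - heavy n t w]\<^bsup>m\<^esup>. clique S E"
proof -
  obtain K where K: "K \<subseteq> {1..n}" "card K = card (heavy n t w) + m" "clique K E"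
    using assms clique_number_ge_iff[of "{1..n}" "card (heavy n t w) + m" E] by auto
  have "finite K"
    using K(1) finite_subset by blast
  have "m \<le> card (K - heavy n t w)"
    using K(2) diff_card_le_card_Diff[of "heavy n t w" K] by simp
  then obtain S where S: "S \<subseteq> K - heavy n t w" "card S = m"
    by (meson obtain_subset_with_card_n)
  have "finite S"
    using S(1) \<open>finite K\<close> finite_subset by blast
  then have "S \<in> [{1..n} - heavy n t w]\<^bsup>m\<^esup>"
    using S K(1) by (auto simp: nsets_def)
  moreover have "clique S E"
    using K(3) S(1) smaller_clique by blast
  ultimately show ?thesis
    by blast
qed

text \<open>
  Either more than \<open>k\<close> vertices are heavy, or a clique with \<open>4 + k\<close> vertices contains four light
  vertices forming a clique. Each vertex of a clique on four vertices has degree three, so the expected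
  number of such cliques is at most \<open>n ^ 4 * (b / n) ^ 6\<close> times the fourth power of the truncated third
  moment.
\<close>

lemma (in weight_law) measure_clique_number_ge_4_le:
  assumes "0 \<le> t" "1 \<le> n"
  shows "measure (graph n) {E. 4 + k \<le> clique_number {1..n} E} \<le>
    real n * prob {t<..} / (real k + 1) +
    b ^ 6 * ((\<integral>x. x ^ 3 * indicator {..t} x \<partial>D) / sqrt (real n)) ^ 4"
proof -
  define g where "g x = x ^ 3 * indicator {..t} x" for x :: real
  define B where "B = {w \<in> space (weights {1..n}). k < card (heavy n t w)}"
  have B [measurable]: "B \<in> sets (weights {1..n})"
    unfolding B_def by measurable
  have g_int: "integrable D g"
  proof (rule integrable_const_bound[where B = "t ^ 3"])
    show "AE x in D. norm (g x) \<le> t ^ 3"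
      using nonneg_D by eventually_elim (use assms(1) in \<open>auto simp: g_def indicator_def power_mono\<close>)
    show "g \<in> borel_measurable D"
      unfolding measurable_D g_def by measurable
  qed
  define h where "h w = indicator B w + (\<Sum>S\<in>[{1..n}]\<^bsup>4\<^esup>. (b / real n) ^ 6 * (\<Prod>i\<in>S. g (w i)))" for w
  have int_prod: "integrable (weights {1..n}) (\<lambda>w. \<Prod>i\<in>S. g (w i))"
    "(\<integral>w. (\<Prod>i\<in>S. g (w i)) \<partial>weights {1..n}) = (\<integral>x. g x \<partial>D) ^ 4" if "S \<in> [{1..n}]\<^bsup>4\<^esup>" for S
    using integrable_weights_prod[of "{1..n}" S "\<lambda>_. g"] integral_weights_prod[of "{1..n}" S "\<lambda>_. g"]
      that g_int by (auto simp: nsets_def)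
  have int1: "integrable (weights {1..n}) (indicator B :: _ \<Rightarrow> real)"
    using B by (simp add: W.emeasure_eq_measure)
  have int2: "integrable (weights {1..n})
      (\<lambda>w. \<Sum>S\<in>[{1..n}]\<^bsup>4\<^esup>. (b / real n) ^ 6 * (\<Prod>i\<in>S. g (w i)))"
    by (intro Bochner_Integration.integrable_sum integrable_mult_right int_prod)
  have "measure (graph n) {E. 4 + k \<le> clique_number {1..n} E} \<le> (\<integral>w. h w \<partial>weights {1..n})"
  proof (rule measure_graph_le)
    show "integrable (weights {1..n}) h"
      unfolding h_def by (intro Bochner_Integration.integrable_add int1 int2)
  next
    fix w :: "nat \<Rightarrow> real"
    assume w: "\<And>i. i \<in> {1..n} \<Longrightarrow> 0 \<le> w i" "w \<in> space (weights {1..n})"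
    let ?K = "edges_given_weights b n w"
    have nn: "0 \<le> (b / real n) ^ 6 * (\<Prod>i\<in>S. g (w i))" if "S \<in> [{1..n}]\<^bsup>4\<^esup>" for S
      using that w(1) b_pos by (intro mult_nonneg_nonneg prod_nonneg) (auto simp: g_def nsets_def)
    show "measure_pmf.prob ?K {E. 4 + k \<le> clique_number {1..n} E} \<le> h w"
    proof (cases "w \<in> B")
      case True
      then show ?thesis
        using measure_pmf.prob_le_1[of ?K] nn unfolding h_def
        by (intro order_trans[OF measure_pmf.prob_le_1]) (simp add: sum_nonneg)
    next
      case False
      then have "card (heavy n t w) \<le> k"
        using w(2) by (simp add: B_def)
      let ?L = "{1..n} - heavy n t w"
      have "{E. 4 + k \<le> clique_number {1..n} E} \<subseteq> (\<Union>S\<in>[?L]\<^bsup>4\<^esup>. {E. [S]\<^bsup>2\<^esup> \<subseteq> E})"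
        using light_clique_exists[of n t w 4] \<open>card (heavy n t w) \<le> k\<close>
        by (fastforce simp flip: clique_iff_nsets)
      then have "measure_pmf.prob ?K {E. 4 + k \<le> clique_number {1..n} E} \<le>
          measure_pmf.prob ?K (\<Union>S\<in>[?L]\<^bsup>4\<^esup>. {E. [S]\<^bsup>2\<^esup> \<subseteq> E})"
        by (intro measure_pmf.finite_measure_mono) auto
      also have "\<dots> \<le> (\<Sum>S\<in>[?L]\<^bsup>4\<^esup>. measure_pmf.prob ?K {E. [S]\<^bsup>2\<^esup> \<subseteq> E})"
        by (intro measure_pmf.finite_measure_subadditive_finite) auto
      also have "\<dots> \<le> (\<Sum>S\<in>[?L]\<^bsup>4\<^esup>. (b / real n) ^ 6 * (\<Prod>i\<in>S. g (w i)))"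
      proof (rule sum_mono)
        fix S assume S: "S \<in> [?L]\<^bsup>4\<^esup>"
        then have S': "S \<subseteq> {1..n}" "finite S" "card S = 4"
          by (auto simp: nsets_def)
        have "measure_pmf.prob ?K {E. [S]\<^bsup>2\<^esup> \<subseteq> E} \<le>
            (b / real n) ^ card ([S]\<^bsup>2\<^esup>) * (\<Prod>e\<in>[S]\<^bsup>2\<^esup>. \<Prod>i\<in>e. w i)"
          using S' w(1) b_pos by (intro prob_given_weights_superset_le nsets_mono) auto
        also have "(\<Prod>e\<in>[S]\<^bsup>2\<^esup>. \<Prod>i\<in>e. w i) = (\<Prod>i\<in>S. w i ^ 3)"
          using S' by (simp add: prod_over_clique)
        also have "\<dots> = (\<Prod>i\<in>S. g (w i))"
          using S by (intro prod.cong refl) (auto simp: g_def heavy_def nsets_def subset_iff)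
        also have "card ([S]\<^bsup>2\<^esup>) = 6"
          using S' by (simp add: choose_two)
        finally show "measure_pmf.prob ?K {E. [S]\<^bsup>2\<^esup> \<subseteq> E} \<le> (b / real n) ^ 6 * (\<Prod>i\<in>S. g (w i))" .
      qed
      also have "\<dots> \<le> (\<Sum>S\<in>[{1..n}]\<^bsup>4\<^esup>. (b / real n) ^ 6 * (\<Prod>i\<in>S. g (w i)))"
        using nn by (intro sum_mono2 nsets_mono) auto
      also have "\<dots> \<le> h w"
        by (simp add: h_def)
      finally show ?thesis .
    qed
  qed
  also have "(\<integral>w. h w \<partial>weights {1..n}) =
      measure (weights {1..n}) B + real (n choose 4) * ((b / real n) ^ 6 * (\<integral>x. g x \<partial>D) ^ 4)"
    unfolding h_def
    by (subst Bochner_Integration.integral_add[OF int1 int2], subst Bochner_Integration.integral_sum)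
       (auto intro!: int_prod integrable_mult_right simp: int_prod(2))
  also have "\<dots> \<le> real n * prob {t<..} / (real k + 1) +
      real n ^ 4 * ((b / real n) ^ 6 * (\<integral>x. g x \<partial>D) ^ 4)"
  proof (intro add_mono mult_right_mono)
    show "measure (weights {1..n}) B \<le> real n * prob {t<..} / (real k + 1)"
      unfolding B_def by (rule heavy_markov)
    have "n choose 4 \<le> n ^ 4"
      by (cases "4 \<le> n") (auto intro: binomial_le_pow simp: binomial_eq_0)
    then show "real (n choose 4) \<le> real n ^ 4"
      by (metis of_nat_le_iff of_nat_power)
  qed auto
  also have "real n ^ 4 * ((b / real n) ^ 6 * (\<integral>x. g x \<partial>D) ^ 4) =
      b ^ 6 * ((\<integral>x. g x \<partial>D) / sqrt (real n)) ^ 4"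
  proof -
    have "sqrt (real n) ^ 4 = (real n)\<^sup>2"
      using power_mult[of "sqrt (real n)" 2 2] by simp
    moreover have "real n ^ 4 / real n ^ 6 = 1 / (real n)\<^sup>2"
      using assms(2) by (simp add: frac_eq_eq flip: power_add)
    moreover have "real n ^ 4 * ((b / real n) ^ 6 * m ^ 4) = b ^ 6 * (m ^ 4 * (real n ^ 4 / real n ^ 6))"
      for m :: real
      by (simp add: power_divide)
    ultimately show ?thesis
      by (simp only: power_divide) simp
  qed
  finally show ?thesis
    unfolding g_def .
qed

section \<open>Poisson approximation for the avoidance of events\<close>

text \<open>
  If each event \<open>A T\<close> is independent of the avoidance of any family of events not related to \<open>T\<close> by
  \<open>dep\<close>, then the probability of avoiding all events differs from the product of the complementary
  probabilities by at most a sum over related pairs. The events are added one at a time. When \<open>T\<close> is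
  added to \<open>F\<close>, replacing \<open>F\<close> by its members \<open>R\<close> unrelated to \<open>T\<close> makes \<open>A T\<close> independent of the
  avoidance of the other events, and the cost of this replacement is bounded by the terms of the members
  \<open>C\<close> related to \<open>T\<close>.
\<close>

lemma (in prob_space) prob_none_approx:
  fixes A :: "'i \<Rightarrow> 'a set"
  assumes fin: "finite S" and ev: "\<And>T. T \<in> S \<Longrightarrow> A T \<in> events"
    and indep: "\<And>T R. T \<in> S \<Longrightarrow> R \<subseteq> S \<Longrightarrow> (\<And>T'. T' \<in> R \<Longrightarrow> \<not> dep T T') \<Longrightarrow>
      prob (A T \<inter> (space M - (\<Union>T'\<in>R. A T'))) = prob (A T) * prob (space M - (\<Union>T'\<in>R. A T'))"
  shows "\<bar>prob (space M - (\<Union>T\<in>S. A T)) - (\<Prod>T\<in>S. 1 - prob (A T))\<bar> \<le>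
    (\<Sum>T\<in>S. \<Sum>T' | T' \<in> S \<and> T' \<noteq> T \<and> dep T T'. prob (A T \<inter> A T') + prob (A T) * prob (A T'))"
proof -
  define N where "N F = space M - (\<Union>T\<in>F. A T)" for F
  define \<delta> where "\<delta> F T = (\<Sum>T' | T' \<in> F \<and> T' \<noteq> T \<and> dep T T'. prob (A T \<inter> A T') + prob (A T) * prob (A T'))"
    for F T
  have \<delta>_mono: "\<delta> F T \<le> \<delta> F' T" if "F \<subseteq> F'" "finite F'" for F F' T
    unfolding \<delta>_def using that by (intro sum_mono2) auto
  have \<delta>_nn: "0 \<le> \<delta> F T" for F T
    unfolding \<delta>_def by (intro sum_nonneg) auto
  have N_ev: "N F \<in> events" if "F \<subseteq> S" for F
    unfolding N_def using that fin finite_subset[OF that fin] ev by (intro sets.Diff sets.finite_UN) auto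
  have "\<bar>prob (N F) - (\<Prod>T\<in>F. 1 - prob (A T))\<bar> \<le> (\<Sum>T\<in>F. \<delta> F T)" if "finite F" "F \<subseteq> S" for F
    using that
  proof (induction F rule: finite_induct)
    case empty
    then show ?case
      by (simp add: N_def prob_space)
  next
    case (insert T F)
    define p where "p = prob (A T)"
    define R where "R = {T' \<in> F. \<not> dep T T'}"
    define C where "C = {T' \<in> F. T' \<noteq> T \<and> dep T T'}"
    have F: "F \<subseteq> S" "T \<in> S" "R \<subseteq> S" and finC: "finite C" and CS: "C \<subseteq> S"
      using insert by (auto simp: R_def C_def)
    have FRC: "F = R \<union> C"
      using insert.hyps by (auto simp: R_def C_def)
    have ev': "A T \<in> events" "N F \<in> events" "N R \<in> events" "\<And>T'. T' \<in> C \<Longrightarrow> A T' \<in> events"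
      using F CS ev N_ev by auto
    have p: "0 \<le> p" "p \<le> 1"
      by (auto simp: p_def)
    have 1: "prob (A T \<inter> N F) \<le> prob (A T \<inter> N R)"
      using ev' FRC by (intro finite_measure_mono) (auto simp: N_def)
    have "prob (A T \<inter> N R) \<le> prob ((A T \<inter> N F) \<union> (\<Union>T'\<in>C. A T \<inter> A T'))"
      using ev' finC FRC by (intro finite_measure_mono sets.Un sets.finite_UN sets.Int) (auto simp: N_def)
    also have "\<dots> \<le> prob (A T \<inter> N F) + prob (\<Union>T'\<in>C. A T \<inter> A T')"
      using ev' finC by (intro measure_Un_le sets.finite_UN sets.Int) auto
    also have "prob (\<Union>T'\<in>C. A T \<inter> A T') \<le> (\<Sum>T'\<in>C. prob (A T \<inter> A T'))"
      using ev' finC by (intro finite_measure_subadditive_finite) auto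
    finally have 2: "prob (A T \<inter> N R) \<le> prob (A T \<inter> N F) + (\<Sum>T'\<in>C. prob (A T \<inter> A T'))"
      by simp
    have 3: "prob (N F) \<le> prob (N R)"
      using ev' FRC by (intro finite_measure_mono) (auto simp: N_def)
    have "prob (N R) \<le> prob (N F \<union> (\<Union>T'\<in>C. A T'))"
      using ev' finC FRC by (intro finite_measure_mono sets.Un sets.finite_UN) (auto simp: N_def)
    also have "\<dots> \<le> prob (N F) + prob (\<Union>T'\<in>C. A T')"
      using ev' finC by (intro measure_Un_le sets.finite_UN) auto
    also have "prob (\<Union>T'\<in>C. A T') \<le> (\<Sum>T'\<in>C. prob (A T'))"
      using ev' finC by (intro finite_measure_subadditive_finite) auto
    finally have 4: "prob (N R) \<le> prob (N F) + (\<Sum>T'\<in>C. prob (A T'))"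
      by simp
    have 5: "prob (A T \<inter> N R) = p * prob (N R)"
      unfolding p_def N_def using F by (intro indep) (auto simp: R_def)
    have "N (insert T F) = N F - A T \<inter> N F"
      by (auto simp: N_def)
    then have 6: "prob (N (insert T F)) = prob (N F) - prob (A T \<inter> N F)"
      using ev' by (simp add: finite_measure_Diff)
    have \<delta>_eq: "\<delta> F T = (\<Sum>T'\<in>C. prob (A T \<inter> A T')) + p * (\<Sum>T'\<in>C. prob (A T'))"
      by (simp add: \<delta>_def C_def p_def sum.distrib sum_distrib_left)
    have "\<bar>prob (A T \<inter> N F) - p * prob (N F)\<bar> \<le> \<delta> F T"
    proof -
      have "p * prob (N F) \<le> p * prob (N R)"
        using 3 p by (intro mult_left_mono)
      moreover have "p * prob (N R) \<le> p * prob (N F) + p * (\<Sum>T'\<in>C. prob (A T'))"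
        using mult_left_mono[OF 4 p(1)] by (simp add: algebra_simps)
      moreover have "0 \<le> (\<Sum>T'\<in>C. prob (A T \<inter> A T'))" "0 \<le> p * (\<Sum>T'\<in>C. prob (A T'))"
        using p by (auto intro!: sum_nonneg mult_nonneg_nonneg)
      ultimately show ?thesis
        using 1 2 5 \<delta>_eq by linarith
    qed
    then have 7: "\<bar>prob (N (insert T F)) - (1 - p) * prob (N F)\<bar> \<le> \<delta> F T"
      unfolding 6 by (simp add: algebra_simps abs_minus_commute)
    have "\<bar>(1 - p) * prob (N F) - (1 - p) * (\<Prod>T\<in>F. 1 - prob (A T))\<bar> =
        (1 - p) * \<bar>prob (N F) - (\<Prod>T\<in>F. 1 - prob (A T))\<bar>"
      using p by (simp add: abs_mult flip: right_diff_distrib)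
    also have "\<dots> \<le> 1 * \<bar>prob (N F) - (\<Prod>T\<in>F. 1 - prob (A T))\<bar>"
      using p by (intro mult_right_mono) auto
    also have "\<dots> \<le> (\<Sum>T\<in>F. \<delta> F T)"
      using insert by simp
    finally have 8: "\<bar>(1 - p) * prob (N F) - (1 - p) * (\<Prod>T\<in>F. 1 - prob (A T))\<bar> \<le> (\<Sum>T\<in>F. \<delta> F T)" .
    have "\<delta> F T + (\<Sum>T\<in>F. \<delta> F T) \<le> (\<Sum>U\<in>insert T F. \<delta> (insert T F) U)"
      using insert.hyps by (simp add: add_mono sum_mono \<delta>_mono subset_insertI)
    moreover have "(\<Prod>T\<in>insert T F. 1 - prob (A T)) = (1 - p) * (\<Prod>T\<in>F. 1 - prob (A T))"
      using insert.hyps by (simp add: p_def)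
    moreover have "\<bar>x - z\<bar> \<le> d + e" if "\<bar>x - y\<bar> \<le> d" "\<bar>y - z\<bar> \<le> e" for x y z d e :: real
      using that by linarith
    from this[OF 7 8] have "\<bar>prob (N (insert T F)) - (1 - p) * (\<Prod>T\<in>F. 1 - prob (A T))\<bar> \<le>
        \<delta> F T + (\<Sum>T\<in>F. \<delta> F T)" .
    ultimately show ?case
      by simp
  qed
  from this[OF fin order_refl] show ?thesis
    unfolding N_def \<delta>_def .
qed

section \<open>Independence over disjoint sets of vertices\<close>

context weight_law
begin

lemma integral_weights_indep:
  fixes f g :: "(nat \<Rightarrow> real) \<Rightarrow> real"
  assumes "finite I" "S \<subseteq> I"
    and f: "\<And>w w'. (\<And>i. i \<in> S \<Longrightarrow> w i = w' i) \<Longrightarrow> f w = f w'"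
    and g: "\<And>w w'. (\<And>i. i \<in> I - S \<Longrightarrow> w i = w' i) \<Longrightarrow> g w = g w'"
    and int: "integrable (weights I) f" "integrable (weights I) g"
      "integrable (weights I) (\<lambda>w. f w * g w)"
  shows "(\<integral>w. f w * g w \<partial>weights I) = (\<integral>w. f w \<partial>weights I) * (\<integral>w. g w \<partial>weights I)"
proof -
  interpret P: product_prob_space "\<lambda>_::nat. D" I
    by unfold_locales
  let ?R = "I - S"
  have I: "I = S \<union> ?R" "S \<inter> ?R = {}" "finite S" "finite ?R"
    using assms(1,2) by (auto intro: finite_subset)
  have fm: "f (merge S ?R (x, y)) = f x" and gm: "g (merge S ?R (x, y)) = g y" for x y
    by (auto intro!: f g simp: merge_def)
  have fold: "(\<integral>w. h w \<partial>weights I) = (\<integral>x. (\<integral>y. h (merge S ?R (x, y)) \<partial>weights ?R) \<partial>weights S)"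
    if "integrable (weights I) h" for h :: "(nat \<Rightarrow> real) \<Rightarrow> real"
    using P.product_integral_fold[OF I(2,3,4), of h] that I(1) by simp
  have "(\<integral>w. f w \<partial>weights I) = (\<integral>x. f x \<partial>weights S)"
    unfolding fold[OF int(1)] fm by (simp add: W.prob_space)
  moreover have "(\<integral>w. g w \<partial>weights I) = (\<integral>x. g x \<partial>weights ?R)"
    unfolding fold[OF int(2)] gm by (simp add: W.prob_space)
  moreover have "(\<integral>w. f w * g w \<partial>weights I) = (\<integral>x. f x \<partial>weights S) * (\<integral>x. g x \<partial>weights ?R)"
    unfolding fold[OF int(3)] gm fm by simp
  ultimately show ?thesis
    by simp
qed

text \<open>
  The edges within two disjoint sets of vertices are independent even without conditioning on the
  weights, since they depend on disjoint sets of weights.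
\<close>

lemma graph_indep:
  assumes "S \<subseteq> {1..n}" "S' \<subseteq> {1..n}" "S \<inter> S' = {}"
  shows "measure (graph n) {E. E \<inter> [S]\<^bsup>2\<^esup> \<in> X \<and> E \<inter> [S']\<^bsup>2\<^esup> \<in> Y} =
    measure (graph n) {E. E \<inter> [S]\<^bsup>2\<^esup> \<in> X} * measure (graph n) {E. E \<inter> [S']\<^bsup>2\<^esup> \<in> Y}"
proof -
  define f where "f w = measure_pmf.prob (bernoulli_subset ([S]\<^bsup>2\<^esup>) (edge_prob b n w)) X" for w
  define g where "g w = measure_pmf.prob (bernoulli_subset ([S']\<^bsup>2\<^esup>) (edge_prob b n w)) Y" for w
  have fin: "finite S" "finite S'"
    using assms finite_subset by blast+
  have sub: "[S]\<^bsup>2\<^esup> \<subseteq> [{1..n}]\<^bsup>2\<^esup>" "[S']\<^bsup>2\<^esup> \<subseteq> [{1..n}]\<^bsup>2\<^esup>"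
    using assms by (simp_all add: nsets_mono)
  have disj: "[S]\<^bsup>2\<^esup> \<inter> [S']\<^bsup>2\<^esup> = {}"
  proof -
    have "[S \<inter> S']\<^bsup>2\<^esup> = {}"
      unfolding assms(3) by (simp add: nsets_eq_empty)
    then show ?thesis
      by (auto simp: nsets_def)
  qed
  have f_eq: "measure_pmf.prob (edges_given_weights b n w) {E. E \<inter> [S]\<^bsup>2\<^esup> \<in> X} = f w" for w
    unfolding f_def edges_given_weights_altdef
    by (subst bernoulli_subset_restrict[symmetric, OF _ sub(1)]) (simp_all add: measure_map_pmf vimage_def)
  have g_eq: "measure_pmf.prob (edges_given_weights b n w) {E. E \<inter> [S']\<^bsup>2\<^esup> \<in> Y} = g w" for w
    unfolding g_def edges_given_weights_altdef
    by (subst bernoulli_subset_restrict[symmetric, OF _ sub(2)]) (simp_all add: measure_map_pmf vimage_def)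
  have fg_eq: "measure_pmf.prob (edges_given_weights b n w)
      {E. E \<inter> [S]\<^bsup>2\<^esup> \<in> X \<and> E \<inter> [S']\<^bsup>2\<^esup> \<in> Y} = f w * g w" for w
    unfolding f_def g_def edges_given_weights_altdef
    by (rule bernoulli_subset_indep) (use sub disj in simp_all)
  show ?thesis
    unfolding measure_graph f_eq g_eq fg_eq
  proof (rule integral_weights_indep)
    fix w w' :: "nat \<Rightarrow> real"
    assume "\<And>i. i \<in> S \<Longrightarrow> w i = w' i"
    then show "f w = f w'"
      unfolding f_def using fin
      by (subst bernoulli_subset_cong[where q = "edge_prob b n w'"])
         (simp, auto simp: edge_prob_def nsets_def subset_iff cong: prod.cong)
  next
    fix w w' :: "nat \<Rightarrow> real"
    assume *: "\<And>i. i \<in> {1..n} - S \<Longrightarrow> w i = w' i"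
    have "w i = w' i" if "i \<in> S'" for i
      using assms that by (intro *) auto
    then show "g w = g w'"
      unfolding g_def using fin
      by (subst bernoulli_subset_cong[where q = "edge_prob b n w'"])
         (simp, auto simp: edge_prob_def nsets_def subset_iff cong: prod.cong)
  next
    show "integrable (weights {1..n}) f" "integrable (weights {1..n}) g"
      "integrable (weights {1..n}) (\<lambda>w. f w * g w)"
      using integrable_given_weights[of n "{E. E \<inter> [S]\<^bsup>2\<^esup> \<in> X}"]
        integrable_given_weights[of n "{E. E \<inter> [S']\<^bsup>2\<^esup> \<in> Y}"]
        integrable_given_weights[of n "{E. E \<inter> [S]\<^bsup>2\<^esup> \<in> X \<and> E \<inter> [S']\<^bsup>2\<^esup> \<in> Y}"]
      by (simp_all only: f_eq g_eq fg_eq)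
  qed (use assms in auto)
qed

section \<open>Probabilities of triangles and of pairs of triangles\<close>

text \<open>
  Since \<open>edge_prob b n w {i, j} \<le> b * w i * w j / n\<close>, the probability that a given graph \<open>F\<close> is
  contained in the random graph is bounded by a product of moments, the exponents being the degrees
  in \<open>F\<close>.
\<close>

lemma measure_graph_superset_le:
  assumes "F \<subseteq> [V]\<^bsup>2\<^esup>" "V \<subseteq> {1..n}"
    and int: "\<And>k::nat. integrable D (\<lambda>x. x ^ k)"
  shows "measure (graph n) {E. F \<subseteq> E} \<le>
    (b / real n) ^ card F * (\<Prod>i\<in>V. \<integral>x. x ^ card {e \<in> F. i \<in> e} \<partial>D)"
proof -
  have fin: "finite V" "finite F"
    using assms finite_subset[of V] finite_subset[of F] by auto
  let ?d = "\<lambda>i. card {e \<in> F. i \<in> e}"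
  have F_sub: "F \<subseteq> [{1..n}]\<^bsup>2\<^esup>"
    using assms(1) nsets_mono[OF assms(2)] by auto
  have "measure (graph n) {E. F \<subseteq> E} \<le>
      (\<integral>w. (b / real n) ^ card F * (\<Prod>i\<in>V. w i ^ ?d i) \<partial>weights {1..n})"
  proof (rule measure_graph_le)
    show "integrable (weights {1..n}) (\<lambda>w. (b / real n) ^ card F * (\<Prod>i\<in>V. w i ^ ?d i))"
      by (intro integrable_mult_right integrable_weights_prod[where g = "\<lambda>i x. x ^ ?d i"]) (use assms in auto)
  next
    fix w :: "nat \<Rightarrow> real"
    assume "\<And>i. i \<in> {1..n} \<Longrightarrow> 0 \<le> w i"
    then have "measure_pmf.prob (edges_given_weights b n w) {E. F \<subseteq> E} \<le>
        (b / real n) ^ card F * (\<Prod>e\<in>F. \<Prod>i\<in>e. w i)"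
      using b_pos F_sub by (intro prob_given_weights_superset_le) auto
    also have "(\<Prod>e\<in>F. \<Prod>i\<in>e. w i) = (\<Prod>i\<in>V. w i ^ ?d i)"
      using fin assms(1) by (intro prod_over_edges) (auto simp: nsets_def)
    finally show "measure_pmf.prob (edges_given_weights b n w) {E. F \<subseteq> E} \<le>
        (b / real n) ^ card F * (\<Prod>i\<in>V. w i ^ ?d i)" .
  qed
  also have "\<dots> = (b / real n) ^ card F * (\<Prod>i\<in>V. \<integral>x. x ^ ?d i \<partial>D)"
    using integral_weights_prod[of "{1..n}" V "\<lambda>i x. x ^ ?d i"] assms by simp
  finally show ?thesis .
qed

lemma measure_triangle_le:
  assumes T: "T \<in> [{1..n}]\<^bsup>3\<^esup>" and int: "\<And>k::nat. integrable D (\<lambda>x. x ^ k)"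
  shows "measure (graph n) {E. clique T E} \<le> (b / real n) ^ 3 * (\<integral>x. x\<^sup>2 \<partial>D) ^ 3"
proof -
  have T': "T \<subseteq> {1..n}" "finite T" "card T = 3"
    using T by (auto simp: nsets_def)
  have "measure (graph n) {E. clique T E} \<le>
      (b / real n) ^ card ([T]\<^bsup>2\<^esup>) * (\<Prod>i\<in>T. \<integral>x. x ^ card {e \<in> [T]\<^bsup>2\<^esup>. i \<in> e} \<partial>D)"
    unfolding clique_iff_nsets by (rule measure_graph_superset_le) (use T' int in auto)
  also have "(\<Prod>i\<in>T. \<integral>x. x ^ card {e \<in> [T]\<^bsup>2\<^esup>. i \<in> e} \<partial>D) = (\<Prod>i\<in>T. \<integral>x. x\<^sup>2 \<partial>D)"
  proof (rule prod.cong[OF refl])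
    fix i assume "i \<in> T"
    then have "card {e \<in> [T]\<^bsup>2\<^esup>. i \<in> e} = 2"
      using card_nsets_2_containing[of T i] T' by simp
    then show "(\<integral>x. x ^ card {e \<in> [T]\<^bsup>2\<^esup>. i \<in> e} \<partial>D) = (\<integral>x. x\<^sup>2 \<partial>D)"
      by (simp only:)
  qed
  finally show ?thesis
    using T' by (simp add: choose_two)
qed

text \<open>
  The union of two triangles sharing \<open>c\<close> vertices has \<open>6 - (c choose 2)\<close> edges; its shared vertices
  have degree \<open>5 - c\<close> and the other ones degree two.
\<close>

lemma measure_two_triangles_le:
  assumes T: "T \<in> [{1..n}]\<^bsup>3\<^esup>" "T' \<in> [{1..n}]\<^bsup>3\<^esup>" and c: "card (T \<inter> T') = c" "1 \<le> c" "c \<le> 2"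
    and int: "\<And>k::nat. integrable D (\<lambda>x. x ^ k)"
  shows "measure (graph n) ({E. clique T E} \<inter> {E. clique T' E}) \<le>
    (b / real n) ^ (6 - (c choose 2)) *
      ((\<integral>x. x\<^sup>2 \<partial>D) ^ (6 - 2 * c) * (\<integral>x. x ^ (5 - c) \<partial>D) ^ c)"
proof -
  have T': "T \<subseteq> {1..n}" "finite T" "card T = 3" "T' \<subseteq> {1..n}" "finite T'" "card T' = 3"
    using T by (auto simp: nsets_def)
  let ?F = "[T]\<^bsup>2\<^esup> \<union> [T']\<^bsup>2\<^esup>" and ?V = "T \<union> T'"
  have Int: "[T]\<^bsup>2\<^esup> \<inter> [T']\<^bsup>2\<^esup> = [T \<inter> T']\<^bsup>2\<^esup>"
    by (auto simp: nsets_def)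
  have "card ?F + card ([T]\<^bsup>2\<^esup> \<inter> [T']\<^bsup>2\<^esup>) = card ([T]\<^bsup>2\<^esup>) + card ([T']\<^bsup>2\<^esup>)"
    using T' by (intro card_Un_Int[symmetric]) auto
  then have card_F: "card ?F = 6 - (c choose 2)"
    unfolding Int using T' c by (simp add: choose_two)
  have deg: "card {e \<in> ?F. i \<in> e} = (if i \<in> T \<inter> T' then 5 - c else 2)" if "i \<in> ?V" for i
  proof -
    let ?A = "{e \<in> [T]\<^bsup>2\<^esup>. i \<in> e}" and ?B = "{e \<in> [T']\<^bsup>2\<^esup>. i \<in> e}"
    have AB: "{e \<in> ?F. i \<in> e} = ?A \<union> ?B" "?A \<inter> ?B = {e \<in> [T \<inter> T']\<^bsup>2\<^esup>. i \<in> e}"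
      using Int by auto
    have fin: "finite ?A" "finite ?B"
      using T' by auto
    have empty: "card {e \<in> [U]\<^bsup>2\<^esup>. i \<in> e} = 0" if "i \<notin> U" for U
    proof -
      have "{e \<in> [U]\<^bsup>2\<^esup>. i \<in> e} = {}"
        using that by (auto simp: nsets_def)
      then show ?thesis
        by (simp only: card.empty)
    qed
    have *: "card (?A \<union> ?B) + card {e \<in> [T \<inter> T']\<^bsup>2\<^esup>. i \<in> e} = card ?A + card ?B"
      unfolding AB(2)[symmetric] by (rule card_Un_Int[symmetric, OF fin])
    show ?thesis
    proof (cases "i \<in> T \<inter> T'")
      case True
      then have "card ?A = 2" "card ?B = 2" "card {e \<in> [T \<inter> T']\<^bsup>2\<^esup>. i \<in> e} = c - 1"
        using T' c by (simp_all add: card_nsets_2_containing)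
      then show ?thesis
        using * True c AB(1) by simp
    next
      case False
      then have "card ?A + card ?B = 2"
        using that T' by (auto simp: card_nsets_2_containing empty)
      then show ?thesis
        using * False AB(1) empty[OF False] by (simp only: if_not_P) simp
    qed
  qed
  have "measure (graph n) {E. ?F \<subseteq> E} \<le>
      (b / real n) ^ card ?F * (\<Prod>i\<in>?V. \<integral>x. x ^ card {e \<in> ?F. i \<in> e} \<partial>D)"
    by (rule measure_graph_superset_le)
       (use T' int nsets_mono[of T "T \<union> T'" 2] nsets_mono[of T' "T \<union> T'" 2] in auto)
  also have "(\<Prod>i\<in>?V. \<integral>x. x ^ card {e \<in> ?F. i \<in> e} \<partial>D) =
      (\<Prod>i\<in>?V. if i \<in> T \<inter> T' then \<integral>x. x ^ (5 - c) \<partial>D else \<integral>x. x\<^sup>2 \<partial>D)"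
    by (intro prod.cong refl) (simp only: deg if_distrib[where f = "\<lambda>d. \<integral>x. x ^ d \<partial>D"])
  also have "\<dots> = (\<integral>x. x ^ (5 - c) \<partial>D) ^ card (?V \<inter> {i. i \<in> T \<inter> T'}) *
      (\<integral>x. x\<^sup>2 \<partial>D) ^ card (?V \<inter> - {i. i \<in> T \<inter> T'})"
    using T' by (simp add: prod.If_cases)
  also have "?V \<inter> {i. i \<in> T \<inter> T'} = T \<inter> T'"
    by auto
  also have "card (?V \<inter> - {i. i \<in> T \<inter> T'}) = 6 - 2 * c"
  proof -
    have "?V \<inter> - {i. i \<in> T \<inter> T'} = ?V - T \<inter> T'"
      by auto
    moreover have "card (?V - T \<inter> T') = card ?V - card (T \<inter> T')"
      using T' by (intro card_Diff_subset) auto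
    moreover have "card ?V + c = 6"
      using card_Un_Int[of T T'] T' c by simp
    ultimately show ?thesis
      using c by simp
  qed
  finally show ?thesis
    using card_F c by (simp add: clique_iff_nsets Collect_conj_eq mult.commute)
qed

text \<open>
  For weights at most \<open>K\<close> the bound \<open>edge_prob b n w e \<le> b * w i * w j / n\<close> for \<open>e = {i, j}\<close> is sharp
  up to the factor \<open>exp (- (b * K\<^sup>2 / n))\<close>, because \<open>1 - exp (- y) \<ge> y * exp (- y)\<close>.
\<close>

lemma measure_triangle_ge:
  assumes T: "T \<in> [{1..n}]\<^bsup>3\<^esup>" and K: "0 \<le> K"
  shows "((b / real n) * exp (- (b * K\<^sup>2 / real n))) ^ 3 *
      (\<integral>x. x\<^sup>2 * indicator {..K} x \<partial>D) ^ 3 \<le> measure (graph n) {E. clique T E}"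
proof -
  have T': "T \<subseteq> {1..n}" "finite T" "card T = 3"
    using T by (auto simp: nsets_def)
  define g where "g x = x\<^sup>2 * indicator {..K} x" for x :: real
  have g_int: "integrable D g"
  proof (rule integrable_const_bound[where B = "K\<^sup>2"])
    show "AE x in D. norm (g x) \<le> K\<^sup>2"
      using nonneg_D by eventually_elim (use K in \<open>auto simp: g_def indicator_def power_mono\<close>)
    show "g \<in> borel_measurable D"
      unfolding measurable_D g_def by measurable
  qed
  let ?c = "(b / real n) * exp (- (b * K\<^sup>2 / real n))"
  have "?c ^ 3 * (\<integral>x. g x \<partial>D) ^ 3 = (\<integral>w. ?c ^ 3 * (\<Prod>i\<in>T. g (w i)) \<partial>weights {1..n})"
    using integral_weights_prod[of "{1..n}" T "\<lambda>_. g"] g_int T' by simp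
  also have "\<dots> \<le> (\<integral>w. measure_pmf.prob (edges_given_weights b n w) {E. clique T E} \<partial>weights {1..n})"
  proof (rule integral_mono_AE)
    show "integrable (weights {1..n}) (\<lambda>w. ?c ^ 3 * (\<Prod>i\<in>T. g (w i)))"
      by (intro integrable_mult_right integrable_weights_prod[where g = "\<lambda>_. g"]) (use T' g_int in auto)
    show "AE w in weights {1..n}. ?c ^ 3 * (\<Prod>i\<in>T. g (w i)) \<le>
        measure_pmf.prob (edges_given_weights b n w) {E. clique T E}"
      using AE_weights_nonneg
    proof eventually_elim
      fix w :: "nat \<Rightarrow> real"
      assume w: "\<forall>i\<in>{1..n}. 0 \<le> w i"
      show "?c ^ 3 * (\<Prod>i\<in>T. g (w i)) \<le>
          measure_pmf.prob (edges_given_weights b n w) {E. clique T E}"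
      proof (cases "\<forall>i\<in>T. w i \<le> K")
        case False
        then obtain i where "i \<in> T" "\<not> w i \<le> K"
          by blast
        then have "(\<Prod>i\<in>T. g (w i)) = 0"
          using T' by (intro prod_zero bexI[of _ i]) (auto simp: g_def)
        then show ?thesis
          by simp
      next
        case True
        have *: "?c * (\<Prod>i\<in>e. w i) \<le> edge_prob b n w e" "0 \<le> ?c * (\<Prod>i\<in>e. w i)" if "e \<in> [T]\<^bsup>2\<^esup>" for e
        proof -
          have e: "e \<subseteq> T" "card e = 2"
            using that by (auto simp: nsets_def)
          have nn: "0 \<le> (\<Prod>i\<in>e. w i)"
            using e T' w by (intro prod_nonneg) auto
          then show "0 \<le> ?c * (\<Prod>i\<in>e. w i)"
            using b_pos by simp
          have "(\<Prod>i\<in>e. w i) \<le> (\<Prod>i\<in>e. K)"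
            using e T' w True by (intro prod_mono) auto
          then have le: "(\<Prod>i\<in>e. w i) \<le> K\<^sup>2"
            using e by simp
          define y where "y = b * (\<Prod>i\<in>e. w i) / real n"
          have "0 \<le> y"
            unfolding y_def using nn b_pos by simp
          have "y \<le> b * K\<^sup>2 / real n"
            unfolding y_def using le b_pos by (intro divide_right_mono mult_left_mono) auto
          then have "y * exp (- (b * K\<^sup>2 / real n)) \<le> y * exp (- y)"
            using \<open>0 \<le> y\<close> by (intro mult_left_mono) auto
          also have "\<dots> \<le> 1 - exp (- y)"
            using exp_ge_add_one_self[of y] by (simp add: exp_minus field_simps)
          finally show "?c * (\<Prod>i\<in>e. w i) \<le> edge_prob b n w e"
            by (simp add: y_def edge_prob_def mult_ac)
        qed
        have "?c ^ 3 * (\<Prod>i\<in>T. g (w i)) = ?c ^ 3 * (\<Prod>i\<in>T. (w i)\<^sup>2)"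
          using True by (intro arg_cong2[where f = "(*)"] prod.cong refl) (auto simp: g_def)
        also have "\<dots> = ?c ^ card ([T]\<^bsup>2\<^esup>) * (\<Prod>e\<in>[T]\<^bsup>2\<^esup>. \<Prod>i\<in>e. w i)"
          using T' by (simp add: prod_over_clique choose_two)
        also have "\<dots> = (\<Prod>e\<in>[T]\<^bsup>2\<^esup>. ?c * (\<Prod>i\<in>e. w i))"
          using prod.distrib[of "\<lambda>_. ?c" "\<lambda>e. \<Prod>i\<in>e. w i" "[T]\<^bsup>2\<^esup>"] by (simp only: prod_constant)
        also have "\<dots> \<le> (\<Prod>e\<in>[T]\<^bsup>2\<^esup>. edge_prob b n w e)"
          using * by (intro prod_mono) auto
        also have "\<dots> = measure_pmf.prob (edges_given_weights b n w) {E. clique T E}"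
          unfolding clique_iff_nsets
          by (rule prob_given_weights_superset[symmetric]) (use b_pos w T' nsets_mono[of T "{1..n}"] in simp_all)
        finally show ?thesis .
      qed
    qed
  qed (rule integrable_given_weights)
  finally show ?thesis
    unfolding measure_graph g_def .
qed

end

section \<open>Triangles\<close>

text \<open>
  A pair of triples with a given union of \<open>m\<close> elements consists of two of its \<open>2 ^ m\<close> subsets.
\<close>

lemma card_pairs_with_union:
  fixes V :: "'a set"
  assumes "finite V"
  shows "card {(T, T'). T \<in> [V]\<^bsup>3\<^esup> \<and> T' \<in> [V]\<^bsup>3\<^esup> \<and> card (T \<union> T') = m} \<le> 4 ^ m * card V ^ m"
proof -
  have "{(T, T'). T \<in> [V]\<^bsup>3\<^esup> \<and> T' \<in> [V]\<^bsup>3\<^esup> \<and> card (T \<union> T') = m} \<subseteq> (\<Union>U\<in>[V]\<^bsup>m\<^esup>. Pow U \<times> Pow U)"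
  proof clarify
    fix T T' assume "T \<in> [V]\<^bsup>3\<^esup>" "T' \<in> [V]\<^bsup>3\<^esup>" "m = card (T \<union> T')"
    then show "(T, T') \<in> (\<Union>U\<in>[V]\<^bsup>card (T \<union> T')\<^esup>. Pow U \<times> Pow U)"
      by (intro UN_I[of "T \<union> T'"]) (auto simp: nsets_def)
  qed
  then have "card {(T, T'). T \<in> [V]\<^bsup>3\<^esup> \<and> T' \<in> [V]\<^bsup>3\<^esup> \<and> card (T \<union> T') = m} \<le>
      card (\<Union>U\<in>[V]\<^bsup>m\<^esup>. Pow U \<times> Pow U)"
    by (intro card_mono) (use assms in \<open>auto simp: nsets_def\<close>)
  also have "\<dots> \<le> (\<Sum>U\<in>[V]\<^bsup>m\<^esup>. card (Pow U \<times> Pow U))"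
    by (intro card_UN_le) (use assms in simp)
  also have "\<dots> = (\<Sum>U\<in>[V]\<^bsup>m\<^esup>. 4 ^ m)"
  proof (rule sum.cong[OF refl])
    fix U assume "U \<in> [V]\<^bsup>m\<^esup>"
    then have "card (Pow U \<times> Pow U) = 2 ^ m * 2 ^ m"
      by (simp add: card_cartesian_product card_Pow nsets_def)
    also have "\<dots> = (4 :: nat) ^ m"
      by (simp flip: power_mult_distrib)
    finally show "card (Pow U \<times> Pow U) = 4 ^ m" .
  qed
  also have "\<dots> = 4 ^ m * (card V choose m)"
    by simp
  also have "\<dots> \<le> 4 ^ m * card V ^ m"
    by (cases "m \<le> card V") (auto intro: binomial_le_pow simp: binomial_eq_0)
  finally show ?thesis .
qed

context weight_law
begin

text \<open>
  Triangles on disjoint vertex sets are independent, so only pairs of distinct triangles sharing one or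
  two vertices contribute to the error, and their vertex sets have five or four elements in total.
\<close>

lemma triangle_free_approx:
  assumes int: "\<And>k::nat. integrable D (\<lambda>x. x ^ k)"
  defines "m \<equiv> \<lambda>k. \<integral>x. x ^ k \<partial>D"
  shows "\<bar>measure (graph n) {E. \<forall>T\<in>[{1..n}]\<^bsup>3\<^esup>. \<not> clique T E} -
      (\<Prod>T\<in>[{1..n}]\<^bsup>3\<^esup>. 1 - measure (graph n) {E. clique T E})\<bar> \<le>
    4 ^ 5 * real n ^ 5 * ((b / real n) ^ 6 * (m 2 ^ 4 * m 4) + ((b / real n) ^ 3 * m 2 ^ 3)\<^sup>2) +
    4 ^ 4 * real n ^ 4 * ((b / real n) ^ 5 * (m 2 ^ 2 * m 3 ^ 2) + ((b / real n) ^ 3 * m 2 ^ 3)\<^sup>2)"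
proof -
  interpret G: prob_space "graph n"
    by (rule prob_space_graph)
  let ?S = "[{1..n}]\<^bsup>3\<^esup>"
  define A where "A T = {E. clique T E}" for T :: "nat set"
  define q where "q = (b / real n) ^ 3 * m 2 ^ 3"
  \<comment> \<open>The contribution of a pair of triangles that share \<open>c\<close> vertices is at most \<open>\<beta> c\<close>.\<close>
  define \<beta> where "\<beta> c = (b / real n) ^ (6 - (c choose 2)) * (m 2 ^ (6 - 2 * c) * m (5 - c) ^ c) + q\<^sup>2" for c
  have p_le: "G.prob (A T) \<le> q" if "T \<in> ?S" for T
    unfolding A_def q_def m_def by (rule measure_triangle_le[OF that int])
  have m_nn: "0 \<le> m k" for k
    unfolding m_def using nonneg_D by (intro integral_nonneg_AE) (auto elim!: eventually_mono)
  have q: "0 \<le> q"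
    using b_pos m_nn unfolding q_def by simp
  have \<beta>_nn: "0 \<le> \<beta> c" for c
    unfolding \<beta>_def using m_nn b_pos by simp
  have "\<bar>G.prob (space (graph n) - (\<Union>T\<in>?S. A T)) - (\<Prod>T\<in>?S. 1 - G.prob (A T))\<bar> \<le>
      (\<Sum>T\<in>?S. \<Sum>T' | T' \<in> ?S \<and> T' \<noteq> T \<and> T \<inter> T' \<noteq> {}.
         G.prob (A T \<inter> A T') + G.prob (A T) * G.prob (A T'))"
  proof (rule G.prob_none_approx[where dep = "\<lambda>T T'. T \<inter> T' \<noteq> {}"])
    fix T R
    assume T: "T \<in> ?S" and R: "R \<subseteq> ?S" "\<And>T'. T' \<in> R \<Longrightarrow> \<not> T \<inter> T' \<noteq> {}"
    let ?V = "{1..n} - T"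
    have A_eq: "A T = {E. E \<inter> [T]\<^bsup>2\<^esup> \<in> A T}"
      by (auto simp: A_def clique_iff_nsets)
    have R_sub: "[T']\<^bsup>2\<^esup> \<subseteq> [?V]\<^bsup>2\<^esup>" if "T' \<in> R" for T'
      using R that by (intro nsets_mono) (fastforce simp: nsets_def)
    have N_eq: "space (graph n) - (\<Union>T'\<in>R. A T') = {E. E \<inter> [?V]\<^bsup>2\<^esup> \<in> - (\<Union>T'\<in>R. A T')}"
      using R_sub by (fastforce simp: A_def clique_iff_nsets)
    have "G.prob {E. E \<inter> [T]\<^bsup>2\<^esup> \<in> A T \<and> E \<inter> [?V]\<^bsup>2\<^esup> \<in> - (\<Union>T'\<in>R. A T')} =
        G.prob {E. E \<inter> [T]\<^bsup>2\<^esup> \<in> A T} * G.prob {E. E \<inter> [?V]\<^bsup>2\<^esup> \<in> - (\<Union>T'\<in>R. A T')}"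
      using T by (intro graph_indep) (auto simp: nsets_def)
    then show "G.prob (A T \<inter> (space (graph n) - (\<Union>T'\<in>R. A T'))) =
        G.prob (A T) * G.prob (space (graph n) - (\<Union>T'\<in>R. A T'))"
      using A_eq N_eq by (simp only: Collect_conj_eq)
  qed auto
  also have "\<dots> \<le> (\<Sum>T\<in>?S. \<Sum>T' | T' \<in> ?S \<and> T' \<noteq> T \<and> T \<inter> T' \<noteq> {}. \<beta> (card (T \<inter> T')))"
  proof (intro sum_mono)
    fix T T' assume T: "T \<in> ?S" and "T' \<in> {T'. T' \<in> ?S \<and> T' \<noteq> T \<and> T \<inter> T' \<noteq> {}}"
    then have T': "T' \<in> ?S" "T' \<noteq> T" "T \<inter> T' \<noteq> {}"
      by auto
    have "T \<inter> T' \<subset> T"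
    proof (rule psubsetI)
      show "T \<inter> T' \<noteq> T"
        using T T' card_subset_eq[of T' T] by (auto simp: nsets_def)
    qed auto
    then have "card (T \<inter> T') < 3"
      using T psubset_card_mono[of T "T \<inter> T'"] by (auto simp: nsets_def)
    moreover have "0 < card (T \<inter> T')"
      using T T' by (auto simp: card_gt_0_iff nsets_def)
    ultimately have "G.prob (A T \<inter> A T') \<le> (b / real n) ^ (6 - (card (T \<inter> T') choose 2)) *
      (m 2 ^ (6 - 2 * card (T \<inter> T')) * m (5 - card (T \<inter> T')) ^ card (T \<inter> T'))"
      unfolding A_def m_def using T T' int by (intro measure_two_triangles_le) auto
    moreover have "G.prob (A T) * G.prob (A T') \<le> q * q"
      using T T' q by (intro mult_mono p_le) auto
    ultimately show "G.prob (A T \<inter> A T') + G.prob (A T) * G.prob (A T') \<le> \<beta> (card (T \<inter> T'))"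
      by (simp add: \<beta>_def power2_eq_square)
  qed
  also have "\<dots> \<le> (\<Sum>T\<in>?S. \<Sum>T'\<in>?S. of_bool (card (T \<union> T') = 5) * \<beta> 1 + of_bool (card (T \<union> T') = 4) * \<beta> 2)"
  proof (intro sum_mono)
    fix T assume T: "T \<in> ?S"
    have "(\<Sum>T' | T' \<in> ?S \<and> T' \<noteq> T \<and> T \<inter> T' \<noteq> {}. \<beta> (card (T \<inter> T'))) \<le>
        (\<Sum>T' | T' \<in> ?S \<and> T' \<noteq> T \<and> T \<inter> T' \<noteq> {}.
          of_bool (card (T \<union> T') = 5) * \<beta> 1 + of_bool (card (T \<union> T') = 4) * \<beta> 2)"
    proof (rule sum_mono)
      fix T' assume "T' \<in> {T'. T' \<in> ?S \<and> T' \<noteq> T \<and> T \<inter> T' \<noteq> {}}"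
      then have T': "T' \<in> ?S" "T' \<noteq> T" "T \<inter> T' \<noteq> {}"
        by auto
      have fin: "finite T" "finite T'" "card T = 3" "card T' = 3"
        using T T' by (auto simp: nsets_def)
      have "T \<inter> T' \<noteq> T"
        using T T' card_subset_eq[of T' T] by (auto simp: nsets_def)
      then have "card (T \<inter> T') < 3"
        using fin psubset_card_mono[of T "T \<inter> T'"] by auto
      moreover have "0 < card (T \<inter> T')"
        using T' fin by (auto simp: card_gt_0_iff)
      moreover have "card (T \<union> T') + card (T \<inter> T') = 6"
        using card_Un_Int[of T T'] fin by simp
      ultimately have "card (T \<inter> T') = 1 \<and> card (T \<union> T') = 5 \<or> card (T \<inter> T') = 2 \<and> card (T \<union> T') = 4"
        by linarith
      then show "\<beta> (card (T \<inter> T')) \<le>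
          of_bool (card (T \<union> T') = 5) * \<beta> 1 + of_bool (card (T \<union> T') = 4) * \<beta> 2"
        by auto
    qed
    also have "\<dots> \<le> (\<Sum>T'\<in>?S. of_bool (card (T \<union> T') = 5) * \<beta> 1 + of_bool (card (T \<union> T') = 4) * \<beta> 2)"
      using \<beta>_nn by (intro sum_mono2) auto
    finally show "(\<Sum>T' | T' \<in> ?S \<and> T' \<noteq> T \<and> T \<inter> T' \<noteq> {}. \<beta> (card (T \<inter> T'))) \<le>
        (\<Sum>T'\<in>?S. of_bool (card (T \<union> T') = 5) * \<beta> 1 + of_bool (card (T \<union> T') = 4) * \<beta> 2)" .
  qed
  also have "\<dots> = real (card {(T, T'). T \<in> ?S \<and> T' \<in> ?S \<and> card (T \<union> T') = 5}) * \<beta> 1 +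
      real (card {(T, T'). T \<in> ?S \<and> T' \<in> ?S \<and> card (T \<union> T') = 4}) * \<beta> 2"
  proof -
    have *: "(\<Sum>T\<in>?S. \<Sum>T'\<in>?S. of_bool (card (T \<union> T') = k) * y) =
        real (card {(T, T'). T \<in> ?S \<and> T' \<in> ?S \<and> card (T \<union> T') = k}) * y" for k and y :: real
    proof -
      have "(\<Sum>T\<in>?S. \<Sum>T'\<in>?S. of_bool (card (T \<union> T') = k) * y) =
          (\<Sum>z\<in>?S \<times> ?S. of_bool (card (fst z \<union> snd z) = k) * y)"
        by (subst sum.cartesian_product) (simp only: case_prod_unfold)
      also have "\<dots> = real (card {z \<in> ?S \<times> ?S. card (fst z \<union> snd z) = k}) * y"
        by (subst sum_distrib_right[symmetric]) (simp add: of_bool_def sum.If_cases Int_def)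
      also have "{z \<in> ?S \<times> ?S. card (fst z \<union> snd z) = k} =
          {(T, T'). T \<in> ?S \<and> T' \<in> ?S \<and> card (T \<union> T') = k}"
        by auto
      finally show ?thesis .
    qed
    show ?thesis
      by (simp only: sum.distrib *)
  qed
  also have "\<dots> \<le> (4 ^ 5 * real n ^ 5) * \<beta> 1 + (4 ^ 4 * real n ^ 4) * \<beta> 2"
  proof (intro add_mono mult_right_mono \<beta>_nn)
    have *: "real (card {(T, T'). T \<in> ?S \<and> T' \<in> ?S \<and> card (T \<union> T') = k}) \<le> 4 ^ k * real n ^ k" for k
    proof -
      have "real (card {(T, T'). T \<in> ?S \<and> T' \<in> ?S \<and> card (T \<union> T') = k}) \<le> real (4 ^ k * n ^ k)"
        using card_pairs_with_union[of "{1..n}" k] by (subst of_nat_le_iff) simp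
      also have "\<dots> = 4 ^ k * real n ^ k"
        by simp
      finally show ?thesis .
    qed
    show "real (card {(T, T'). T \<in> ?S \<and> T' \<in> ?S \<and> card (T \<union> T') = 5}) \<le> 4 ^ 5 * real n ^ 5"
      "real (card {(T, T'). T \<in> ?S \<and> T' \<in> ?S \<and> card (T \<union> T') = 4}) \<le> 4 ^ 4 * real n ^ 4"
      by (rule *)+
  qed
  finally have "\<bar>G.prob (space (graph n) - (\<Union>T\<in>?S. A T)) - (\<Prod>T\<in>?S. 1 - G.prob (A T))\<bar> \<le>
      4 ^ 5 * real n ^ 5 * \<beta> 1 + 4 ^ 4 * real n ^ 4 * \<beta> 2" .
  moreover have "space (graph n) - (\<Union>T\<in>?S. A T) = {E. \<forall>T\<in>?S. \<not> clique T E}"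
    by (auto simp: A_def)
  moreover have "\<beta> 1 = (b / real n) ^ 6 * (m 2 ^ 4 * m 4) + ((b / real n) ^ 3 * m 2 ^ 3)\<^sup>2"
    "\<beta> 2 = (b / real n) ^ 5 * (m 2 ^ 2 * m 3 ^ 2) + ((b / real n) ^ 3 * m 2 ^ 3)\<^sup>2"
    by (simp_all add: \<beta>_def q_def choose_two)
  ultimately show ?thesis
    by (simp only: A_def)
qed

end

section \<open>Truncation of the weights\<close>

text \<open>
  A weight exceeding \<open>R\<close> is replaced by zero, which isolates its vertex.
\<close>

definition truncate :: "real \<Rightarrow> real \<Rightarrow> real" where
  "truncate R x = (if x \<le> R then x else 0)"

lemma measurable_truncate [measurable]: "truncate R \<in> borel_measurable borel"
  unfolding truncate_def by measurable

context weight_law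
begin

lemma weight_law_truncate: "weight_law (distr D borel (truncate R)) b"
proof -
  interpret T: prob_space "distr D borel (truncate R)"
    by (rule prob_space_distr) simp
  show ?thesis
  proof
    have "AE x in D. 0 \<le> truncate R x"
      using nonneg_D by eventually_elim (simp add: truncate_def)
    then show "AE x in distr D borel (truncate R). 0 \<le> x"
      by (subst AE_distr_iff) auto
  qed (use b_pos in auto)
qed

lemma truncate_moment:
  assumes "0 < k"
  shows "(\<integral>x. x ^ k \<partial>distr D borel (truncate R)) = (\<integral>x. x ^ k * indicator {..R} x \<partial>D)"
proof -
  have "(\<integral>x. x ^ k \<partial>distr D borel (truncate R)) = (\<integral>x. truncate R x ^ k \<partial>D)"
    by (rule integral_distr) simp_all
  also have "\<dots> = (\<integral>x. x ^ k * indicator {..R} x \<partial>D)"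
    using assms by (intro Bochner_Integration.integral_cong) (auto simp: truncate_def)
  finally show ?thesis .
qed

lemma truncate_integrable:
  assumes "0 \<le> R"
  shows "integrable (distr D borel (truncate R)) (\<lambda>x. x ^ k)"
proof (subst integrable_distr_eq)
  show "integrable D (\<lambda>x. truncate R x ^ k)"
  proof (rule integrable_const_bound[where B = "max 1 R ^ k"])
    show "AE x in D. norm (truncate R x ^ k) \<le> max 1 R ^ k"
      using nonneg_D by eventually_elim (auto simp: truncate_def intro!: power_mono)
  qed simp
qed simp_all

text \<open>
  Both graphs are obtained from the same weights, and they have the same conditional law unless some
  vertex is heavy at level \<open>R\<close>.
\<close>

lemma truncate_graph:
  "\<bar>measure (weighted_random_graph (distr D borel (truncate R)) b n) A - measure (graph n) A\<bar> \<le>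
     real n * prob {R<..}"
proof -
  let ?D' = "distr D borel (truncate R)"
  interpret T: weight_law ?D' b
    by (rule weight_law_truncate)
  define K where "K w = measure_pmf.prob (edges_given_weights b n w) A" for w
  let ?c = "compose {1..n} (truncate R)"
  define B where "B = {w \<in> space (weights {1..n}). 0 < card (heavy n R w)}"
  have B [measurable]: "B \<in> sets (weights {1..n})"
    unfolding B_def by measurable
  have "distr (weights {1..n}) (\<Pi>\<^sub>M i\<in>{1..n}. borel) ?c = T.weights {1..n}"
  proof -
    have "distr (PiM {1..n} (\<lambda>_. D)) (PiM {1..n} (\<lambda>_. ?D')) ?c = PiM {1..n} (\<lambda>i. distr D ?D' (truncate R))"
      by (rule distr_PiM_finite_prob_space') (auto intro: prob_space_axioms T.prob_space_axioms)
    moreover have "distr D ?D' (truncate R) = ?D'"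
      by (rule distr_cong) auto
    moreover have "distr (PiM {1..n} (\<lambda>_. D)) (PiM {1..n} (\<lambda>_. ?D')) ?c =
        distr (PiM {1..n} (\<lambda>_. D)) (PiM {1..n} (\<lambda>_. borel)) ?c"
      by (rule distr_cong) (rule refl, rule sets_PiM_cong, simp_all)
    ultimately show ?thesis
      by simp
  qed
  then have W': "T.weights {1..n} = distr (weights {1..n}) (\<Pi>\<^sub>M i\<in>{1..n}. borel) ?c"
    by simp
  have c_meas: "?c \<in> measurable (weights {1..n}) (\<Pi>\<^sub>M i\<in>{1..n}. borel)"
    unfolding compose_def
    by (intro measurable_restrict measurable_compose[OF measurable_weights_component]) simp_all
  have K_meas: "K \<in> borel_measurable (\<Pi>\<^sub>M i\<in>{1..n}. borel)"
    using T.measurable_given_weights[of n A] unfolding K_def W' by simp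
  \<comment> \<open>The truncated model expressed through the original weights, which couples the two models.\<close>
  have eq: "measure (T.graph n) A = (\<integral>w. K (?c w) \<partial>weights {1..n})"
    unfolding T.measure_graph K_def[symmetric] W' by (rule integral_distr[OF c_meas K_meas])
  have int1: "integrable (weights {1..n}) K"
    unfolding K_def by (rule integrable_given_weights)
  have int2: "integrable (weights {1..n}) (\<lambda>w. K (?c w))"
    by (rule W.integrable_const_bound[where B = 1])
       (auto simp: K_def intro: measurable_compose[OF c_meas K_meas, unfolded K_def])
  have int3: "integrable (weights {1..n}) (indicator B :: _ \<Rightarrow> real)"
    using B by (simp add: W.emeasure_eq_measure)
  have "\<bar>measure (T.graph n) A - measure (graph n) A\<bar> = \<bar>\<integral>w. K (?c w) - K w \<partial>weights {1..n}\<bar>"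
    unfolding eq measure_graph K_def[symmetric]
    by (subst Bochner_Integration.integral_diff[OF int2 int1]) simp
  also have "\<dots> \<le> (\<integral>w. \<bar>K (?c w) - K w\<bar> \<partial>weights {1..n})"
    by (rule integral_abs_bound)
  also have "\<dots> \<le> (\<integral>w. indicator B w \<partial>weights {1..n})"
  proof (rule integral_mono)
    fix w assume w: "w \<in> space (weights {1..n})"
    show "\<bar>K (?c w) - K w\<bar> \<le> indicator B w"
    proof (cases "w \<in> B")
      case True
      have "0 \<le> K w" "0 \<le> K (?c w)" "K w \<le> 1" "K (?c w) \<le> 1"
        by (auto simp: K_def)
      then show ?thesis
        using True by simp
    next
      case False
      then have "heavy n R w = {}"
        using w by (auto simp: B_def)
      then have "?c w i = w i" if "i \<in> {1..n}" for i
        using that by (auto simp: compose_def truncate_def heavy_def)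
      then have "(\<Prod>i\<in>e. ?c w i) = (\<Prod>i\<in>e. w i)" if "e \<in> [{1..n}]\<^bsup>2\<^esup>" for e
        using that by (intro prod.cong refl) (auto simp: nsets_def)
      then have "K (?c w) = K w"
        unfolding K_def edges_given_weights_altdef
        by (subst bernoulli_subset_cong[where q = "edge_prob b n w"]) (simp_all add: edge_prob_def)
      then show ?thesis
        by simp
    qed
  qed (use int1 int2 int3 in auto)
  also have "\<dots> = measure (weights {1..n}) B"
    using B by simp
  also have "\<dots> \<le> real n * prob {R<..}"
    using heavy_markov[of n 0 R] by (simp add: B_def)
  finally show ?thesis .
qed

end

section \<open>Weights with a finite second moment\<close>

lemma tendsto_one_minus_power:
  fixes x :: "nat \<Rightarrow> real" and N :: "nat \<Rightarrow> nat"
  assumes "(\<lambda>n. real (N n) * x n) \<longlonglongrightarrow> l" "x \<longlonglongrightarrow> 0"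
  shows "(\<lambda>n. (1 - x n) ^ N n) \<longlonglongrightarrow> exp (- l)"
proof -
  have small: "eventually (\<lambda>n. \<bar>x n\<bar> \<le> 1 / 2) sequentially"
    using tendstoD[OF assms(2), of "1/2"] by (auto elim!: eventually_mono)
  have "(\<lambda>n. real (N n) * (ln (1 - x n) + x n)) \<longlonglongrightarrow> 0"
  proof (rule Lim_null_comparison)
    have "(\<lambda>n. 2 * \<bar>real (N n) * x n\<bar> * \<bar>x n\<bar>) \<longlonglongrightarrow> 2 * \<bar>l\<bar> * \<bar>0\<bar>"
      by (intro tendsto_intros assms)
    then show "(\<lambda>n. 2 * \<bar>real (N n) * x n\<bar> * \<bar>x n\<bar>) \<longlonglongrightarrow> 0"
      by simp
    show "eventually (\<lambda>n. norm (real (N n) * (ln (1 - x n) + x n)) \<le> 2 * \<bar>real (N n) * x n\<bar> * \<bar>x n\<bar>) sequentially"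
      using small
    proof eventually_elim
      case (elim n)
      then have "\<bar>ln (1 + (- x n)) - (- x n)\<bar> \<le> 2 * (- x n)\<^sup>2"
        by (intro abs_ln_one_plus_x_minus_x_bound) simp
      then have "real (N n) * \<bar>ln (1 - x n) + x n\<bar> \<le> real (N n) * (2 * (x n)\<^sup>2)"
        by (intro mult_left_mono) auto
      then show ?case
        by (simp add: abs_mult power2_eq_square mult_ac)
    qed
  qed
  then have "(\<lambda>n. real (N n) * (ln (1 - x n) + x n) - real (N n) * x n) \<longlonglongrightarrow> 0 - l"
    by (intro tendsto_diff assms)
  then have "(\<lambda>n. exp (real (N n) * ln (1 - x n))) \<longlonglongrightarrow> exp (- l)"
    by (intro tendsto_exp) (simp add: algebra_simps)
  moreover have "eventually (\<lambda>n. exp (real (N n) * ln (1 - x n)) = (1 - x n) ^ N n) sequentially"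
    using small by eventually_elim (auto simp: exp_of_nat_mult)
  ultimately show ?thesis
    by (rule Lim_transform_eventually)
qed

lemma choose_three_asymptotics: "(\<lambda>n. real (n choose 3) / real n ^ 3) \<longlonglongrightarrow> 1 / 6"
proof -
  have "eventually (\<lambda>n. real n * (real n - 1) * (real n - 2) / 6 / real n ^ 3 = real (n choose 3) / real n ^ 3) sequentially"
    using eventually_ge_at_top[of 3]
  proof eventually_elim
    case (elim n)
    have "real (n choose 3) = (\<Prod>i = 0..<3. real (n - i) / real (3 - i))"
      using binomial_altdef_of_nat[of 3 n, where 'a = real] elim by simp
    also have "\<dots> = real n * (real n - 1) * (real n - 2) / 6"
    proof -
      have "{0..<3} = {0, 1, 2 :: nat}"
        by auto
      then show ?thesis
        using elim by (simp add: of_nat_diff One_nat_def)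
    qed
    finally show ?case
      by (simp only:)
  qed
  moreover have "(\<lambda>n. real n * (real n - 1) * (real n - 2) / 6 / real n ^ 3) \<longlonglongrightarrow> 1 / 6"
    by real_asymp
  ultimately show ?thesis
    by (rule Lim_transform_eventually[rotated])
qed

lemma real_choose_two: "real (h choose 2) = real h * (real h - 1) / 2"
proof (cases h)
  case (Suc k)
  have "even (h * (h - 1))"
    by (cases "even h") auto
  then have "real (h choose 2) = real (h * (h - 1)) / 2"
    by (simp add: choose_two real_of_nat_div)
  then show ?thesis
    using Suc by (simp add: algebra_simps)
qed simp

context weight_law
begin

text \<open>
  The next three lemmas are instances of dominated convergence, with the square of the weight as the
  dominating function.
\<close>

lemma truncated_moment_tendsto:
  assumes int2: "integrable D (\<lambda>x. x\<^sup>2)" and K: "filterlim K at_top sequentially"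
  shows "(\<lambda>n. \<integral>x. x\<^sup>2 * indicator {..K n} x \<partial>D) \<longlonglongrightarrow> (\<integral>x. x\<^sup>2 \<partial>D)"
proof (rule integral_dominated_convergence[OF _ _ int2])
  show "AE x in D. (\<lambda>n. x\<^sup>2 * indicator {..K n} x) \<longlonglongrightarrow> x\<^sup>2"
  proof (rule AE_I2)
    fix x :: real
    have "eventually (\<lambda>n. x \<le> K n) sequentially"
      using K by (auto simp: filterlim_at_top)
    then have "eventually (\<lambda>n. x\<^sup>2 * indicator {..K n} x = x\<^sup>2) sequentially"
      by eventually_elim simp
    then show "(\<lambda>n. x\<^sup>2 * indicator {..K n} x) \<longlonglongrightarrow> x\<^sup>2"
      by (rule tendsto_eventually)
  qed
qed (auto simp: indicator_def)

lemma higher_truncated_moment_tendsto: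
  assumes int2: "integrable D (\<lambda>x. x\<^sup>2)" and j: "0 < j"
  shows "(\<lambda>n. (\<integral>x. x ^ (2 + j) * indicator {..sqrt (real n)} x \<partial>D) / sqrt (real n) ^ j) \<longlonglongrightarrow> 0"
proof -
  have "(\<lambda>n. \<integral>x. x ^ (2 + j) * indicator {..sqrt (real n)} x / sqrt (real n) ^ j \<partial>D) \<longlonglongrightarrow> (\<integral>x. 0 \<partial>D)"
  proof (rule integral_dominated_convergence[OF _ _ int2])
    show "AE x in D. (\<lambda>n. x ^ (2 + j) * indicator {..sqrt (real n)} x / sqrt (real n) ^ j) \<longlonglongrightarrow> 0"
    proof (rule AE_I2)
      fix x :: real
      have "filterlim (\<lambda>n. sqrt (real n) ^ j) at_top sequentially"
        using j by (intro filterlim_pow_at_top filterlim_compose[OF sqrt_at_top] filterlim_real_sequentially)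
      then have lim: "(\<lambda>n. \<bar>x ^ (2 + j)\<bar> / sqrt (real n) ^ j) \<longlonglongrightarrow> 0"
        by (intro real_tendsto_divide_at_top[OF tendsto_const])
      show "(\<lambda>n. x ^ (2 + j) * indicator {..sqrt (real n)} x / sqrt (real n) ^ j) \<longlonglongrightarrow> 0"
        by (rule Lim_null_comparison[OF _ lim])
           (auto simp: indicator_def power_abs intro!: always_eventually)
    qed
  next
    fix n :: nat
    show "AE x in D. norm (x ^ (2 + j) * indicator {..sqrt (real n)} x / sqrt (real n) ^ j) \<le> x\<^sup>2"
      using nonneg_D
    proof eventually_elim
      case (elim x)
      show ?case
      proof (cases "x \<le> sqrt (real n) \<and> 0 < n")
        case True
        then have "x ^ j / sqrt (real n) ^ j \<le> 1"
          using elim by (simp add: divide_le_eq_1 power_mono)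
        then have "x\<^sup>2 * (x ^ j / sqrt (real n) ^ j) \<le> x\<^sup>2 * 1"
          by (intro mult_left_mono) auto
        then show ?thesis
          using True elim by (simp add: power_add power2_eq_square mult.assoc)
      next
        case False
        then show ?thesis
          using j elim by (cases "n = 0") (auto simp: power_0_left)
      qed
    qed
  qed auto
  then show ?thesis
    by simp
qed

lemma tail_at_sqrt_tendsto:
  assumes int2: "integrable D (\<lambda>x. x\<^sup>2)"
  shows "(\<lambda>n. real n * prob {sqrt (real n)<..}) \<longlonglongrightarrow> 0"
proof -
  have "(\<lambda>n. \<integral>x. real n * indicator {sqrt (real n)<..} x \<partial>D) \<longlonglongrightarrow> (\<integral>x. 0 \<partial>D)"
  proof (rule integral_dominated_convergence[OF _ _ int2])
    show "AE x in D. (\<lambda>n. real n * indicator {sqrt (real n)<..} x) \<longlonglongrightarrow> 0"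
    proof (rule AE_I2)
      fix x :: real
      have "filterlim (\<lambda>n. sqrt (real n)) at_top sequentially"
        by (intro filterlim_compose[OF sqrt_at_top] filterlim_real_sequentially)
      then have "eventually (\<lambda>n. x \<le> sqrt (real n)) sequentially"
        by (auto simp: filterlim_at_top)
      then have "eventually (\<lambda>n. real n * indicator {sqrt (real n)<..} x = 0) sequentially"
        by eventually_elim simp
      then show "(\<lambda>n. real n * indicator {sqrt (real n)<..} x) \<longlonglongrightarrow> 0"
        by (rule tendsto_eventually)
    qed
  next
    fix n :: nat
    show "AE x in D. norm (real n * indicator {sqrt (real n)<..} x) \<le> x\<^sup>2"
      using nonneg_D by eventually_elim (auto simp: indicator_def real_less_rsqrt intro: sqrt_le_D)
  qed auto
  then show ?thesis
    by simp
qed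

lemma no_four_clique:
  assumes "integrable D (\<lambda>x. x\<^sup>2)"
  shows "(\<lambda>n. measure (graph n) {E. 4 \<le> clique_number {1..n} E}) \<longlonglongrightarrow> 0"
proof (rule tendsto_sandwich[OF _ _ tendsto_const])
  let ?u = "\<lambda>n. real n * prob {sqrt (real n)<..} +
    b ^ 6 * ((\<integral>x. x ^ (2 + 1) * indicator {..sqrt (real n)} x \<partial>D) / sqrt (real n) ^ 1) ^ 4"
  have "?u \<longlonglongrightarrow> 0 + b ^ 6 * 0 ^ 4"
    by (intro tendsto_intros tail_at_sqrt_tendsto higher_truncated_moment_tendsto assms) auto
  then show "?u \<longlonglongrightarrow> 0"
    by simp
  show "eventually (\<lambda>n. measure (graph n) {E. 4 \<le> clique_number {1..n} E} \<le> ?u n) sequentially"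
    using eventually_ge_at_top[of 1]
  proof eventually_elim
    case (elim n)
    then show ?case
      using measure_clique_number_ge_4_le[of "sqrt (real n)" n 0] by simp
  qed
qed auto

text \<open>
  The weights are truncated at \<open>sqrt n\<close>. Then the truncated third moment is of smaller order than
  \<open>sqrt n\<close> and the fourth of smaller order than \<open>n\<close>, so the error in \<open>triangle_free_approx\<close> vanishes. For
  the product of the \<open>1 - P(clique T)\<close>, the probabilities are bounded below by a further truncation
  at \<open>n powr (1/4)\<close>, for which \<open>K\<^sup>2 / n\<close> tends to zero.
\<close>

lemma triangle_free_tendsto:
  assumes int2: "integrable D (\<lambda>x. x\<^sup>2)"
  shows "(\<lambda>n. measure (graph n) {E. \<forall>T\<in>[{1..n}]\<^bsup>3\<^esup>. \<not> clique T E}) \<longlonglongrightarrow>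
    exp (- ((b * (\<integral>x. x\<^sup>2 \<partial>D)) ^ 3 / 6))"
proof -
  define D' where "D' n = distr D borel (truncate (sqrt (real n)))" for n
  define G' where "G' n = weighted_random_graph (D' n) b n" for n
  define \<mu> where "\<mu> k n = (\<integral>x. x ^ k * indicator {..sqrt (real n)} x \<partial>D)" for k and n :: nat
  define A where "A n = {E. \<forall>T\<in>[{1..n}]\<^bsup>3\<^esup>. \<not> clique T E}" for n :: nat
  define Q where "Q n = (\<Prod>T\<in>[{1..n}]\<^bsup>3\<^esup>. 1 - measure (G' n) {E. clique T E})" for n
  define m2 where "m2 = (\<integral>x. x\<^sup>2 \<partial>D)"
  define K where "K n = real n powr (1/4)" for n
  define \<kappa> where "\<kappa> n = (\<integral>x. x\<^sup>2 * indicator {..K n} x \<partial>D)" for n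
  \<comment> \<open>Upper and lower bounds for the probability of a given triangle after truncation.\<close>
  define hi where "hi n = (b / real n) ^ 3 * \<mu> 2 n ^ 3" for n
  define lo where "lo n = ((b / real n) * exp (- (b * (K n)\<^sup>2 / real n))) ^ 3 * \<kappa> n ^ 3" for n
  have law: "weight_law (D' n) b" for n
    unfolding D'_def by (rule weight_law_truncate)
  have int: "integrable (D' n) (\<lambda>x. x ^ k)" for n and k :: nat
    unfolding D'_def by (rule truncate_integrable) simp
  have mom: "(\<integral>x. x ^ k \<partial>D' n) = \<mu> k n" if "0 < k" for k n
    unfolding D'_def \<mu>_def by (rule truncate_moment[OF that])
  have \<mu>2: "\<mu> 2 \<longlonglongrightarrow> m2"
    unfolding \<mu>_def m2_def
    by (intro truncated_moment_tendsto int2 filterlim_compose[OF sqrt_at_top] filterlim_real_sequentially)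
  have \<mu>3: "(\<lambda>n. \<mu> 3 n / sqrt (real n)) \<longlonglongrightarrow> 0"
    using higher_truncated_moment_tendsto[OF int2, of 1] by (simp add: \<mu>_def)
  have \<mu>4: "(\<lambda>n. \<mu> 4 n / real n) \<longlonglongrightarrow> 0"
    using higher_truncated_moment_tendsto[OF int2, of 2] by (simp add: \<mu>_def)
  have inv: "(\<lambda>n. 1 / real n) \<longlonglongrightarrow> 0"
    by real_asymp
  have \<kappa>: "\<kappa> \<longlonglongrightarrow> m2"
    unfolding \<kappa>_def m2_def by (intro truncated_moment_tendsto int2) (unfold K_def, real_asymp)
  have approx: "\<bar>measure (G' n) (A n) - Q n\<bar> \<le>
      4 ^ 5 * real n ^ 5 * ((b / real n) ^ 6 * (\<mu> 2 n ^ 4 * \<mu> 4 n) + ((b / real n) ^ 3 * \<mu> 2 n ^ 3)\<^sup>2) +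
      4 ^ 4 * real n ^ 4 * ((b / real n) ^ 5 * (\<mu> 2 n ^ 2 * \<mu> 3 n ^ 2) + ((b / real n) ^ 3 * \<mu> 2 n ^ 3)\<^sup>2)"
    (is "_ \<le> ?e n") for n
    using weight_law.triangle_free_approx[OF law int, of n n] by (simp add: mom A_def Q_def G'_def)
  \<comment> \<open>The same error bound after cancelling powers of \<open>n\<close>.\<close>
  define err where "err n = 4 ^ 5 * (b ^ 6 * \<mu> 2 n ^ 4 * (\<mu> 4 n / real n) + b ^ 6 * \<mu> 2 n ^ 6 * (1 / real n)) +
      4 ^ 4 * (b ^ 5 * \<mu> 2 n ^ 2 * (\<mu> 3 n / sqrt (real n)) ^ 2 + b ^ 6 * \<mu> 2 n ^ 6 * (1 / real n) ^ 2)" for n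
  have "err \<longlonglongrightarrow> 4 ^ 5 * (b ^ 6 * m2 ^ 4 * 0 + b ^ 6 * m2 ^ 6 * 0) +
      4 ^ 4 * (b ^ 5 * m2 ^ 2 * 0 ^ 2 + b ^ 6 * m2 ^ 6 * 0 ^ 2)"
    unfolding err_def by (intro tendsto_intros \<mu>2 \<mu>3 \<mu>4 inv)
  then have err0: "err \<longlonglongrightarrow> 0"
    by simp
  have e_eq: "?e n = err n" if "0 < n" for n
  proof -
    define N where "N = real n"
    have N: "N > 0"
      using that by (simp add: N_def)
    have "N ^ 5 * (b / N) ^ 6 = b ^ 6 * (1 / N)" "N ^ 4 * (b / N) ^ 5 = b ^ 5 * (1 / N)"
      "N ^ 5 * ((b / N) ^ 3)\<^sup>2 = b ^ 6 * (1 / N)" "N ^ 4 * ((b / N) ^ 3)\<^sup>2 = b ^ 6 * (1 / N)\<^sup>2"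
      using N by (simp_all add: power_divide divide_simps flip: power_mult power_add power_Suc2)
    then have "N ^ 5 * ((b / N) ^ 6 * (x ^ 4 * z) + ((b / N) ^ 3 * x ^ 3)\<^sup>2) =
        b ^ 6 * x ^ 4 * (z / N) + b ^ 6 * x ^ 6 * (1 / N)"
      "N ^ 4 * ((b / N) ^ 5 * (x ^ 2 * y ^ 2) + ((b / N) ^ 3 * x ^ 3)\<^sup>2) =
        b ^ 5 * x ^ 2 * (y ^ 2 / N) + b ^ 6 * x ^ 6 * (1 / N)\<^sup>2" for x y z
      by (simp_all add: distrib_left power_mult_distrib mult.assoc[symmetric] flip: power_mult)
    moreover have "(y / sqrt N) ^ 2 = y ^ 2 / N" for y
      using N by (simp add: power_divide)
    ultimately show ?thesis
      unfolding err_def N_def[symmetric] by (simp only: mult.assoc)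
  qed
  have diff1: "(\<lambda>n. measure (G' n) (A n) - Q n) \<longlonglongrightarrow> 0"
  proof (rule Lim_null_comparison[OF _ err0])
    show "eventually (\<lambda>n. norm (measure (G' n) (A n) - Q n) \<le> err n) sequentially"
      using eventually_gt_at_top[of 0]
    proof eventually_elim
      case (elim n)
      show ?case
        using approx[of n] unfolding e_eq[OF elim] by (simp only: real_norm_def)
    qed
  qed
  have diff2: "(\<lambda>n. measure (graph n) (A n) - measure (G' n) (A n)) \<longlonglongrightarrow> 0"
  proof (rule Lim_null_comparison[OF _ tail_at_sqrt_tendsto[OF int2]])
    show "eventually (\<lambda>n. norm (measure (graph n) (A n) - measure (G' n) (A n)) \<le>
        real n * prob {sqrt (real n)<..}) sequentially"
      using truncate_graph unfolding G'_def D'_def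
      by (intro always_eventually allI) (simp add: abs_minus_commute)
  qed
  have p_hi: "measure (G' n) {E. clique T E} \<le> hi n" if "T \<in> [{1..n}]\<^bsup>3\<^esup>" for n T
    using weight_law.measure_triangle_le[OF law that int] by (simp add: mom hi_def G'_def)
  have p_lo: "lo n \<le> measure (G' n) {E. clique T E}" if T: "T \<in> [{1..n}]\<^bsup>3\<^esup>" for n T
  proof -
    have "1 \<le> n"
      using T by (cases n) (auto simp: nsets_def)
    have "K n \<le> real n powr (1/2)"
      unfolding K_def using \<open>1 \<le> n\<close> by (intro powr_mono) auto
    then have le: "K n \<le> sqrt (real n)"
      by (simp add: powr_half_sqrt)
    have "(\<integral>x. x\<^sup>2 * indicator {..K n} x \<partial>D' n) =
        (\<integral>x. (truncate (sqrt (real n)) x)\<^sup>2 * indicator {..K n} (truncate (sqrt (real n)) x) \<partial>D)"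
      unfolding D'_def by (rule integral_distr) auto
    also have "\<dots> = \<kappa> n"
      unfolding \<kappa>_def using le
      by (intro Bochner_Integration.integral_cong) (auto simp: truncate_def indicator_def K_def)
    finally have "(\<integral>x. x\<^sup>2 * indicator {..K n} x \<partial>D' n) = \<kappa> n" .
    then show ?thesis
      using weight_law.measure_triangle_ge[OF law[of n] T, of "K n"] by (simp add: lo_def G'_def K_def)
  qed
  have "(\<lambda>n. (real (n choose 3) / real n ^ 3) * b ^ 3 * \<mu> 2 n ^ 3) \<longlonglongrightarrow> (1 / 6) * b ^ 3 * m2 ^ 3"
    by (intro tendsto_intros choose_three_asymptotics \<mu>2)
  then have lim_hi: "(\<lambda>n. real (n choose 3) * hi n) \<longlonglongrightarrow> (b * m2) ^ 3 / 6"
    by (simp add: hi_def power_divide power_mult_distrib mult_ac)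
  have "(\<lambda>n. exp (- (b * (K n)\<^sup>2 / real n))) \<longlonglongrightarrow> 1"
    unfolding K_def by real_asymp
  then have "(\<lambda>n. (real (n choose 3) / real n ^ 3) * b ^ 3 * exp (- (b * (K n)\<^sup>2 / real n)) ^ 3 * \<kappa> n ^ 3) \<longlonglongrightarrow>
      (1 / 6) * b ^ 3 * 1 ^ 3 * m2 ^ 3"
    by (intro tendsto_intros choose_three_asymptotics \<kappa>)
  then have lim_lo: "(\<lambda>n. real (n choose 3) * lo n) \<longlonglongrightarrow> (b * m2) ^ 3 / 6"
    by (simp add: lo_def power_divide power_mult_distrib mult_ac)
  have inv3: "(\<lambda>n. 1 / real n ^ 3) \<longlonglongrightarrow> 0"
    by real_asymp
  have "(\<lambda>n. (1 / real n ^ 3) * (b ^ 3 * \<mu> 2 n ^ 3)) \<longlonglongrightarrow> 0 * (b ^ 3 * m2 ^ 3)"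
    by (intro tendsto_intros inv3 \<mu>2)
  then have hi0: "hi \<longlonglongrightarrow> 0"
    by (simp add: hi_def[abs_def] power_divide mult_ac)
  have "(\<lambda>n. (1 / real n ^ 3) * (b ^ 3 * exp (- (b * (K n)\<^sup>2 / real n)) ^ 3 * \<kappa> n ^ 3)) \<longlonglongrightarrow> 0 * (b ^ 3 * 1 ^ 3 * m2 ^ 3)"
    using \<open>(\<lambda>n. exp (- (b * (K n)\<^sup>2 / real n))) \<longlonglongrightarrow> 1\<close> by (intro tendsto_intros inv3 \<kappa>)
  then have lo0: "lo \<longlonglongrightarrow> 0"
    by (simp add: lo_def[abs_def] power_divide power_mult_distrib mult_ac)
  have lim_Q: "Q \<longlonglongrightarrow> exp (- ((b * m2) ^ 3 / 6))"
  proof (rule tendsto_sandwich)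
    show "(\<lambda>n. (1 - hi n) ^ (n choose 3)) \<longlonglongrightarrow> exp (- ((b * m2) ^ 3 / 6))"
      by (rule tendsto_one_minus_power[OF lim_hi hi0])
    show "(\<lambda>n. (1 - lo n) ^ (n choose 3)) \<longlonglongrightarrow> exp (- ((b * m2) ^ 3 / 6))"
      by (rule tendsto_one_minus_power[OF lim_lo lo0])
    have "eventually (\<lambda>n. hi n < 1) sequentially"
      using hi0 by (rule order_tendstoD) simp
    then show "eventually (\<lambda>n. (1 - hi n) ^ (n choose 3) \<le> Q n) sequentially"
    proof eventually_elim
      case (elim n)
      have "(\<Prod>T\<in>[{1..n}]\<^bsup>3\<^esup>. 1 - hi n) \<le> Q n"
        unfolding Q_def using elim p_hi by (intro prod_mono) auto
      then show ?case
        by simp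
    qed
    show "eventually (\<lambda>n. Q n \<le> (1 - lo n) ^ (n choose 3)) sequentially"
    proof (intro always_eventually allI)
      fix n
      interpret G': prob_space "G' n"
        unfolding G'_def by (rule weight_law.prob_space_graph[OF law])
      have "Q n \<le> (\<Prod>T\<in>[{1..n}]\<^bsup>3\<^esup>. 1 - lo n)"
        unfolding Q_def using p_lo by (intro prod_mono) auto
      then show "Q n \<le> (1 - lo n) ^ (n choose 3)"
        by simp
    qed
  qed
  have "(\<lambda>n. (measure (graph n) (A n) - measure (G' n) (A n)) + (measure (G' n) (A n) - Q n) + Q n)
      \<longlonglongrightarrow> 0 + 0 + exp (- ((b * m2) ^ 3 / 6))"
    by (intro tendsto_add diff1 diff2 lim_Q)
  then show ?thesis
    by (simp add: A_def m2_def)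
qed

text \<open>
  Among a linear number of vertices of weight at least \<open>t\<close> there are quadratically many pairs, each
  adjacent with probability of order at least \<open>1 / n\<close>.
\<close>

lemma no_edge_tendsto:
  assumes t: "0 < t" "0 < prob {t<..}"
  shows "(\<lambda>n. measure (graph n) {E. clique_number {1..n} E \<le> 1}) \<longlonglongrightarrow> 0"
proof (rule tendsto_sandwich[OF _ _ tendsto_const])
  define p where "p = prob {t<..}"
  have p: "0 < p"
    using t by (simp add: p_def)
  let ?u = "\<lambda>n. 4 / (real n * p) + exp (- (b * t\<^sup>2 / real n) * (real n * p / 2 * (real n * p / 2 - 1) / 2))"
  show "?u \<longlonglongrightarrow> 0"
    using p t b_pos by real_asymp
  have "eventually (\<lambda>n. 1 \<le> real n * p / 2) sequentially"
    using p by real_asymp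
  then show "eventually (\<lambda>n. measure (graph n) {E. clique_number {1..n} E \<le> 1} \<le> ?u n) sequentially"
    using eventually_gt_at_top[of 0]
  proof eventually_elim
    case (elim n)
    \<comment> \<open>Half of the mean number of vertices of weight above \<open>t\<close>.\<close>
    define y where "y = real n * p / 2"
    define B where "B = {w \<in> space (weights {1..n}). y \<le> \<bar>real (card (heavy n t w)) - real n * p\<bar>}"
    have "measure (graph n) {E. clique_number {1..n} E \<le> 1} \<le> measure (weights {1..n}) B +
        exp (- (b * t\<^sup>2 / real n) * (y * (y - 1) / 2))"
    proof (rule measure_graph_le_bad)
      show "B \<in> sets (weights {1..n})"
        unfolding B_def by measurable
      fix w :: "nat \<Rightarrow> real"
      assume w: "\<And>i. i \<in> {1..n} \<Longrightarrow> 0 \<le> w i" "w \<in> space (weights {1..n})" "w \<notin> B"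
      let ?K = "edges_given_weights b n w" and ?H = "heavy n t w"
      have y_le: "y \<le> real (card ?H)"
      proof -
        have "\<bar>real (card ?H) - real n * p\<bar> < y"
          using w(2,3) by (simp add: B_def)
        then show ?thesis
          unfolding y_def by linarith
      qed
      have "{E. clique_number {1..n} E \<le> 1} \<subseteq> {E. [?H]\<^bsup>2\<^esup> \<inter> E = {}}"
      proof clarify
        fix E assume E: "clique_number {1..n} E \<le> 1"
        have "e \<notin> E" if e: "e \<in> [?H]\<^bsup>2\<^esup>" for e
        proof
          assume "e \<in> E"
          have e': "e \<subseteq> {1..n}" "card e = 2" "finite e"
            using e heavy_subset[of n t w] by (auto simp: nsets_def)
          have "x = e" if "x \<in> [e]\<^bsup>2\<^esup>" for x
            using that e' by (intro card_subset_eq) (auto simp: nsets_def)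
          moreover have "e \<in> [e]\<^bsup>2\<^esup>"
            using e' by (simp add: nsets_def)
          ultimately have "[e]\<^bsup>2\<^esup> = {e}"
            by blast
          then have "clique e E"
            using \<open>e \<in> E\<close> by (simp add: clique_iff_nsets)
          then have "2 \<le> clique_number {1..n} E"
            using e' clique_number_ge_iff[of "{1..n}" 2 E] by auto
          then show False
            using E by simp
        qed
        then show "[?H]\<^bsup>2\<^esup> \<inter> E = {}"
          by auto
      qed
      then have "measure_pmf.prob ?K {E. clique_number {1..n} E \<le> 1} \<le>
          measure_pmf.prob ?K {E. [?H]\<^bsup>2\<^esup> \<inter> E = {}}"
        by (intro measure_pmf.finite_measure_mono) auto
      also have "\<dots> = (\<Prod>e\<in>[?H]\<^bsup>2\<^esup>. exp (- (b * (\<Prod>i\<in>e. w i) / real n)))"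
        using b_pos w(1) nsets_mono[OF heavy_subset] by (intro prob_given_weights_disjoint) auto
      also have "\<dots> \<le> (\<Prod>e\<in>[?H]\<^bsup>2\<^esup>. exp (- (b * t\<^sup>2 / real n)))"
      proof (rule prod_mono)
        fix e assume e: "e \<in> [?H]\<^bsup>2\<^esup>"
        have "(\<Prod>i\<in>e. t) \<le> (\<Prod>i\<in>e. w i)"
          using e t by (intro prod_mono) (auto simp: nsets_def heavy_def subset_iff less_imp_le)
        then have "t\<^sup>2 \<le> (\<Prod>i\<in>e. w i)"
          using e by (simp add: nsets_def)
        then have "b * t\<^sup>2 / real n \<le> b * (\<Prod>i\<in>e. w i) / real n"
          using b_pos by (intro divide_right_mono mult_left_mono) auto
        then show "0 \<le> exp (- (b * (\<Prod>i\<in>e. w i) / real n)) \<and>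
            exp (- (b * (\<Prod>i\<in>e. w i) / real n)) \<le> exp (- (b * t\<^sup>2 / real n))"
          by simp
      qed
      also have "\<dots> = exp (- (b * t\<^sup>2 / real n) * real (card ?H choose 2))"
        by (simp flip: exp_of_nat_mult)
      also have "\<dots> \<le> exp (- (b * t\<^sup>2 / real n) * (y * (y - 1) / 2))"
      proof -
        have "y * (y - 1) \<le> real (card ?H) * (real (card ?H) - 1)"
          using y_le elim by (intro mult_mono) (auto simp: y_def)
        then have "y * (y - 1) / 2 \<le> real (card ?H choose 2)"
          by (simp add: real_choose_two)
        then have "- (b * t\<^sup>2 / real n) * real (card ?H choose 2) \<le> - (b * t\<^sup>2 / real n) * (y * (y - 1) / 2)"
          using b_pos by (intro mult_left_mono_neg) auto
        then show ?thesis
          by (simp only: exp_le_cancel_iff)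
      qed
      finally show "measure_pmf.prob ?K {E. clique_number {1..n} E \<le> 1} \<le>
          exp (- (b * t\<^sup>2 / real n) * (y * (y - 1) / 2))" .
    qed simp
    also have "measure (weights {1..n}) B \<le> real n * p / y\<^sup>2"
      unfolding B_def p_def by (rule heavy_chebyshev) (use elim y_def p in simp)
    also have "real n * p / y\<^sup>2 = 4 / (real n * p)"
      using elim p by (simp add: y_def power2_eq_square field_simps)
    finally show ?case
      by (simp add: y_def)
  qed
qed auto

end

section \<open>Weights with a power-law tail\<close>

text \<open>
  A weight distribution whose tail is exactly \<open>a * x powr (- \<alpha>)\<close> from \<open>x\<^sub>0\<close> on.
\<close>

locale pareto_law = weight_law D b for D b +
  fixes a \<alpha> x\<^sub>0 :: real
  assumes a_pos: "0 < a" and \<alpha>_pos: "0 < \<alpha>" and x0_pos: "0 < x\<^sub>0"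
    and tail: "\<And>x. x\<^sub>0 \<le> x \<Longrightarrow> prob {x<..} = a * x powr (- \<alpha>)"
begin

lemma prob_x0_pos: "0 < prob {x\<^sub>0<..}"
  using tail[of x\<^sub>0] a_pos x0_pos by simp

lemma second_moment_pos:
  assumes "integrable D (\<lambda>x. x\<^sup>2)"
  shows "0 < (\<integral>x. x\<^sup>2 \<partial>D)"
proof -
  have "0 < x\<^sub>0\<^sup>2 * prob {x\<^sub>0<..}"
    using prob_x0_pos x0_pos by simp
  also have "\<dots> = (\<integral>x. x\<^sub>0\<^sup>2 * indicator {x\<^sub>0<..} x \<partial>D)"
    by simp
  also have "\<dots> \<le> (\<integral>x. x\<^sup>2 \<partial>D)"
  proof (rule integral_mono)
    show "integrable D (\<lambda>x. x\<^sub>0\<^sup>2 * indicator {x\<^sub>0<..} x)"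
      by (intro integrable_mult_right integrable_indicator_D)
  qed (use assms x0_pos in \<open>auto simp: indicator_def intro!: power_mono\<close>)
  finally show ?thesis .
qed

lemma integrable_square:
  assumes "2 < \<alpha>"
  shows "integrable D (\<lambda>x. x\<^sup>2)"
proof (rule integrableI_bounded)
  have sum: "summable (\<lambda>k. (2 * real k + 1) * prob {real k<..})"
  proof (rule summable_comparison_test_ev)
    show "summable (\<lambda>k. 3 * a * real k powr (1 - \<alpha>))"
      using assms by (intro summable_mult) (simp add: summable_real_powr_iff)
    show "eventually (\<lambda>k. norm ((2 * real k + 1) * prob {real k<..}) \<le> 3 * a * real k powr (1 - \<alpha>)) sequentially"
      using eventually_ge_at_top[of "nat \<lceil>x\<^sub>0\<rceil>"] eventually_ge_at_top[of 1]
    proof eventually_elim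
      case (elim k)
      have "x\<^sub>0 \<le> real k"
        using elim by linarith
      then have "(2 * real k + 1) * prob {real k<..} = (2 * real k + 1) * (a * real k powr (- \<alpha>))"
        by (simp add: tail)
      also have "\<dots> \<le> (3 * real k) * (a * real k powr (- \<alpha>))"
        using elim a_pos by (intro mult_right_mono) auto
      also have "\<dots> = 3 * a * real k powr (1 - \<alpha>)"
        using elim powr_add[of "real k" 1 "- \<alpha>"] by simp
      finally show ?case
        by simp
    qed
  qed
  have le: "ennreal (norm (x\<^sup>2)) \<le> (\<Sum>k. ennreal (2 * real k + 1) * indicator {real k<..} x)" if "0 \<le> x" for x :: real
  proof -
    define m where "m = nat \<lceil>x\<rceil>"
    have m: "x \<le> real m" "\<And>k. k < m \<Longrightarrow> real k < x"
      unfolding m_def using that by linarith+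
    have "x\<^sup>2 \<le> (real m)\<^sup>2"
      using m that by (intro power_mono) auto
    also have "(real m)\<^sup>2 = (\<Sum>k<m. 2 * real k + 1)"
      by (induction m) (auto simp: power2_eq_square algebra_simps)
    finally have "ennreal (norm (x\<^sup>2)) \<le> ennreal (\<Sum>k<m. 2 * real k + 1)"
      by (intro ennreal_leI) simp
    also have "\<dots> = (\<Sum>k<m. ennreal (2 * real k + 1))"
      by (intro sum_ennreal[symmetric]) simp
    also have "\<dots> = (\<Sum>k<m. ennreal (2 * real k + 1) * indicator {real k<..} x)"
      using m by (intro sum.cong refl) (simp add: indicator_def)
    also have "\<dots> \<le> (\<Sum>k. ennreal (2 * real k + 1) * indicator {real k<..} x)"
      by (intro sum_le_suminf) auto
    finally show ?thesis .
  qed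
  have "(\<integral>\<^sup>+ x. ennreal (norm (x\<^sup>2)) \<partial>D) \<le>
      (\<integral>\<^sup>+ x. (\<Sum>k. ennreal (2 * real k + 1) * indicator {real k<..} x) \<partial>D)"
  proof (rule nn_integral_mono_AE)
    show "AE x in D. ennreal (norm (x\<^sup>2)) \<le> (\<Sum>k. ennreal (2 * real k + 1) * indicator {real k<..} x)"
      using nonneg_D by eventually_elim (rule le)
  qed
  also have "\<dots> = (\<Sum>k. \<integral>\<^sup>+ x. ennreal (2 * real k + 1) * indicator {real k<..} x \<partial>D)"
    by (intro nn_integral_suminf) simp
  also have "\<dots> = (\<Sum>k. ennreal ((2 * real k + 1) * prob {real k<..}))"
    by (intro suminf_cong) (simp add: nn_integral_cmult_indicator emeasure_eq_measure ennreal_mult)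
  also have "\<dots> < \<infinity>"
  proof -
    have "(\<Sum>k. ennreal ((2 * real k + 1) * prob {real k<..})) \<noteq> \<top>"
      by (rule ennreal_suminf_neq_top[OF sum]) simp
    then show ?thesis
      by (simp only: infinity_ennreal_def less_top)
  qed
  finally show "(\<integral>\<^sup>+ x. ennreal (norm (x\<^sup>2)) \<partial>D) < \<infinity>" .
qed simp

text \<open>
  For \<open>\<alpha> = 2\<close> the tail at \<open>k\<close> is at most a constant times \<open>1 / (k + 1)\<^sup>2\<close>, while \<open>x ^ 3\<close> is at most the
  sum of \<open>3 * (k + 1)\<^sup>2\<close> over the integers \<open>k < x\<close>. Hence the truncated third moment grows at most
  linearly.
\<close>

lemma truncated_third_moment_le:
  assumes "\<alpha> = 2" "0 \<le> t"
  shows "(\<integral>x. x ^ 3 * indicator {..t} x \<partial>D) \<le> 3 * (4 * a + (x\<^sub>0 + 2)\<^sup>2) * (t + 1)"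
proof -
  define C where "C = 4 * a + (x\<^sub>0 + 2)\<^sup>2"
  define M where "M = nat \<lceil>t\<rceil>"
  have C: "(real k + 1)\<^sup>2 * prob {real k<..} \<le> C" for k
  proof (cases "x\<^sub>0 \<le> real k")
    case True
    have k: "1 \<le> real k"
      using True x0_pos by (cases k) auto
    have "prob {real k<..} = a / (real k)\<^sup>2"
      using tail[OF True] assms k by (simp add: powr_minus powr_numeral divide_inverse)
    then have "(real k + 1)\<^sup>2 * prob {real k<..} = a * ((real k + 1) / real k)\<^sup>2"
      by (simp add: power_divide)
    also have "\<dots> \<le> a * 2\<^sup>2"
      using k a_pos by (intro mult_left_mono power_mono) (auto simp: divide_simps)
    also have "\<dots> \<le> C"
      by (simp add: C_def)
    finally show ?thesis .
  next
    case False
    have "(real k + 1)\<^sup>2 * prob {real k<..} \<le> (x\<^sub>0 + 2)\<^sup>2 * 1"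
      using False x0_pos by (intro mult_mono power_mono) auto
    also have "\<dots> \<le> C"
      using a_pos by (simp add: C_def)
    finally show ?thesis .
  qed
  have int: "integrable D (\<lambda>x. \<Sum>k<M. 3 * (real k + 1)\<^sup>2 * indicator {real k<..} x)"
    by (intro Bochner_Integration.integrable_sum integrable_mult_right integrable_indicator_D)
  have "(\<integral>x. x ^ 3 * indicator {..t} x \<partial>D) \<le> (\<integral>x. (\<Sum>k<M. 3 * (real k + 1)\<^sup>2 * indicator {real k<..} x) \<partial>D)"
  proof (rule integral_mono_AE[OF _ int])
    show "AE x in D. x ^ 3 * indicator {..t} x \<le> (\<Sum>k<M. 3 * (real k + 1)\<^sup>2 * indicator {real k<..} x)"
      using nonneg_D
    proof eventually_elim
      case (elim x)
      show ?case
      proof (cases "x \<le> t")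
        case True
        define m where "m = nat \<lceil>x\<rceil>"
        have m: "x \<le> real m" "\<And>k. k < m \<Longrightarrow> real k < x" "m \<le> M"
          unfolding m_def M_def using elim True by (linarith | intro nat_mono ceiling_mono)+
        have "x ^ 3 \<le> real m ^ 3"
          using m elim by (intro power_mono) auto
        also have "real m ^ 3 \<le> (\<Sum>k<m. 3 * (real k + 1)\<^sup>2)"
          by (induction m) (auto simp: power2_eq_square power3_eq_cube algebra_simps)
        also have "\<dots> = (\<Sum>k<m. 3 * (real k + 1)\<^sup>2 * indicator {real k<..} x)"
          using m by (intro sum.cong refl) (simp add: indicator_def)
        also have "\<dots> \<le> (\<Sum>k<M. 3 * (real k + 1)\<^sup>2 * indicator {real k<..} x)"
          using m by (intro sum_mono2) auto
        finally show ?thesis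
          using True by simp
      next
        case False
        then show ?thesis
          by (simp add: sum_nonneg)
      qed
    qed
    show "integrable D (\<lambda>x. x ^ 3 * indicator {..t} x)"
    proof (rule integrable_const_bound[where B = "t ^ 3"])
      show "AE x in D. norm (x ^ 3 * indicator {..t} x) \<le> t ^ 3"
        using nonneg_D by eventually_elim (use assms(2) in \<open>auto simp: indicator_def power_mono\<close>)
      show "(\<lambda>x. x ^ 3 * indicator {..t} x) \<in> borel_measurable D"
        unfolding measurable_D by measurable
    qed
  qed
  also have "\<dots> = (\<Sum>k<M. 3 * ((real k + 1)\<^sup>2 * prob {real k<..}))"
    by (subst Bochner_Integration.integral_sum) (auto simp: mult.assoc)
  also have "\<dots> \<le> (\<Sum>k<M. 3 * C)"
    using C by (intro sum_mono mult_left_mono) auto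
  also have "\<dots> = 3 * C * real M"
    by simp
  also have "\<dots> \<le> 3 * C * (t + 1)"
  proof (rule mult_left_mono)
    show "real M \<le> t + 1"
      unfolding M_def using assms(2) by linarith
    show "0 \<le> 3 * C"
      using a_pos by (simp add: C_def)
  qed
  finally show ?thesis
    unfolding C_def .
qed

section \<open>The critical exponent\<close>

lemma critical_bounded_in_probability:
  assumes \<alpha>: "\<alpha> = 2" and \<epsilon>: "0 < \<epsilon>"
  shows "\<exists>C::real. \<forall>n\<ge>1. measure (graph n) {E. C < real (clique_number {1..n} E)} \<le> \<epsilon>"
proof -
  define c where "c = 3 * (4 * a + (x\<^sub>0 + 2)\<^sup>2)"
  have c: "0 < c"
    using a_pos by (simp add: c_def add_pos_nonneg)
  have "((\<lambda>\<delta>. b ^ 6 * (c * (2 * \<delta>)) ^ 4) \<longlongrightarrow> b ^ 6 * (c * (2 * 0)) ^ 4) (at_right 0)"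
    by (intro tendsto_intros)
  then have "eventually (\<lambda>\<delta>. b ^ 6 * (c * (2 * \<delta>)) ^ 4 < \<epsilon> / 2) (at_right 0)"
    using \<epsilon> by (intro order_tendstoD(2)) auto
  then have "eventually (\<lambda>\<delta>. 0 < \<delta> \<and> b ^ 6 * (c * (2 * \<delta>)) ^ 4 < \<epsilon> / 2) (at_right 0)"
    using eventually_at_right_less[of 0] by eventually_elim simp
  then obtain \<delta> where \<delta>: "0 < \<delta>" "b ^ 6 * (c * (2 * \<delta>)) ^ 4 < \<epsilon> / 2"
    using eventually_happens'[of "at_right (0::real)"] by auto
  \<comment> \<open>At level \<open>\<delta> * sqrt n\<close> the mean number of heavy vertices is \<open>a / \<delta>\<^sup>2\<close>.\<close>
  obtain k :: nat where k: "2 * a / (\<delta>\<^sup>2 * \<epsilon>) \<le> real k"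
    using real_arch_simple by blast
  have "eventually (\<lambda>n. 1 \<le> \<delta> * sqrt (real n) \<and> x\<^sub>0 \<le> \<delta> * sqrt (real n) \<and> 1 \<le> n) sequentially"
    using \<delta>(1) by (intro eventually_conj; real_asymp)
  then obtain n\<^sub>0 where n\<^sub>0: "\<And>n. n\<^sub>0 \<le> n \<Longrightarrow> 1 \<le> \<delta> * sqrt (real n) \<and> x\<^sub>0 \<le> \<delta> * sqrt (real n) \<and> 1 \<le> n"
    by (auto simp: eventually_sequentially)
  have "measure (graph n) {E. real (max n\<^sub>0 (4 + k)) < real (clique_number {1..n} E)} \<le> \<epsilon>" for n
  proof (cases "n\<^sub>0 \<le> n")
    case False
    have "clique_number {1..n} E \<le> n" for E
      using clique_number_le_card[of "{1..n}" E] by simp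
    then have "{E. real (max n\<^sub>0 (4 + k)) < real (clique_number {1..n} E)} = {}"
      using False by (auto simp: not_less) (meson le_trans nat_le_linear)
    then show ?thesis
      using \<epsilon> by (simp only: measure_empty)
  next
    case True
    note n = n\<^sub>0[OF True]
    interpret G: prob_space "graph n"
      by (rule prob_space_graph)
    define t where "t = \<delta> * sqrt (real n)"
    have t: "0 \<le> t" "x\<^sub>0 \<le> t" "1 \<le> t" "0 < t"
      using n \<delta> by (auto simp: t_def)
    have sq: "0 < sqrt (real n)"
      using n by simp
    have "measure (graph n) {E. real (max n\<^sub>0 (4 + k)) < real (clique_number {1..n} E)} \<le>
        measure (graph n) {E. 4 + k \<le> clique_number {1..n} E}"
      by (intro G.finite_measure_mono) auto
    also have "\<dots> \<le> real n * prob {t<..} / (real k + 1) +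
        b ^ 6 * ((\<integral>x. x ^ 3 * indicator {..t} x \<partial>D) / sqrt (real n)) ^ 4"
      using t n by (intro measure_clique_number_ge_4_le) auto
    also have "\<dots> \<le> \<epsilon> / 2 + b ^ 6 * (c * (2 * \<delta>)) ^ 4"
    proof (intro add_mono mult_left_mono power_mono)
      have "prob {t<..} = a / t\<^sup>2"
        using tail[OF t(2)] \<alpha> t by (simp add: powr_minus powr_numeral divide_inverse)
      then have "real n * prob {t<..} = a / \<delta>\<^sup>2"
        using n by (simp add: t_def power_mult_distrib)
      moreover have "a / \<delta>\<^sup>2 \<le> \<epsilon> / 2 * (real k + 1)"
      proof -
        have "a / \<delta>\<^sup>2 = \<epsilon> / 2 * (2 * a / (\<delta>\<^sup>2 * \<epsilon>))"
          using \<epsilon> by simp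
        also have "\<dots> \<le> \<epsilon> / 2 * (real k + 1)"
          using k \<epsilon> by (intro mult_left_mono) auto
        finally show ?thesis .
      qed
      ultimately show "real n * prob {t<..} / (real k + 1) \<le> \<epsilon> / 2"
        by (simp only:) (subst pos_divide_le_eq, simp_all)
      have "(\<integral>x. x ^ 3 * indicator {..t} x \<partial>D) \<le> c * (t + 1)"
        unfolding c_def by (rule truncated_third_moment_le[OF \<alpha> t(1)])
      also have "\<dots> \<le> c * (2 * t)"
        using t c by (intro mult_left_mono) auto
      also have "\<dots> = c * (2 * \<delta>) * sqrt (real n)"
        by (simp add: t_def)
      finally show "(\<integral>x. x ^ 3 * indicator {..t} x \<partial>D) / sqrt (real n) \<le> c * (2 * \<delta>)"
        using sq by (simp add: divide_le_eq)
      show "0 \<le> (\<integral>x. x ^ 3 * indicator {..t} x \<partial>D) / sqrt (real n)"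
        using nonneg_D by (intro divide_nonneg_nonneg integral_nonneg_AE)
          (auto simp: indicator_def elim!: eventually_mono)
    qed (use b_pos in simp)
    also have "\<dots> \<le> \<epsilon>"
      using \<delta>(2) by simp
    finally show ?thesis .
  qed
  then show ?thesis
    by blast
qed

end

context weight_law
begin

text \<open>
  The heavy vertices form a binomial random subset of the vertices.
\<close>

lemma prob_heavy_eq:
  assumes "S \<subseteq> {1..n}"
  shows "measure (weights {1..n}) {w \<in> space (weights {1..n}). heavy n t w = S} =
    prob {t<..} ^ card S * (1 - prob {t<..}) ^ (n - card S)"
proof -
  let ?g = "\<lambda>i. if i \<in> S then indicator {t<..} else indicator {..t} :: real \<Rightarrow> real"
  have fin: "finite S"
    using assms finite_subset by blast
  have ind: "indicator {w \<in> space (weights {1..n}). heavy n t w = S} w = (\<Prod>i\<in>{1..n}. ?g i (w i))"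
    if "w \<in> space (weights {1..n})" for w
  proof (cases "heavy n t w = S")
    case True
    then have "?g i (w i) = 1" if "i \<in> {1..n}" for i
      using that by (auto simp: heavy_def)
    then show ?thesis
      using True that by simp
  next
    case False
    have "heavy n t w = S" if "\<forall>i\<in>{1..n}. (i \<in> S) = (t < w i)"
      using assms that by (auto simp: heavy_def)
    then obtain i where "i \<in> {1..n}" "(i \<in> S) \<noteq> (t < w i)"
      using False by blast
    then have "\<exists>i\<in>{1..n}. ?g i (w i) = 0"
      by (intro bexI[of _ i]) auto
    then have "(\<Prod>i\<in>{1..n}. ?g i (w i)) = 0"
      by (simp only: prod_zero_iff finite_atLeastAtMost)
    then show ?thesis
      using False by simp
  qed
  have g_int: "integrable D (?g i)" for i
    by (rule integrable_const_bound[where B = 1]) (auto simp: indicator_def)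
  have compl: "prob {..t} = 1 - prob {t<..}"
    using prob_compl[of "{t<..}"] by (simp add: Compl_eq_Diff_UNIV[symmetric] Compl_greaterThan)
  have "measure (weights {1..n}) {w \<in> space (weights {1..n}). heavy n t w = S} =
      (\<integral>w. indicator {w \<in> space (weights {1..n}). heavy n t w = S} w \<partial>weights {1..n})"
    by (simp add: Int_absorb2 subset_iff)
  also have "\<dots> = (\<integral>w. (\<Prod>i\<in>{1..n}. ?g i (w i)) \<partial>weights {1..n})"
    by (intro Bochner_Integration.integral_cong refl ind)
  also have "\<dots> = (\<Prod>i\<in>{1..n}. \<integral>x. ?g i x \<partial>D)"
    by (rule integral_weights_prod) (simp_all only: finite_atLeastAtMost order_refl g_int)
  also have "\<dots> = (\<Prod>i\<in>{1..n}. if i \<in> S then prob {t<..} else 1 - prob {t<..})"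
    by (intro prod.cong refl) (simp add: compl)
  also have "\<dots> = prob {t<..} ^ card ({1..n} \<inter> {i. i \<in> S}) * (1 - prob {t<..}) ^ card ({1..n} \<inter> - {i. i \<in> S})"
    by (simp add: prod.If_cases)
  also have "{1..n} \<inter> {i. i \<in> S} = S"
    using assms by auto
  also have "{1..n} \<inter> - {i. i \<in> S} = {1..n} - S"
    by auto
  also have "card ({1..n} - S) = n - card S"
    using assms fin by (simp add: card_Diff_subset)
  finally show ?thesis .
qed

text \<open>
  The event that exactly \<open>m\<close> vertices are heavy at level \<open>sqrt n\<close> has a binomial probability, and any
  two of these vertices are adjacent with probability at least \<open>1 - exp (- b)\<close>. In the binomial
  probability the exponent \<open>n - m\<close> is replaced by \<open>n\<close>.
\<close>

lemma clique_number_ge_lower: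
  assumes n: "m \<le> n" "1 \<le> n"
  shows "(1 - exp (- b)) ^ (m choose 2) *
      (real (n choose m) * (prob {sqrt (real n)<..} ^ m * (1 - prob {sqrt (real n)<..}) ^ n))
    \<le> measure (graph n) {E. m \<le> clique_number {1..n} E}"
proof -
  define t where "t = sqrt (real n)"
  define p where "p = prob {t<..}"
  \<comment> \<open>The events \<open>B S\<close> that \<open>S\<close> is the set of heavy vertices are disjoint for different \<open>S\<close>.\<close>
  define B where "B S = {w \<in> space (weights {1..n}). heavy n t w = S}" for S
  have B_sets [measurable]: "B S \<in> sets (weights {1..n})" for S
  proof -
    have "B S = {w \<in> space (weights {1..n}). \<forall>i\<in>{1..n}. (t < w i) = (i \<in> S)} \<inter> (if S \<subseteq> {1..n} then UNIV else {})"
      by (auto simp: B_def heavy_def)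
    moreover have "{w \<in> space (weights {1..n}). \<forall>i\<in>{1..n}. (t < w i) = (i \<in> S)} \<in> sets (weights {1..n})"
    proof (rule sets.sets_Collect_finite_All')
      fix i assume "i \<in> {1..n}"
      note [measurable] = measurable_weights_component[OF this]
      show "{w \<in> space (weights {1..n}). (t < w i) = (i \<in> S)} \<in> sets (weights {1..n})"
        by measurable
    qed (use n in auto)
    ultimately show ?thesis
      by simp
  qed
  let ?U = "\<Union>S\<in>[{1..n}]\<^bsup>m\<^esup>. B S"
  have "(1 - exp (- b)) ^ (m choose 2) * measure (weights {1..n}) ?U \<le>
      measure (graph n) {E. m \<le> clique_number {1..n} E}"
  proof (rule measure_graph_ge)
    show "?U \<in> sets (weights {1..n})"
      by (intro sets.finite_UN) auto
    fix w :: "nat \<Rightarrow> real"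
    assume w: "\<And>i. i \<in> {1..n} \<Longrightarrow> 0 \<le> w i" "w \<in> ?U"
    then obtain S where S: "S \<in> [{1..n}]\<^bsup>m\<^esup>" "heavy n t w = S"
      by (auto simp: B_def)
    then have S': "S \<subseteq> {1..n}" "finite S" "card S = m"
      by (auto simp: nsets_def)
    let ?K = "edges_given_weights b n w"
    have "(1 - exp (- b)) ^ (m choose 2) = (\<Prod>e\<in>[S]\<^bsup>2\<^esup>. 1 - exp (- b))"
      using S' by simp
    also have "\<dots> \<le> (\<Prod>e\<in>[S]\<^bsup>2\<^esup>. edge_prob b n w e)"
    proof (rule prod_mono)
      fix e assume e: "e \<in> [S]\<^bsup>2\<^esup>"
      have "(\<Prod>i\<in>e. t) \<le> (\<Prod>i\<in>e. w i)"
        using e S(2) by (intro prod_mono) (auto simp: nsets_def heavy_def subset_iff t_def less_imp_le)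
      then have "real n \<le> (\<Prod>i\<in>e. w i)"
        using e by (simp add: nsets_def t_def)
      then have "b * real n / real n \<le> b * (\<Prod>i\<in>e. w i) / real n"
        using b_pos by (intro divide_right_mono mult_left_mono) auto
      then show "0 \<le> 1 - exp (- b) \<and> 1 - exp (- b) \<le> edge_prob b n w e"
        using n b_pos by (simp add: edge_prob_def)
    qed
    also have "\<dots> = measure_pmf.prob ?K {E. [S]\<^bsup>2\<^esup> \<subseteq> E}"
      by (rule prob_given_weights_superset[symmetric])
         (use b_pos w(1) S' nsets_mono[of S "{1..n}"] in simp_all)
    also have "\<dots> \<le> measure_pmf.prob ?K {E. m \<le> clique_number {1..n} E}"
      using S' clique_number_ge_iff[of "{1..n}" m]
      by (intro measure_pmf.finite_measure_mono) (auto simp flip: clique_iff_nsets)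
    finally show "(1 - exp (- b)) ^ (m choose 2) \<le> measure_pmf.prob ?K {E. m \<le> clique_number {1..n} E}" .
  qed
  moreover have "measure (weights {1..n}) ?U = (\<Sum>S\<in>[{1..n}]\<^bsup>m\<^esup>. measure (weights {1..n}) (B S))"
    by (intro W.finite_measure_finite_Union) (use B_sets in auto, auto simp: disjoint_family_on_def B_def)
  moreover have "(\<Sum>S\<in>[{1..n}]\<^bsup>m\<^esup>. measure (weights {1..n}) (B S)) = (\<Sum>S\<in>[{1..n}]\<^bsup>m\<^esup>. p ^ m * (1 - p) ^ (n - m))"
    by (intro sum.cong refl) (auto simp: B_def p_def prob_heavy_eq nsets_def)
  moreover have "real (n choose m) * (p ^ m * (1 - p) ^ n) \<le> (\<Sum>S\<in>[{1..n}]\<^bsup>m\<^esup>. p ^ m * (1 - p) ^ (n - m))"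
    by (simp add: p_def) (intro mult_left_mono power_decreasing, auto)
  moreover have "0 \<le> (1 - exp (- b)) ^ (m choose 2)"
    using b_pos by simp
  ultimately have "(1 - exp (- b)) ^ (m choose 2) * (real (n choose m) * (p ^ m * (1 - p) ^ n)) \<le>
      measure (graph n) {E. m \<le> clique_number {1..n} E}"
    by (simp only:) (erule order_trans[OF mult_left_mono, rotated], assumption, assumption?)
  then show ?thesis
    by (simp only: p_def t_def)
qed

end

context pareto_law
begin

lemma critical_unbounded:
  assumes \<alpha>: "\<alpha> = 2"
  shows "\<not> (\<lambda>n. measure (graph n) {E. real (clique_number {1..n} E) \<le> C}) \<longlonglongrightarrow> 1"
proof
  assume lim: "(\<lambda>n. measure (graph n) {E. real (clique_number {1..n} E) \<le> C}) \<longlonglongrightarrow> 1"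
  define m where "m = nat \<lceil>C\<rceil> + 1"
  have m: "1 \<le> m" "C < real m"
    unfolding m_def by linarith+
  define d where "d = (1 - exp (- b)) ^ (m choose 2)"
  have d: "0 < d"
    using b_pos by (simp add: d_def)
  define u where "u n = d * ((a / real m) ^ m * (1 - a / real n) ^ n)" for n
  have "(\<lambda>n. (1 - a / real n) ^ n) \<longlonglongrightarrow> exp (- a)"
  proof (rule tendsto_one_minus_power)
    show "(\<lambda>n. real n * (a / real n)) \<longlonglongrightarrow> a" "(\<lambda>n. a / real n) \<longlonglongrightarrow> 0"
      by real_asymp+
  qed
  then have u: "u \<longlonglongrightarrow> d * ((a / real m) ^ m * exp (- a))"
    unfolding u_def by (intro tendsto_intros)
  have "eventually (\<lambda>n. x\<^sub>0 \<le> sqrt (real n)) sequentially"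
    by real_asymp
  then have "eventually (\<lambda>n. measure (graph n) {E. real (clique_number {1..n} E) \<le> C} \<le> 1 - u n) sequentially"
    using eventually_ge_at_top[of m] eventually_ge_at_top[of 1]
  proof eventually_elim
    case (elim n)
    interpret G: prob_space "graph n"
      by (rule prob_space_graph)
    define p where "p = prob {sqrt (real n)<..}"
    have p_eq: "p = a / real n"
      using tail[OF elim(1)] \<alpha> elim(3) by (simp add: p_def powr_minus powr_numeral divide_inverse)
    have p: "0 \<le> p" "p \<le> 1"
      by (auto simp: p_def)
    have "(a / real m) ^ m = (real n / real m) ^ m * p ^ m"
      using elim by (simp add: p_eq flip: power_mult_distrib)
    also have "\<dots> \<le> real (n choose m) * p ^ m"
      using p elim by (intro mult_right_mono binomial_ge_n_over_k_pow_k) auto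
    finally have "(a / real m) ^ m * (1 - p) ^ n \<le> real (n choose m) * p ^ m * (1 - p) ^ n"
      using p by (intro mult_right_mono) auto
    then have "u n \<le> d * (real (n choose m) * (p ^ m * (1 - p) ^ n))"
      unfolding u_def using d by (intro mult_left_mono) (auto simp: p_eq mult.assoc)
    also have "\<dots> \<le> measure (graph n) {E. m \<le> clique_number {1..n} E}"
      unfolding d_def p_def using elim by (intro clique_number_ge_lower) auto
    also have "\<dots> \<le> measure (graph n) (space (graph n) - {E. real (clique_number {1..n} E) \<le> C})"
      using m by (intro G.finite_measure_mono) auto
    also have "\<dots> = 1 - measure (graph n) {E. real (clique_number {1..n} E) \<le> C}"
      by (intro G.prob_compl) simp
    finally show ?case
      by simp
  qed
  then have "1 \<le> 1 - d * ((a / real m) ^ m * exp (- a))"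
    by (intro tendsto_le[OF _ tendsto_diff[OF tendsto_const u] lim]) auto
  moreover have "0 < d * ((a / real m) ^ m * exp (- a))"
    using d a_pos m by simp
  ultimately show False
    by simp
qed

end

section \<open>Subcritical exponents\<close>

text \<open>Deleting one endpoint of every missing edge inside \<open>H\<close> leaves a clique.\<close>

lemma card_le_clique_number_plus_missing:
  assumes "H \<subseteq> V" "finite V"
  shows "card H \<le> clique_number V E + card ([H]\<^bsup>2\<^esup> - E)"
proof -
  have fin: "finite H"
    using assms finite_subset by blast
  define f where "f e = (SOME i. i \<in> e)" for e :: "'a set"
  have f: "f e \<in> e" if "e \<in> [H]\<^bsup>2\<^esup>" for e
  proof -
    have "e \<noteq> {}"
      using that by (auto simp: nsets_def)
    then show ?thesis
      unfolding f_def by (simp add: some_in_eq)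
  qed
  define R where "R = f ` ([H]\<^bsup>2\<^esup> - E)"
  have "[H - R]\<^bsup>2\<^esup> \<subseteq> E"
  proof
    fix e assume e: "e \<in> [H - R]\<^bsup>2\<^esup>"
    then have eH: "e \<in> [H]\<^bsup>2\<^esup>"
      by (auto simp: nsets_def)
    show "e \<in> E"
    proof (rule ccontr)
      assume "e \<notin> E"
      then have "f e \<in> R"
        using eH by (auto simp: R_def)
      then show False
        using f[OF eH] e by (auto simp: nsets_def)
    qed
  qed
  then have "clique (H - R) E" "H - R \<subseteq> V"
    using assms(1) by (auto simp only: clique_iff_nsets)
  then have "card (H - R) \<le> clique_number V E"
    using clique_number_ge_iff[OF assms(2)] by blast
  moreover have "card R \<le> card ([H]\<^bsup>2\<^esup> - E)"
    unfolding R_def using fin by (intro card_image_le) auto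
  moreover have "card H \<le> card (H - R) + card R"
    using diff_card_le_card_Diff[of R H] fin by (simp add: R_def)
  ultimately show ?thesis
    by linarith
qed

text \<open>
  Markov's inequality for the number of missing edges inside \<open>H\<close>, where \<open>q\<close> bounds the conditional
  probability that a pair in \<open>H\<close> is missing; the number of pairs is bounded by the square of \<open>card H\<close>.
\<close>

lemma measure_missing_edges_le:
  assumes "b > 0" "\<And>i. i \<in> {1..n} \<Longrightarrow> 0 \<le> w i" "H \<subseteq> {1..n}" "0 < y" "0 \<le> q"
    and q: "\<And>e. e \<in> [H]\<^bsup>2\<^esup> \<Longrightarrow> exp (- (b * (\<Prod>i\<in>e. w i) / real n)) \<le> q"
  shows "measure_pmf.prob (edges_given_weights b n w) {E. y \<le> real (card ([H]\<^bsup>2\<^esup> - E))} \<le>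
    (real (card H))\<^sup>2 * q / y"
proof -
  let ?K = "edges_given_weights b n w"
  have fin: "finite H"
    using assms finite_subset by blast
  have card_eq: "real (card ([H]\<^bsup>2\<^esup> - E)) = (\<Sum>e\<in>[H]\<^bsup>2\<^esup>. indicator {E. {e} \<inter> E = {}} E)" for E
  proof -
    have "(\<Sum>e\<in>[H]\<^bsup>2\<^esup>. indicator {E. {e} \<inter> E = {}} E) = (\<Sum>e\<in>[H]\<^bsup>2\<^esup>. of_bool (e \<notin> E) :: real)"
      by (intro sum.cong refl) (auto simp: indicator_def)
    also have "\<dots> = real (card ([H]\<^bsup>2\<^esup> \<inter> {e. e \<notin> E}))"
      using fin by (simp add: of_bool_def sum.If_cases)
    also have "[H]\<^bsup>2\<^esup> \<inter> {e. e \<notin> E} = [H]\<^bsup>2\<^esup> - E"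
      by auto
    finally show ?thesis ..
  qed
  have int: "integrable (measure_pmf ?K) (\<lambda>E. indicator A E :: real)" for A
    by (rule measure_pmf.integrable_const_bound[where B = 1]) (auto simp: indicator_def)
  have "measure_pmf.prob ?K {E. y \<le> real (card ([H]\<^bsup>2\<^esup> - E))} \<le>
      (\<integral>E. real (card ([H]\<^bsup>2\<^esup> - E)) \<partial>measure_pmf ?K) / y"
  proof -
    have "integrable (measure_pmf ?K) (\<lambda>E. real (card ([H]\<^bsup>2\<^esup> - E)))"
      unfolding card_eq by (intro Bochner_Integration.integrable_sum int)
    from integral_Markov_inequality_measure[OF this, of UNIV y] show ?thesis
      using assms(4) by simp
  qed
  also have "(\<integral>E. real (card ([H]\<^bsup>2\<^esup> - E)) \<partial>measure_pmf ?K) / y \<le> (real (card H))\<^sup>2 * q / y"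
  proof (rule divide_right_mono)
    have "(\<integral>E. real (card ([H]\<^bsup>2\<^esup> - E)) \<partial>measure_pmf ?K) =
        (\<Sum>e\<in>[H]\<^bsup>2\<^esup>. measure_pmf.prob ?K {E. {e} \<inter> E = {}})"
      unfolding card_eq by (subst Bochner_Integration.integral_sum) (use int in auto)
    also have "\<dots> \<le> (\<Sum>e\<in>[H]\<^bsup>2\<^esup>. q)"
    proof (rule sum_mono)
      fix e assume e: "e \<in> [H]\<^bsup>2\<^esup>"
      have "measure_pmf.prob ?K {E. {e} \<inter> E = {}} = (\<Prod>e\<in>{e}. exp (- (b * (\<Prod>i\<in>e. w i) / real n)))"
        using assms e nsets_mono[OF assms(3), of 2] by (intro prob_given_weights_disjoint) auto
      also have "\<dots> \<le> q"
        using q[OF e] by simp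
      finally show "measure_pmf.prob ?K {E. {e} \<inter> E = {}} \<le> q" .
    qed
    also have "\<dots> = real (card H choose 2) * q"
      by simp
    also have "\<dots> \<le> (real (card H))\<^sup>2 * q"
      using assms(5) by (intro mult_right_mono) (simp_all add: real_choose_two power2_eq_square field_simps)
    finally show "(\<integral>E. real (card ([H]\<^bsup>2\<^esup> - E)) \<partial>measure_pmf ?K) \<le> (real (card H))\<^sup>2 * q" .
  qed (use assms(4) in simp)
  finally show ?thesis .
qed

context weight_law
begin

text \<open>
  The union bound over the sets of \<open>m\<close> light vertices; two light vertices are adjacent with probability
  at most \<open>1 - q \<le> exp (- q)\<close> for \<open>q = exp (- (b * t\<^sup>2 / n))\<close>.
\<close>

lemma light_clique_prob_le:
  assumes w: "\<And>i. i \<in> {1..n} \<Longrightarrow> 0 \<le> w i" and n: "1 \<le> n" and t: "0 \<le> t"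
  shows "measure_pmf.prob (edges_given_weights b n w)
      {E. \<exists>S\<in>[{1..n} - heavy n t w]\<^bsup>m\<^esup>. clique S E} \<le>
    real n ^ m * exp (- exp (- (b * t\<^sup>2 / real n)) * real (m choose 2))"
proof -
  let ?K = "edges_given_weights b n w" and ?L = "{1..n} - heavy n t w"
  define r where "r = exp (- exp (- (b * t\<^sup>2 / real n)))"
  have "{E. \<exists>S\<in>[?L]\<^bsup>m\<^esup>. clique S E} = (\<Union>S\<in>[?L]\<^bsup>m\<^esup>. {E. [S]\<^bsup>2\<^esup> \<subseteq> E})"
    by (auto simp: clique_iff_nsets)
  then have "measure_pmf.prob ?K {E. \<exists>S\<in>[?L]\<^bsup>m\<^esup>. clique S E} \<le>
      (\<Sum>S\<in>[?L]\<^bsup>m\<^esup>. measure_pmf.prob ?K {E. [S]\<^bsup>2\<^esup> \<subseteq> E})"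
    by (simp only:) (intro measure_pmf.finite_measure_subadditive_finite, auto)
  also have "\<dots> \<le> (\<Sum>S\<in>[?L]\<^bsup>m\<^esup>. r ^ (m choose 2))"
  proof (rule sum_mono)
    fix S assume S: "S \<in> [?L]\<^bsup>m\<^esup>"
    then have S': "S \<subseteq> {1..n}" "finite S" "card S = m"
      by (auto simp: nsets_def)
    have "measure_pmf.prob ?K {E. [S]\<^bsup>2\<^esup> \<subseteq> E} = (\<Prod>e\<in>[S]\<^bsup>2\<^esup>. edge_prob b n w e)"
      by (rule prob_given_weights_superset) (use b_pos w S' nsets_mono[of S "{1..n}"] in simp_all)
    also have "\<dots> \<le> (\<Prod>e\<in>[S]\<^bsup>2\<^esup>. r)"
    proof (rule prod_mono, intro conjI)
      fix e assume e: "e \<in> [S]\<^bsup>2\<^esup>"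
      have "e \<in> [{1..n}]\<^bsup>2\<^esup>"
        using e S' by (auto simp: nsets_def)
      then show "0 \<le> edge_prob b n w e"
        using b_pos w by (intro edge_prob_bounds)
      have "(\<Prod>i\<in>e. w i) \<le> (\<Prod>i\<in>e. t)"
      proof (rule prod_mono)
        fix i assume "i \<in> e"
        then have "i \<in> ?L"
          using e S by (auto simp: nsets_def)
        then show "0 \<le> w i \<and> w i \<le> t"
          using w[of i] by (auto simp: heavy_def)
      qed
      then have "(\<Prod>i\<in>e. w i) \<le> t\<^sup>2"
        using e by (simp add: nsets_def)
      then have "b * (\<Prod>i\<in>e. w i) / real n \<le> b * t\<^sup>2 / real n"
        using b_pos by (intro divide_right_mono mult_left_mono) auto
      then have "edge_prob b n w e \<le> 1 - exp (- (b * t\<^sup>2 / real n))"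
        by (simp add: edge_prob_def)
      also have "\<dots> \<le> r"
        unfolding r_def using exp_ge_add_one_self[of "- exp (- (b * t\<^sup>2 / real n))"] by simp
      finally show "edge_prob b n w e \<le> r" .
    qed
    also have "\<dots> = r ^ (m choose 2)"
      using S' by simp
    finally show "measure_pmf.prob ?K {E. [S]\<^bsup>2\<^esup> \<subseteq> E} \<le> r ^ (m choose 2)" .
  qed
  also have "\<dots> = real (card ?L choose m) * r ^ (m choose 2)"
    by simp
  also have "\<dots> \<le> real n ^ m * r ^ (m choose 2)"
  proof (rule mult_right_mono)
    have "card ?L choose m \<le> card ?L ^ m"
      by (cases "m \<le> card ?L") (auto intro: binomial_le_pow simp: binomial_eq_0)
    also have "\<dots> \<le> n ^ m"
      using card_mono[of "{1..n}" ?L] by (intro power_mono) auto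
    finally show "real (card ?L choose m) \<le> real n ^ m"
      by (metis of_nat_le_iff of_nat_power)
  qed (simp add: r_def)
  also have "r ^ (m choose 2) = exp (- exp (- (b * t\<^sup>2 / real n)) * real (m choose 2))"
    unfolding r_def by (simp flip: exp_of_nat_mult add: mult.commute)
  finally show ?thesis .
qed

end

context pareto_law
begin

text \<open>
  The order of magnitude of the clique number for \<open>\<alpha> < 2\<close>.
\<close>

definition clique_scale :: "nat \<Rightarrow> real" where
  "clique_scale n = real n powr (1 - \<alpha> / 2) * ln (real n) powr (- \<alpha> / 2)"

text \<open>
  The level separating heavy from light vertices for \<open>\<alpha> < 2\<close>: two vertices whose weights equal the
  level are non-adjacent with probability \<open>n powr (- (b * A\<^sup>2))\<close>, see \<open>level_square\<close>.
\<close>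

definition level :: "real \<Rightarrow> nat \<Rightarrow> real" where
  "level A n = A * sqrt (real n * ln (real n))"

lemma clique_scale_pos: "2 \<le> n \<Longrightarrow> 0 < clique_scale n"
  by (simp add: clique_scale_def)

lemma clique_scale_at_top:
  assumes "\<alpha> < 2"
  shows "filterlim clique_scale at_top sequentially"
proof -
  define d where "d = 1 - \<alpha> / 2"
  have d: "0 < d"
    using assms by (simp add: d_def)
  have "filterlim (\<lambda>n. real n powr d * ln (real n) powr (- \<alpha> / 2)) at_top sequentially"
    using d \<alpha>_pos by real_asymp
  then show ?thesis
    by (simp add: clique_scale_def[abs_def] d_def)
qed

lemma eventually_level_ge:
  assumes "0 < A"
  shows "eventually (\<lambda>n. x\<^sub>0 \<le> level A n \<and> 2 \<le> n) sequentially"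
  unfolding level_def using assms by (intro eventually_conj; real_asymp)

lemma mean_heavy_level:
  assumes "0 < A" "x\<^sub>0 \<le> level A n" "2 \<le> n"
  shows "real n * prob {level A n<..} = a * A powr (- \<alpha>) * clique_scale n"
proof -
  have ln: "0 < ln (real n)"
    using assms by simp
  have "level A n powr (- \<alpha>) = A powr (- \<alpha>) * ((real n * ln (real n)) powr (1 / 2)) powr (- \<alpha>)"
  proof -
    have "sqrt (real n * ln (real n)) = (real n * ln (real n)) powr (1 / 2)"
      using ln by (intro powr_half_sqrt[symmetric]) simp
    then show ?thesis
      unfolding level_def by (simp only: powr_mult)
  qed
  also have "((real n * ln (real n)) powr (1 / 2)) powr (- \<alpha>) =
      real n powr (- \<alpha> / 2) * ln (real n) powr (- \<alpha> / 2)"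
    using ln by (simp add: powr_powr powr_mult)
  also have "real n * (a * (A powr (- \<alpha>) * (real n powr (- \<alpha> / 2) * ln (real n) powr (- \<alpha> / 2)))) =
      a * A powr (- \<alpha>) * (real n powr 1 * real n powr (- \<alpha> / 2) * ln (real n) powr (- \<alpha> / 2))"
    using assms by simp
  also have "real n powr 1 * real n powr (- \<alpha> / 2) = real n powr (1 - \<alpha> / 2)"
    by (subst powr_add[symmetric]) simp
  finally show ?thesis
    using tail[OF assms(2)] by (simp add: clique_scale_def)
qed

lemma level_square:
  assumes "2 \<le> n"
  shows "b * (level A n)\<^sup>2 / real n = b * A\<^sup>2 * ln (real n)"
  using assms by (simp add: level_def power_mult_distrib)

text \<open>
  The weights for which the number of heavy vertices differs from its mean (given by
  \<open>mean_heavy_level\<close> for large \<open>n\<close>) by at least \<open>\<eta> * clique_scale n\<close>.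
\<close>

definition deviant :: "real \<Rightarrow> real \<Rightarrow> nat \<Rightarrow> (nat \<Rightarrow> real) set" where
  "deviant A \<eta> n = {w \<in> space (weights {1..n}).
     \<eta> * clique_scale n \<le> \<bar>real (card (heavy n (level A n) w)) - a * A powr (- \<alpha>) * clique_scale n\<bar>}"

lemma deviant_sets [measurable]: "deviant A \<eta> n \<in> sets (weights {1..n})"
  unfolding deviant_def by measurable

lemma measure_deviant_le:
  assumes "0 < A" "0 < \<eta>" "x\<^sub>0 \<le> level A n" "2 \<le> n"
  shows "measure (weights {1..n}) (deviant A \<eta> n) \<le> a * A powr (- \<alpha>) / \<eta>\<^sup>2 * inverse (clique_scale n)"
proof -
  have s: "0 < clique_scale n"
    using assms by (intro clique_scale_pos)
  have "measure (weights {1..n}) (deviant A \<eta> n) \<le> a * A powr (- \<alpha>) * clique_scale n / (\<eta> * clique_scale n)\<^sup>2"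
    using heavy_chebyshev[of "\<eta> * clique_scale n" n "level A n"] assms s
    unfolding deviant_def mean_heavy_level[OF assms(1,3,4)] by simp
  also have "\<dots> = a * A powr (- \<alpha>) / \<eta>\<^sup>2 * inverse (clique_scale n)"
    using s by (simp add: power2_eq_square divide_simps)
  finally show ?thesis .
qed

text \<open>
  Two light vertices are non-adjacent with probability at least \<open>n powr (- \<gamma>)\<close>, so the expected number
  of cliques on \<open>m\<close> of them is at most \<open>exp (m * (ln n - n powr (- \<gamma>) * (m - 1) / 2))\<close>. This is at most
  \<open>1 / n\<close> for the value of \<open>m\<close> below, which is negligible compared with \<open>clique_scale n\<close>.
\<close>

lemma subcritical_upper:
  assumes \<alpha>: "\<alpha> < 2" and A: "0 < A" "b * A\<^sup>2 < 1 - \<alpha> / 2" and \<eta>: "0 < \<eta>"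
  shows "(\<lambda>n. measure (graph n) {E. (a * A powr (- \<alpha>) + 2 * \<eta>) * clique_scale n < real (clique_number {1..n} E)}) \<longlonglongrightarrow> 0"
proof (rule tendsto_sandwich[OF _ _ tendsto_const])
  define \<gamma> where "\<gamma> = b * A\<^sup>2"
  define m where "m n = nat \<lceil>4 * real n powr \<gamma> * ln (real n)\<rceil> + 2" for n :: nat
  let ?u = "\<lambda>n. a * A powr (- \<alpha>) / \<eta>\<^sup>2 * inverse (clique_scale n) + 1 / real n"
  have "(\<lambda>n. inverse (clique_scale n)) \<longlonglongrightarrow> 0"
    by (rule tendsto_inverse_0_at_top[OF clique_scale_at_top[OF \<alpha>]])
  moreover have "(\<lambda>n. 1 / real n) \<longlonglongrightarrow> 0"
    by real_asymp
  ultimately have "?u \<longlonglongrightarrow> a * A powr (- \<alpha>) / \<eta>\<^sup>2 * 0 + 0"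
    by (intro tendsto_intros)
  then show "?u \<longlonglongrightarrow> 0"
    by simp
  have "eventually (\<lambda>n. 4 * real n powr \<gamma> * ln (real n) + 3 < \<eta> * clique_scale n) sequentially"
  proof -
    define d where "d = 1 - \<alpha> / 2"
    have "\<gamma> < d" "0 < \<gamma>"
      using A b_pos by (simp_all add: d_def \<gamma>_def)
    then have "eventually (\<lambda>n. 4 * real n powr \<gamma> * ln (real n) + 3 <
        \<eta> * (real n powr d * ln (real n) powr (- \<alpha> / 2))) sequentially"
      using \<eta> \<alpha>_pos by real_asymp
    then show ?thesis
      by (simp add: clique_scale_def d_def)
  qed
  then show "eventually (\<lambda>n. measure (graph n)
      {E. (a * A powr (- \<alpha>) + 2 * \<eta>) * clique_scale n < real (clique_number {1..n} E)} \<le> ?u n) sequentially"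
    using eventually_level_ge[OF A(1)]
  proof eventually_elim
    case (elim n)
    then have n: "x\<^sub>0 \<le> level A n" "2 \<le> n"
      by auto
    have ln: "0 < ln (real n)"
      using n by simp
    have m_ge: "4 * real n powr \<gamma> * ln (real n) \<le> real (m n) - 1" "2 \<le> m n"
      unfolding m_def by linarith+
    have "0 \<le> 4 * real n powr \<gamma> * ln (real n)"
      using ln by simp
    then have m_less: "real (m n) < \<eta> * clique_scale n"
      using elim(1) unfolding m_def by linarith
    have "measure (graph n) {E. (a * A powr (- \<alpha>) + 2 * \<eta>) * clique_scale n < real (clique_number {1..n} E)} \<le>
        measure (weights {1..n}) (deviant A \<eta> n) + 1 / real n"
    proof (rule measure_graph_le_bad)
      fix w :: "nat \<Rightarrow> real"
      assume w: "\<And>i. i \<in> {1..n} \<Longrightarrow> 0 \<le> w i" "w \<in> space (weights {1..n})" "w \<notin> deviant A \<eta> n"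
      let ?K = "edges_given_weights b n w" and ?H = "heavy n (level A n) w"
      have "\<bar>real (card ?H) - a * A powr (- \<alpha>) * clique_scale n\<bar> < \<eta> * clique_scale n"
        using w by (simp add: deviant_def)
      then have "real (card ?H + m n) \<le> (a * A powr (- \<alpha>) + 2 * \<eta>) * clique_scale n"
        using m_less by (simp add: algebra_simps)
      then have "{E. (a * A powr (- \<alpha>) + 2 * \<eta>) * clique_scale n < real (clique_number {1..n} E)} \<subseteq>
          {E. \<exists>S\<in>[{1..n} - ?H]\<^bsup>m n\<^esup>. clique S E}"
        by (auto intro!: light_clique_exists simp del: of_nat_add)
      then have "measure_pmf.prob ?K {E. (a * A powr (- \<alpha>) + 2 * \<eta>) * clique_scale n < real (clique_number {1..n} E)} \<le>
          measure_pmf.prob ?K {E. \<exists>S\<in>[{1..n} - ?H]\<^bsup>m n\<^esup>. clique S E}"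
        by (intro measure_pmf.finite_measure_mono) auto
      also have "\<dots> \<le> real n ^ m n * exp (- exp (- (b * (level A n)\<^sup>2 / real n)) * real (m n choose 2))"
        using w n x0_pos by (intro light_clique_prob_le) auto
      also have "exp (- (b * (level A n)\<^sup>2 / real n)) = real n powr (- \<gamma>)"
        unfolding level_square[OF n(2)] \<gamma>_def using n by (simp add: powr_def)
      also have "real n ^ m n * exp (- (real n powr (- \<gamma>)) * real (m n choose 2)) =
          exp (real (m n) * (ln (real n) - real n powr (- \<gamma>) * (real (m n) - 1) / 2))"
      proof -
        have "real n ^ m n = exp (real (m n) * ln (real n))"
          using n by (simp add: exp_of_nat_mult)
        then have "real n ^ m n * exp (- (real n powr (- \<gamma>)) * real (m n choose 2)) =
            exp (real (m n) * ln (real n) + (- (real n powr (- \<gamma>)) * real (m n choose 2)))"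
          by (simp only: exp_add)
        also have "real (m n) * ln (real n) + (- (real n powr (- \<gamma>)) * real (m n choose 2)) =
            real (m n) * (ln (real n) - real n powr (- \<gamma>) * (real (m n) - 1) / 2)"
          unfolding real_choose_two by (simp add: field_simps)
        finally show ?thesis .
      qed
      also have "\<dots> \<le> exp (1 * (- ln (real n)))"
      proof -
        have "real n powr (- \<gamma>) * (4 * real n powr \<gamma> * ln (real n)) \<le> real n powr (- \<gamma>) * (real (m n) - 1)"
          using m_ge by (intro mult_left_mono) auto
        moreover have "real n powr (- \<gamma>) * (4 * real n powr \<gamma> * ln (real n)) = 4 * ln (real n)"
          using n by (simp add: powr_minus)
        ultimately have "ln (real n) - real n powr (- \<gamma>) * (real (m n) - 1) / 2 \<le> - ln (real n)"
          by linarith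
        then have "real (m n) * (ln (real n) - real n powr (- \<gamma>) * (real (m n) - 1) / 2) \<le>
            real (m n) * (- ln (real n))"
          by (intro mult_left_mono) auto
        also have "\<dots> \<le> 1 * (- ln (real n))"
          using m_ge ln by (intro mult_right_mono_neg) auto
        finally show ?thesis
          by (simp only: exp_le_cancel_iff)
      qed
      also have "\<dots> = 1 / real n"
        using n by (simp add: exp_minus inverse_eq_divide)
      finally show "measure_pmf.prob ?K
          {E. (a * A powr (- \<alpha>) + 2 * \<eta>) * clique_scale n < real (clique_number {1..n} E)} \<le> 1 / real n" .
    qed simp_all
    also have "measure (weights {1..n}) (deviant A \<eta> n) \<le> a * A powr (- \<alpha>) / \<eta>\<^sup>2 * inverse (clique_scale n)"
      by (rule measure_deviant_le[OF A(1) \<eta> n])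
    finally show ?case
      by simp
  qed
qed auto

text \<open>
  With \<open>N\<close> heavy vertices, the expected number of missing edges between them is at most
  \<open>N\<^sup>2 * n powr (- \<gamma>)\<close>. As \<open>N\<close> is of order \<open>clique_scale n\<close> and \<open>\<gamma> > 1 - \<alpha> / 2\<close>, this is negligible
  compared with \<open>N\<close>.
\<close>

lemma subcritical_lower:
  assumes \<alpha>: "\<alpha> < 2" and A: "0 < A" "1 - \<alpha> / 2 < b * A\<^sup>2" and \<eta>: "0 < \<eta>"
  shows "(\<lambda>n. measure (graph n) {E. real (clique_number {1..n} E) < (a * A powr (- \<alpha>) - 2 * \<eta>) * clique_scale n}) \<longlonglongrightarrow> 0"
proof (rule tendsto_sandwich[OF _ _ tendsto_const])
  define \<gamma> where "\<gamma> = b * A\<^sup>2"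
  define M where "M = a * A powr (- \<alpha>)"
  have M: "0 < M"
    using a_pos A by (simp add: M_def)
  let ?u = "\<lambda>n. M / \<eta>\<^sup>2 * inverse (clique_scale n) + (M + \<eta>)\<^sup>2 / \<eta> * (clique_scale n * real n powr (- \<gamma>))"
  have inv0: "(\<lambda>n. inverse (clique_scale n)) \<longlonglongrightarrow> 0"
    by (rule tendsto_inverse_0_at_top[OF clique_scale_at_top[OF \<alpha>]])
  have "(\<lambda>n. clique_scale n * real n powr (- \<gamma>)) \<longlonglongrightarrow> 0"
  proof -
    define d where "d = 1 - \<alpha> / 2"
    have "d < \<gamma>"
      using A by (simp add: d_def \<gamma>_def)
    then have "(\<lambda>n. real n powr d * ln (real n) powr (- \<alpha> / 2) * real n powr (- \<gamma>)) \<longlonglongrightarrow> 0"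
      using \<alpha>_pos by real_asymp
    then show ?thesis
      by (simp add: clique_scale_def d_def)
  qed
  then have "?u \<longlonglongrightarrow> M / \<eta>\<^sup>2 * 0 + (M + \<eta>)\<^sup>2 / \<eta> * 0"
    by (intro tendsto_intros inv0)
  then show "?u \<longlonglongrightarrow> 0"
    by simp
  show "eventually (\<lambda>n. measure (graph n)
      {E. real (clique_number {1..n} E) < (a * A powr (- \<alpha>) - 2 * \<eta>) * clique_scale n} \<le> ?u n) sequentially"
    using eventually_level_ge[OF A(1)]
  proof eventually_elim
    case (elim n)
    then have n: "x\<^sub>0 \<le> level A n" "2 \<le> n"
      by auto
    have s: "0 < clique_scale n"
      by (rule clique_scale_pos[OF n(2)])
    let ?d = "(M + \<eta>)\<^sup>2 / \<eta> * (clique_scale n * real n powr (- \<gamma>))"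
    have "measure (graph n) {E. real (clique_number {1..n} E) < (a * A powr (- \<alpha>) - 2 * \<eta>) * clique_scale n} \<le>
        measure (weights {1..n}) (deviant A \<eta> n) + ?d"
    proof (rule measure_graph_le_bad)
      show "0 \<le> ?d"
        using \<eta> s by simp
      fix w :: "nat \<Rightarrow> real"
      assume w: "\<And>i. i \<in> {1..n} \<Longrightarrow> 0 \<le> w i" "w \<in> space (weights {1..n})" "w \<notin> deviant A \<eta> n"
      let ?K = "edges_given_weights b n w" and ?H = "heavy n (level A n) w"
      have "\<bar>real (card ?H) - M * clique_scale n\<bar> < \<eta> * clique_scale n"
        using w by (simp add: deviant_def M_def)
      then have H: "real (card ?H) \<le> (M + \<eta>) * clique_scale n" "(M - \<eta>) * clique_scale n \<le> real (card ?H)"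
        by (simp_all add: algebra_simps)
      have "{E. real (clique_number {1..n} E) < (M - 2 * \<eta>) * clique_scale n} \<subseteq>
          {E. \<eta> * clique_scale n \<le> real (card ([?H]\<^bsup>2\<^esup> - E))}"
      proof clarify
        fix E assume E: "real (clique_number {1..n} E) < (M - 2 * \<eta>) * clique_scale n"
        have "real (card ?H) \<le> real (clique_number {1..n} E) + real (card ([?H]\<^bsup>2\<^esup> - E))"
          using card_le_clique_number_plus_missing[OF heavy_subset[of n "level A n" w] finite_atLeastAtMost, of E]
          by (simp flip: of_nat_add)
        then show "\<eta> * clique_scale n \<le> real (card ([?H]\<^bsup>2\<^esup> - E))"
          using E H(2) by (simp add: algebra_simps)
      qed
      then have "measure_pmf.prob ?K {E. real (clique_number {1..n} E) < (M - 2 * \<eta>) * clique_scale n} \<le>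
          measure_pmf.prob ?K {E. \<eta> * clique_scale n \<le> real (card ([?H]\<^bsup>2\<^esup> - E))}"
        by (intro measure_pmf.finite_measure_mono) auto
      also have "\<dots> \<le> (real (card ?H))\<^sup>2 * real n powr (- \<gamma>) / (\<eta> * clique_scale n)"
      proof (rule measure_missing_edges_le)
        fix e assume e: "e \<in> [?H]\<^bsup>2\<^esup>"
        have "(\<Prod>i\<in>e. level A n) \<le> (\<Prod>i\<in>e. w i)"
          using e n x0_pos by (intro prod_mono) (auto simp: nsets_def heavy_def subset_iff less_imp_le)
        then have "(level A n)\<^sup>2 \<le> (\<Prod>i\<in>e. w i)"
          using e by (simp add: nsets_def)
        then have "b * (level A n)\<^sup>2 / real n \<le> b * (\<Prod>i\<in>e. w i) / real n"
          using b_pos by (intro divide_right_mono mult_left_mono) auto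
        then have "exp (- (b * (\<Prod>i\<in>e. w i) / real n)) \<le> exp (- (b * A\<^sup>2 * ln (real n)))"
          unfolding level_square[OF n(2)] by simp
        also have "\<dots> = real n powr (- \<gamma>)"
          using n by (simp add: \<gamma>_def powr_def)
        finally show "exp (- (b * (\<Prod>i\<in>e. w i) / real n)) \<le> real n powr (- \<gamma>)" .
      qed (use b_pos w \<eta> s heavy_subset in auto)
      also have "\<dots> \<le> ((M + \<eta>) * clique_scale n)\<^sup>2 * real n powr (- \<gamma>) / (\<eta> * clique_scale n)"
        using H(1) \<eta> s by (intro divide_right_mono mult_right_mono power_mono) auto
      also have "\<dots> = ?d"
        using s \<eta> by (simp add: power2_eq_square divide_simps)
      finally show "measure_pmf.prob ?K
          {E. real (clique_number {1..n} E) < (a * A powr (- \<alpha>) - 2 * \<eta>) * clique_scale n} \<le> ?d"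
        by (simp add: M_def)
    qed simp
    also have "measure (weights {1..n}) (deviant A \<eta> n) \<le> M / \<eta>\<^sup>2 * inverse (clique_scale n)"
      unfolding M_def by (rule measure_deviant_le[OF A(1) \<eta> n])
    finally show ?case
      by simp
  qed
qed auto

lemma subcritical_concentration:
  assumes \<alpha>: "\<alpha> < 2"
  defines "c \<equiv> a * b powr (\<alpha> / 2) * (1 - \<alpha> / 2) powr (- \<alpha> / 2)"
  defines "Z \<equiv> \<lambda>n E. real (clique_number {1..n} E) / clique_scale n - c"
  shows "op1 graph Z"
  unfolding op1_def
proof (intro conjI allI impI)
  show "Z n \<in> borel_measurable (graph n)" for n
    by (simp add: measurable_def)
next
  fix \<epsilon> :: real assume \<epsilon>: "0 < \<epsilon>"
  \<comment> \<open>The threshold, at which the upper and the lower bound have the same constant \<open>c\<close>.\<close>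
  define A\<^sub>0 where "A\<^sub>0 = sqrt ((1 - \<alpha> / 2) / b)"
  have A0: "0 < A\<^sub>0"
    using \<alpha> b_pos by (simp add: A\<^sub>0_def)
  have A0_sq: "b * A\<^sub>0\<^sup>2 = 1 - \<alpha> / 2"
    using \<alpha> b_pos by (simp add: A\<^sub>0_def)
  have c_eq: "a * A\<^sub>0 powr (- \<alpha>) = c"
  proof -
    have "A\<^sub>0 powr (- \<alpha>) = (((1 - \<alpha> / 2) / b) powr (1 / 2)) powr (- \<alpha>)"
      unfolding A\<^sub>0_def using \<alpha> b_pos by (simp add: powr_half_sqrt)
    also have "\<dots> = ((1 - \<alpha> / 2) / b) powr (- \<alpha> / 2)"
      by (simp add: powr_powr)
    also have "\<dots> = b powr (\<alpha> / 2) * (1 - \<alpha> / 2) powr (- \<alpha> / 2)"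
    proof -
      have "(u / b) powr (- s) = b powr s * u powr (- s)" if "0 < u" for u s
        using that b_pos by (simp add: powr_divide powr_minus field_simps)
      from this[of "1 - \<alpha> / 2" "\<alpha> / 2"] show ?thesis
        using \<alpha> by (simp only: minus_divide_left)
    qed
    finally show ?thesis
      by (simp add: c_def)
  qed
  have cont: "((\<lambda>A. a * A powr (- \<alpha>)) \<longlongrightarrow> c) (at A\<^sub>0)"
    unfolding c_eq[symmetric] using A0 by (intro tendsto_intros) auto
  have "((\<lambda>A. a * A powr (- \<alpha>)) \<longlongrightarrow> c) (at_left A\<^sub>0)"
    by (rule tendsto_mono[OF at_le cont]) simp
  then have "eventually (\<lambda>A. a * A powr (- \<alpha>) < c + \<epsilon> / 2) (at_left A\<^sub>0)"
    using \<epsilon> by (intro order_tendstoD(2)) auto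
  then have "eventually (\<lambda>A. a * A powr (- \<alpha>) < c + \<epsilon> / 2 \<and> 0 < A \<and> A < A\<^sub>0) (at_left A\<^sub>0)"
    using eventually_at_left_real[OF A0] by eventually_elim simp
  then obtain A\<^sub>1 where A1: "a * A\<^sub>1 powr (- \<alpha>) < c + \<epsilon> / 2" "0 < A\<^sub>1" "A\<^sub>1 < A\<^sub>0"
    using eventually_happens'[of "at_left A\<^sub>0"] by auto
  have "((\<lambda>A. a * A powr (- \<alpha>)) \<longlongrightarrow> c) (at_right A\<^sub>0)"
    by (rule tendsto_mono[OF at_le cont]) simp
  then have "eventually (\<lambda>A. c - \<epsilon> / 2 < a * A powr (- \<alpha>)) (at_right A\<^sub>0)"
    using \<epsilon> by (intro order_tendstoD(1)) auto
  then have "eventually (\<lambda>A. c - \<epsilon> / 2 < a * A powr (- \<alpha>) \<and> A\<^sub>0 < A) (at_right A\<^sub>0)"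
    using eventually_at_right_less[of A\<^sub>0] by eventually_elim simp
  then obtain A\<^sub>2 where A2: "c - \<epsilon> / 2 < a * A\<^sub>2 powr (- \<alpha>)" "A\<^sub>0 < A\<^sub>2"
    using eventually_happens'[of "at_right A\<^sub>0"] by auto
  have sq1: "b * A\<^sub>1\<^sup>2 < 1 - \<alpha> / 2"
    unfolding A0_sq[symmetric] using A1 b_pos by (intro mult_strict_left_mono power_strict_mono) auto
  have sq2: "1 - \<alpha> / 2 < b * A\<^sub>2\<^sup>2"
    unfolding A0_sq[symmetric] using A2 A0 b_pos by (intro mult_strict_left_mono power_strict_mono) auto
  let ?U = "\<lambda>n. {E. (a * A\<^sub>1 powr (- \<alpha>) + 2 * (\<epsilon> / 4)) * clique_scale n < real (clique_number {1..n} E)}"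
  let ?L = "\<lambda>n. {E. real (clique_number {1..n} E) < (a * A\<^sub>2 powr (- \<alpha>) - 2 * (\<epsilon> / 4)) * clique_scale n}"
  show "(\<lambda>n. measure (graph n) {E \<in> space (graph n). \<epsilon> < \<bar>Z n E\<bar>}) \<longlonglongrightarrow> 0"
  proof (rule tendsto_sandwich[OF _ _ tendsto_const])
    have "(\<lambda>n. measure (graph n) (?U n) + measure (graph n) (?L n)) \<longlonglongrightarrow> 0 + 0"
      by (intro tendsto_add subcritical_upper subcritical_lower)
         (use \<alpha> A0 A1 A2 sq1 sq2 \<epsilon> in auto)
    then show "(\<lambda>n. measure (graph n) (?U n) + measure (graph n) (?L n)) \<longlonglongrightarrow> 0"
      by simp
    show "eventually (\<lambda>n. measure (graph n) {E \<in> space (graph n). \<epsilon> < \<bar>Z n E\<bar>} \<le>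
        measure (graph n) (?U n) + measure (graph n) (?L n)) sequentially"
      using eventually_ge_at_top[of 2]
    proof eventually_elim
      case (elim n)
      interpret G: prob_space "graph n"
        by (rule prob_space_graph)
      have s: "0 < clique_scale n"
        by (rule clique_scale_pos[OF elim])
      have "{E \<in> space (graph n). \<epsilon> < \<bar>Z n E\<bar>} \<subseteq> ?U n \<union> ?L n"
      proof clarify
        fix E assume E: "\<epsilon> < \<bar>Z n E\<bar>" "\<not> real (clique_number {1..n} E) < (a * A\<^sub>2 powr (- \<alpha>) - 2 * (\<epsilon> / 4)) * clique_scale n"
        let ?r = "real (clique_number {1..n} E) / clique_scale n"
        have "a * A\<^sub>2 powr (- \<alpha>) - 2 * (\<epsilon> / 4) \<le> ?r"
          using E(2) s by (simp add: pos_le_divide_eq)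
        then have "c + \<epsilon> < ?r"
          using E(1) A2(1) unfolding Z_def by linarith
        then have "a * A\<^sub>1 powr (- \<alpha>) + 2 * (\<epsilon> / 4) < ?r"
          using A1(1) by linarith
        then show "(a * A\<^sub>1 powr (- \<alpha>) + 2 * (\<epsilon> / 4)) * clique_scale n < real (clique_number {1..n} E)"
          using s by (simp add: pos_less_divide_eq)
      qed
      then have "measure (graph n) {E \<in> space (graph n). \<epsilon> < \<bar>Z n E\<bar>} \<le> measure (graph n) (?U n \<union> ?L n)"
        by (intro G.finite_measure_mono) auto
      also have "\<dots> \<le> measure (graph n) (?U n) + measure (graph n) (?L n)"
        by (intro measure_Un_le) auto
      finally show ?case .
    qed
  qed auto
qed

section \<open>Supercritical exponents\<close>

lemma supercritical_limits:
  assumes "2 < \<alpha>"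
  defines "p \<equiv> exp (- ((b * (\<integral>x. x\<^sup>2 \<partial>D)) ^ 3 / 6))"
  shows "(\<lambda>n. measure (graph n) {E. clique_number {1..n} E \<in> {2, 3}}) \<longlonglongrightarrow> 1"
    and "(\<lambda>n. measure (graph n) {E. clique_number {1..n} E = 2}) \<longlonglongrightarrow> p"
    and "(\<lambda>n. measure (graph n) {E. clique_number {1..n} E = 3}) \<longlonglongrightarrow> 1 - p"
proof -
  note int2 = integrable_square[OF assms(1)]
  let ?le1 = "\<lambda>n. measure (graph n) {E. clique_number {1..n} E \<le> 1}"
  let ?ge4 = "\<lambda>n. measure (graph n) {E. 4 \<le> clique_number {1..n} E}"
  let ?le2 = "\<lambda>n. measure (graph n) {E. clique_number {1..n} E \<le> 2}"
  have le1: "?le1 \<longlonglongrightarrow> 0"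
    by (rule no_edge_tendsto[OF x0_pos prob_x0_pos])
  have ge4: "?ge4 \<longlonglongrightarrow> 0"
    by (rule no_four_clique[OF int2])
  have "(\<forall>T\<in>[{1..n}]\<^bsup>3\<^esup>. \<not> clique T E) \<longleftrightarrow> clique_number {1..n} E \<le> 2"
    for n and E :: "nat set set"
  proof -
    have "(\<forall>T\<in>[{1..n}]\<^bsup>3\<^esup>. \<not> clique T E) \<longleftrightarrow> \<not> 3 \<le> clique_number {1..n} E"
    proof -
      have "S \<in> [{1..n}]\<^bsup>3\<^esup> \<longleftrightarrow> S \<subseteq> {1..n} \<and> card S = 3" for S
        using finite_subset[OF _ finite_atLeastAtMost, of S 1 n] by (auto simp: nsets_def)
      then show ?thesis
        by (simp only: clique_number_ge_iff[OF finite_atLeastAtMost]) blast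
    qed
    then show ?thesis
      by auto
  qed
  then have le2: "?le2 \<longlonglongrightarrow> p"
    using triangle_free_tendsto[OF int2] by (simp add: p_def)
  have split: "measure (graph n) {E. P (clique_number {1..n} E) \<or> Q (clique_number {1..n} E)} =
      measure (graph n) {E. P (clique_number {1..n} E)} + measure (graph n) {E. Q (clique_number {1..n} E)}"
    if "\<And>k. P k \<Longrightarrow> \<not> Q k" for n and P Q :: "nat \<Rightarrow> bool"
  proof -
    interpret G: prob_space "graph n"
      by (rule prob_space_graph)
    show ?thesis
      unfolding Collect_disj_eq using that by (intro G.finite_measure_Union) auto
  qed
  have total: "measure (graph n) {E. True} = 1" for n
    using prob_space.prob_space[OF prob_space_graph[of n]] by simp
  have eq2: "measure (graph n) {E. clique_number {1..n} E = 2} = ?le2 n - ?le1 n" for n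
  proof -
    have "(k \<le> 1 \<or> k = 2) = (k \<le> 2)" for k :: nat
      by auto
    then show ?thesis
      using split[of "\<lambda>k. k \<le> 1" "\<lambda>k. k = 2" n] by simp
  qed
  have eq3: "measure (graph n) {E. clique_number {1..n} E = 3} = 1 - ?le2 n - ?ge4 n" for n
  proof -
    have "(k \<le> 2 \<or> k = 3 \<or> 4 \<le> k) = True" for k :: nat
      by auto
    then show ?thesis
      using split[of "\<lambda>k. k \<le> 2" "\<lambda>k. k = 3 \<or> 4 \<le> k" n] split[of "\<lambda>k. k = 3" "\<lambda>k. 4 \<le> k" n] total[of n]
      by simp
  qed
  have "(\<lambda>n. ?le2 n - ?le1 n) \<longlonglongrightarrow> p - 0"
    by (intro tendsto_diff le1 le2)
  then show l2: "(\<lambda>n. measure (graph n) {E. clique_number {1..n} E = 2}) \<longlonglongrightarrow> p"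
    by (simp add: eq2)
  have "(\<lambda>n. 1 - ?le2 n - ?ge4 n) \<longlonglongrightarrow> 1 - p - 0"
    by (intro tendsto_diff tendsto_const le2 ge4)
  then show l3: "(\<lambda>n. measure (graph n) {E. clique_number {1..n} E = 3}) \<longlonglongrightarrow> 1 - p"
    by (simp add: eq3)
  have "measure (graph n) {E. clique_number {1..n} E \<in> {2, 3}} =
      measure (graph n) {E. clique_number {1..n} E = 2} + measure (graph n) {E. clique_number {1..n} E = 3}" for n
    using split[of "\<lambda>k. k = 2" "\<lambda>k. k = 3" n] by simp
  then show "(\<lambda>n. measure (graph n) {E. clique_number {1..n} E \<in> {2, 3}}) \<longlonglongrightarrow> 1"
    using tendsto_add[OF l2 l3] by simp
qed

end

section \<open>The clique number in the three regimes\<close>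

theorem theorem1:
  fixes \<Omega> :: "'a measure" and W :: "'a \<Rightarrow> real" and \<alpha> a b x\<^sub>0 :: real
  assumes "\<alpha> > 0" and "a > 0" and "b > 0" and "x\<^sub>0 > 0"
    and "prob_space \<Omega>" and "W \<in> borel_measurable \<Omega>"
    and "AE t in \<Omega>. W t \<ge> 0"
    and "\<And>x. x \<ge> x\<^sub>0 \<Longrightarrow> measure \<Omega> {t \<in> space \<Omega>. W t > x} = a * x powr (- \<alpha>)"
  shows
    "let G = (\<lambda>n. weighted_random_graph (distr \<Omega> borel W) b n);
         \<omega> = (\<lambda>n E. clique_number {1..n} E);
         c = a * b powr (\<alpha> / 2) * (1 - \<alpha> / 2) powr (- \<alpha> / 2);
         p = exp (- (1 / 6) * (b * (\<integral>t. (W t)\<^sup>2 \<partial>\<Omega>)) ^ 3)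
     in
       (\<alpha> < 2 \<longrightarrow>
         (\<exists>Z. op1 G Z \<and>
           (\<forall>n\<ge>2. \<forall>E\<in>space (G n).
              real (\<omega> n E) =
                (c + Z n E) * (real n powr (1 - \<alpha> / 2) * ln (real n) powr (- \<alpha> / 2)))))
     \<and> (\<alpha> = 2 \<longrightarrow>
         (\<forall>\<epsilon>>0. \<exists>C::real. \<forall>n\<ge>1. measure (G n) {E \<in> space (G n). real (\<omega> n E) > C} \<le> \<epsilon>) \<and>
         \<not> (\<exists>C::real. (\<lambda>n. measure (G n) {E \<in> space (G n). real (\<omega> n E) \<le> C}) \<longlonglongrightarrow> 1))
     \<and> (\<alpha> > 2 \<longrightarrow>
         (\<lambda>n. measure (G n) {E \<in> space (G n). \<omega> n E \<in> {2, 3}}) \<longlonglongrightarrow> 1 \<and>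
         (\<lambda>n. measure (G n) {E \<in> space (G n). \<omega> n E = 2}) \<longlonglongrightarrow> p \<and>
         (\<lambda>n. measure (G n) {E \<in> space (G n). \<omega> n E = 3}) \<longlonglongrightarrow> 1 - p \<and>
         0 < p \<and> 0 < 1 - p)"
proof -
  interpret \<Omega>: prob_space \<Omega>
    by fact
  interpret D: prob_space "distr \<Omega> borel W"
    by (rule \<Omega>.prob_space_distr) fact
  interpret pareto_law "distr \<Omega> borel W" b a \<alpha> x\<^sub>0
  proof
    show "AE x in distr \<Omega> borel W. 0 \<le> x"
      using assms(6,7) by (subst AE_distr_iff) auto
    show "measure (distr \<Omega> borel W) {x<..} = a * x powr (- \<alpha>)" if "x\<^sub>0 \<le> x" for x
    proof -
      have "W -` {x<..} \<inter> space \<Omega> = {t \<in> space \<Omega>. W t > x}"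
        by auto
      then show ?thesis
        using assms(6) assms(8)[OF that] by (subst measure_distr) auto
    qed
  qed (use assms in auto)
  have moment: "(\<integral>x. x\<^sup>2 \<partial>distr \<Omega> borel W) = (\<integral>t. (W t)\<^sup>2 \<partial>\<Omega>)"
    using assms(6) by (intro integral_distr) auto
  define c where "c = a * b powr (\<alpha> / 2) * (1 - \<alpha> / 2) powr (- \<alpha> / 2)"
  define p where "p = exp (- (1 / 6) * (b * (\<integral>t. (W t)\<^sup>2 \<partial>\<Omega>)) ^ 3)"
  have p_eq: "p = exp (- ((b * (\<integral>x. x\<^sup>2 \<partial>distr \<Omega> borel W)) ^ 3 / 6))"
    by (simp add: p_def moment)
  have i: "\<exists>Z. op1 graph Z \<and> (\<forall>n\<ge>2. \<forall>E\<in>space (graph n). real (clique_number {1..n} E) =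
      (c + Z n E) * (real n powr (1 - \<alpha> / 2) * ln (real n) powr (- \<alpha> / 2)))" if "\<alpha> < 2"
  proof (intro exI conjI allI impI ballI)
    show "op1 graph (\<lambda>n E. real (clique_number {1..n} E) / clique_scale n - c)"
      unfolding c_def by (rule subcritical_concentration[OF that])
    show "real (clique_number {1..n} E) = (c + (real (clique_number {1..n} E) / clique_scale n - c)) *
        (real n powr (1 - \<alpha> / 2) * ln (real n) powr (- \<alpha> / 2))" if "2 \<le> n" for n E
      using clique_scale_pos[OF that] unfolding clique_scale_def[symmetric] by simp
  qed
  have iii: "0 < p \<and> 0 < 1 - p" if "2 < \<alpha>"
    using second_moment_pos[OF integrable_square[OF that]] b_pos by (simp add: p_eq)
  show ?thesis
    unfolding Let_def c_def[symmetric] p_def[symmetric]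
    using i iii critical_bounded_in_probability critical_unbounded
      supercritical_limits[folded p_eq] by (simp del: One_nat_def)
qed

end
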